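(* Let $(B,y)$ be a connected, locally path-connected, semi-locally simply connected pointed space, and let $p\colon(E,x)\to(B,y)$ be a normal extension with respect to the Galois structure $\Gamma$ on pointed locally connected spaces given by $\pi_0\dashv\mathrm{Dis}$, étale maps and all maps of pointed sets. Let $(F,x)$ be the kernel of $p$, i.e. the fibre $p^{-1}(y)$ with base-point $x$. Then there is an exact sequence of pointed sets $$0\to\pi_1(E,x)\to\pi_1(B,y)\to\pi_0(F,x)\to\pi_0(E,x)\to 0,$$ which is the low-dimensional part of the usual exact homotopy sequence induced by the fibration $(F,x)\to(E,x)\to(B,y)$, and in which the morphism $\pi_1(B,y)\to\pi_0(F,x)=(F,x)$ is the $p$-component $\delta_p$ of the natural transformation $\delta\colon\pi_1(-,\pi_0)\circ\mathrm{Cod}\Rightarrow\mathrm{Ker}$.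
   Context: **The Galois structure.** $\mathsf{LoCo}_*$ is the category of pointed locally connected topological spaces, $\mathsf{Set}_*$ that of pointed sets; $I=\pi_0\colon\mathsf{LoCo}_*\to\mathsf{Set}_*$ is the connected components functor, left adjoint to the discrete topology functor $H=\mathrm{Dis}$, with unit $\eta$. $\mathcal{E}$ is the class of base-point preserving étale maps (local homeomorphisms) and $\mathcal{F}$ the class of all base-point preserving maps of pointed sets. For this $\Gamma$, the monadic extensions (maps $p\in\mathcal{E}$ for which the pullback functor $p^*\colon(\mathcal{E}\downarrow B)\to(\mathcal{E}\downarrow E)$ between the full subcategories of the slice categories on maps in $\mathcal{E}$ is monadic) are the surjective local homeomorphisms; a trivial covering is $f\colon A\to B$ in $\mathcal{E}$ whose naturality square for $\eta$ is a pullback. A normal extension is a monadic extension whose kernel pair projections are trivial coverings. **Notation.** $0$ denotes the one-point pointed set. Fibres of normal extensions are discrete, so $(F,x)=\pi_0(F,x)$ as pointed sets, and $\mathrm{Ker}(p)=(F,x)$. $\pi_1$ is the classical Poincaré fundamental group. **The functor $\pi_1(-,\pi_0)$ and $\delta$.** Every $(B,y)$ as in the claim has a universal covering map $u\colon(U,w)\to(B,y)$, with $U$ connected and simply connected; it is an initial object among the normal extensions of $(B,y)$. The categorical fundamental group $\pi_1((B,y),\pi_0)$ is the Galois group of $u$, with underlying pointed set $\mathrm{Ker}(u)\cap\mathrm{Ker}(\eta_U)=\mathrm{Ker}(u)=(u^{-1}(y),w)$ (as $U$ is connected), and it is the classical fundamental group $\pi_1(B,y)$ (an element $[\omega]$ corresponding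 to the endpoint of the lift of the loop $\omega$ starting at $w$). $\mathrm{Cod}$ and $\mathrm{Ker}$ are the codomain and kernel functors on the category of those $\Gamma$-normal extensions (morphisms: commutative squares) whose codomain is a connected, locally path-connected, semi-locally simply connected pointed space. For $p\colon(E,x)\to(B,y)$ such a normal extension, $\delta_p\colon\pi_1(B,y)=\mathrm{Ker}(u)\to\mathrm{Ker}(p)=(F,x)$ is the restriction to fibres over $y$ of the unique base-point preserving continuous map $e\colon(U,w)\to(E,x)$ with $p\circ e=u$. *)

theory Defs
  imports "HOL-Analysis.Analysis"
begin

section \<open>Pointed sets\<close>

text \<open>A pointed set is a pair of a carrier and a base-point; \<open>({()}, ())\<close> is the zero object.\<close>

definition pointed_fun :: "'a set \<times> 'a \<Rightarrow> 'b set \<times> 'b \<Rightarrow> ('a \<Rightarrow> 'b) \<Rightarrow> bool" where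
  "pointed_fun A B f \<longleftrightarrow> f \<in> fst A \<rightarrow> fst B \<and> f (snd A) = snd B"

definition exact_at ::
    "'a set \<times> 'a \<Rightarrow> ('a \<Rightarrow> 'b) \<Rightarrow> 'b set \<times> 'b \<Rightarrow> ('b \<Rightarrow> 'c) \<Rightarrow> 'c set \<times> 'c \<Rightarrow> bool" where
  "exact_at A f B g C \<longleftrightarrow>
     pointed_fun A B f \<and> pointed_fun B C g \<and> f ` fst A = {b \<in> fst B. g b = snd C}"

text \<open>Exactness of \<open>0 \<rightarrow> A \<rightarrow> B \<rightarrow> C \<rightarrow> D \<rightarrow> 0\<close>.\<close>

definition exact_sequence_0ABCD0 ::
    "'a set \<times> 'a \<Rightarrow> ('a \<Rightarrow> 'b) \<Rightarrow> 'b set \<times> 'b \<Rightarrow> ('b \<Rightarrow> 'c) \<Rightarrow> 'c set \<times> 'c \<Rightarrow> ('c \<Rightarrow> 'd)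
       \<Rightarrow> 'd set \<times> 'd \<Rightarrow> bool" where
  "exact_sequence_0ABCD0 A f B g C h D \<longleftrightarrow>
     exact_at ({()}, ()) (\<lambda>_. snd A) A f B \<and>
     exact_at A f B g C \<and>
     exact_at B g C h D \<and>
     exact_at C h D (\<lambda>_. ()) ({()}, ())"


section \<open>Pointed locally connected spaces, connected components, etale maps\<close>

definition pointed_loco :: "'a topology \<Rightarrow> 'a \<Rightarrow> bool" where
  "pointed_loco X x \<longleftrightarrow> locally_connected_space X \<and> x \<in> topspace X"

definition loco_map :: "'a topology \<Rightarrow> 'a \<Rightarrow> 'b topology \<Rightarrow> 'b \<Rightarrow> ('a \<Rightarrow> 'b) \<Rightarrow> bool" where
  "loco_map X x Y y f \<longleftrightarrow>
     pointed_loco X x \<and> pointed_loco Y y \<and> continuous_map X Y f \<and> f x = y"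

abbreviation pi0 :: "'a topology \<Rightarrow> 'a set set" where
  "pi0 X \<equiv> connected_components_of X"

abbreviation eta :: "'a topology \<Rightarrow> 'a \<Rightarrow> 'a set" where
  "eta X \<equiv> connected_component_of_set X"

text \<open>A continuous map sends all points of a component \<open>C\<close> into one component of the codomain,
  so for \<open>C \<in> pi0 X\<close> the union below has a single member.\<close>

definition pi0_map :: "'b topology \<Rightarrow> ('a \<Rightarrow> 'b) \<Rightarrow> 'a set \<Rightarrow> 'b set" where
  "pi0_map Y f C = (\<Union>t\<in>C. eta Y (f t))"

definition local_homeomorphism :: "'a topology \<Rightarrow> 'b topology \<Rightarrow> ('a \<Rightarrow> 'b) \<Rightarrow> bool" where
  "local_homeomorphism X Y f \<longleftrightarrow>
     continuous_map X Y f \<and>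
     (\<forall>t \<in> topspace X. \<exists>V. openin X V \<and> t \<in> V \<and> openin Y (f ` V) \<and>
        homeomorphic_map (subtopology X V) (subtopology Y (f ` V)) f)"

definition etale_map :: "'a topology \<Rightarrow> 'a \<Rightarrow> 'b topology \<Rightarrow> 'b \<Rightarrow> ('a \<Rightarrow> 'b) \<Rightarrow> bool" where
  "etale_map X x Y y f \<longleftrightarrow> loco_map X x Y y f \<and> local_homeomorphism X Y f"

text \<open>The topological fibre product.  It is used below only when one of the two maps is etale; its
  projection to the other factor is then etale, so the fibre product is again locally connected
  and is the pullback in the category of pointed locally connected spaces.\<close>

definition fibre_product :: "'a topology \<Rightarrow> ('a \<Rightarrow> 'c) \<Rightarrow> 'b topology \<Rightarrow> ('b \<Rightarrow> 'c) \<Rightarrow> ('a \<times> 'b) topology"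
  where "fibre_product X f Y g = subtopology (prod_topology X Y) {(s, t). f s = g t}"

text \<open>The fibre over \<open>y\<close> with the subspace topology, i.e. the kernel when \<open>y\<close> is the base-point.\<close>

definition fibre :: "'a topology \<Rightarrow> ('a \<Rightarrow> 'b) \<Rightarrow> 'b \<Rightarrow> 'a topology" where
  "fibre X f y = subtopology X {t. f t = y}"


section \<open>Trivial coverings, monadic extensions, normal extensions\<close>

definition trivial_covering :: "'a topology \<Rightarrow> 'a \<Rightarrow> 'b topology \<Rightarrow> 'b \<Rightarrow> ('a \<Rightarrow> 'b) \<Rightarrow> bool" where
  "trivial_covering A a B b f \<longleftrightarrow>
     etale_map A a B b f \<and>
     homeomorphic_map A
       (fibre_product B (eta B) (discrete_topology (pi0 A)) (pi0_map B f))
       (\<lambda>t. (f t, eta A t))"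

text \<open>Morphisms of the category of etale maps over a pointed space, from \<open>f: A \<rightarrow> B\<close> to
  \<open>f': A' \<rightarrow> B\<close>.\<close>

definition over_map ::
    "'a topology \<Rightarrow> 'a \<Rightarrow> ('a \<Rightarrow> 'b) \<Rightarrow> 'c topology \<Rightarrow> 'c \<Rightarrow> ('c \<Rightarrow> 'b) \<Rightarrow> ('a \<Rightarrow> 'c) \<Rightarrow> bool" where
  "over_map A a f A' a' f' h \<longleftrightarrow> loco_map A a A' a' h \<and> (\<forall>t \<in> topspace A. f' (h t) = f t)"

text \<open>Let \<open>p: E \<rightarrow> B\<close> be etale.  The pullback functor \<open>p*\<close> between the categories of etale maps over
  \<open>B\<close> and over \<open>E\<close> has composition with \<open>p\<close> as left adjoint.  The induced monad \<open>T\<close> sends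
  \<open>\<gamma>: C \<rightarrow> E\<close> to the first projection of the fibre product of \<open>p\<close> and \<open>p \<circ> \<gamma>\<close>, with unit
  \<open>t \<mapsto> (\<gamma> t, t)\<close> and multiplication \<open>(e, (e', t)) \<mapsto> (e, t)\<close>.  The next definitions spell out
  \<open>T\<close>-algebras and their morphisms.\<close>

definition T_algebra ::
    "'e topology \<Rightarrow> 'e \<Rightarrow> ('e \<Rightarrow> 'b) \<Rightarrow> 'c topology \<Rightarrow> 'c \<Rightarrow> ('c \<Rightarrow> 'e) \<Rightarrow> ('e \<times> 'c \<Rightarrow> 'c) \<Rightarrow> bool" where
  "T_algebra E x p C c \<gamma> \<xi> \<longleftrightarrow>
     etale_map C c E x \<gamma> \<and>
     over_map (fibre_product E p C (p \<circ> \<gamma>)) (x, c) fst C c \<gamma> \<xi> \<and>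
     (\<forall>t \<in> topspace C. \<xi> (\<gamma> t, t) = t) \<and>
     (\<forall>e \<in> topspace E. \<forall>e' \<in> topspace E. \<forall>t \<in> topspace C.
        p e = p e' \<and> p e' = p (\<gamma> t) \<longrightarrow> \<xi> (e, \<xi> (e', t)) = \<xi> (e, t))"

definition T_algebra_map ::
    "'e topology \<Rightarrow> ('e \<Rightarrow> 'b) \<Rightarrow> 'c topology \<Rightarrow> 'c \<Rightarrow> ('c \<Rightarrow> 'e) \<Rightarrow> ('e \<times> 'c \<Rightarrow> 'c)
       \<Rightarrow> 'd topology \<Rightarrow> 'd \<Rightarrow> ('d \<Rightarrow> 'e) \<Rightarrow> ('e \<times> 'd \<Rightarrow> 'd) \<Rightarrow> ('c \<Rightarrow> 'd) \<Rightarrow> bool" where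
  "T_algebra_map E p C c \<gamma> \<xi> D d \<delta> \<zeta> h \<longleftrightarrow>
     over_map C c \<gamma> D d \<delta> h \<and>
     (\<forall>e \<in> topspace E. \<forall>t \<in> topspace C. p e = p (\<gamma> t) \<longrightarrow> h (\<xi> (e, t)) = \<zeta> (e, h t))"

text \<open>The comparison functor sends \<open>f: A \<rightarrow> B\<close> to the algebra on the fibre product of \<open>p\<close> and \<open>f\<close>
  whose structure map is \<open>comparison_str\<close>, and \<open>h\<close> to \<open>(e, t) \<mapsto> (e, h t)\<close>.  Monadicity is the
  statement that it is full, faithful and essentially surjective.  HOL cannot quantify over spaces
  of unbounded size, so the etale spaces involved are those with points in a universe type \<open>'u\<close>;
  \<open>monadic_extension_iff\<close> below shows that the choice is immaterial once \<open>B\<close> fits into it.\<close>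

definition comparison_str :: "'e \<times> ('e \<times> 'a) \<Rightarrow> 'e \<times> 'a" where
  "comparison_str = (\<lambda>(e, (e', t)). (e, t))"

definition monadic_extension ::
    "'u itself \<Rightarrow> 'e topology \<Rightarrow> 'e \<Rightarrow> 'b topology \<Rightarrow> 'b \<Rightarrow> ('e \<Rightarrow> 'b) \<Rightarrow> bool" where
  "monadic_extension \<U> E x B y p \<longleftrightarrow>
     etale_map E x B y p \<and>
     (\<forall>(A :: 'u topology) a f (A' :: 'u topology) a' f'.
        etale_map A a B y f \<and> etale_map A' a' B y f' \<longrightarrow>
        (\<forall>h h'. over_map A a f A' a' f' h \<and> over_map A a f A' a' f' h' \<and>
           (\<forall>(e, t) \<in> topspace (fibre_product E p A f). (e, h t) = (e, h' t)) \<longrightarrow>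
           (\<forall>t \<in> topspace A. h t = h' t)) \<and>
        (\<forall>k. T_algebra_map E p
             (fibre_product E p A f) (x, a) fst comparison_str
             (fibre_product E p A' f') (x, a') fst comparison_str k \<longrightarrow>
           (\<exists>h. over_map A a f A' a' f' h \<and>
              (\<forall>(e, t) \<in> topspace (fibre_product E p A f). k (e, t) = (e, h t))))) \<and>
     (\<forall>(C :: 'u topology) c \<gamma> \<xi>. T_algebra E x p C c \<gamma> \<xi> \<longrightarrow>
        (\<exists>(A :: 'u topology) a f k. etale_map A a B y f \<and>
           homeomorphic_map (fibre_product E p A f) C k \<and>
           T_algebra_map E p (fibre_product E p A f) (x, a) fst comparison_str C c \<gamma> \<xi> k))"

definition normal_extension ::
    "'e topology \<Rightarrow> 'e \<Rightarrow> 'b topology \<Rightarrow> 'b \<Rightarrow> ('e \<Rightarrow> 'b) \<Rightarrow> bool" where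
  "normal_extension E x B y p \<longleftrightarrow>
     monadic_extension TYPE('e + 'b) E x B y p \<and>
     trivial_covering (fibre_product E p E p) (x, x) E x fst \<and>
     trivial_covering (fibre_product E p E p) (x, x) E x snd"


section \<open>The classical fundamental group\<close>

text \<open>Paths are functions on the type of reals of which only the values on \<open>[0, 1]\<close> matter.
  Only the underlying pointed set of the fundamental group is needed.\<close>

definition loops :: "'a topology \<Rightarrow> 'a \<Rightarrow> (real \<Rightarrow> 'a) set" where
  "loops X x = {\<omega>. pathin X \<omega> \<and> \<omega> 0 = x \<and> \<omega> 1 = x}"

definition loop_homotopic :: "'a topology \<Rightarrow> 'a \<Rightarrow> (real \<Rightarrow> 'a) \<Rightarrow> (real \<Rightarrow> 'a) \<Rightarrow> bool" where
  "loop_homotopic X x = homotopic_with (\<lambda>\<sigma>. \<sigma> 0 = x \<and> \<sigma> 1 = x) (top_of_set {0..1}) X"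

definition loop_class :: "'a topology \<Rightarrow> 'a \<Rightarrow> (real \<Rightarrow> 'a) \<Rightarrow> (real \<Rightarrow> 'a) set" where
  "loop_class X x \<omega> = {\<sigma>. loop_homotopic X x \<omega> \<sigma>}"

definition pi1 :: "'a topology \<Rightarrow> 'a \<Rightarrow> (real \<Rightarrow> 'a) set set" where
  "pi1 X x = loop_class X x ` loops X x"

definition pi1_one :: "'a topology \<Rightarrow> 'a \<Rightarrow> (real \<Rightarrow> 'a) set" where
  "pi1_one X x = loop_class X x (\<lambda>_. x)"

text \<open>The class of \<open>f \<circ> \<omega>\<close> does not depend on the representative \<open>\<omega>\<close> of \<open>c\<close>.\<close>

definition pi1_map :: "'b topology \<Rightarrow> 'b \<Rightarrow> ('a \<Rightarrow> 'b) \<Rightarrow> (real \<Rightarrow> 'a) set \<Rightarrow> (real \<Rightarrow> 'b) set" where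
  "pi1_map Y y f c = (\<Union>\<omega>\<in>c. loop_class Y y (f \<circ> \<omega>))"

definition semilocally_simply_connected_space :: "'a topology \<Rightarrow> bool" where
  "semilocally_simply_connected_space X \<longleftrightarrow>
     (\<forall>b \<in> topspace X. \<exists>V. openin X V \<and> b \<in> V \<and>
        (\<forall>\<omega> \<in> loops (subtopology X V) b. loop_homotopic X b \<omega> (\<lambda>_. b)))"

definition simply_connected_space :: "'a topology \<Rightarrow> bool" where
  "simply_connected_space X \<longleftrightarrow>
     path_connected_space X \<and> (\<forall>z \<in> topspace X. pi1 X z = {pi1_one X z})"

definition admissible_base :: "'b topology \<Rightarrow> 'b \<Rightarrow> bool" where
  "admissible_base B y \<longleftrightarrow>
     connected_space B \<and> locally_path_connected_space B \<and>
     semilocally_simply_connected_space B \<and> y \<in> topspace B"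


section \<open>Universal coverings, liftings and the connecting map\<close>

text \<open>This is the library's \<open>covering_space\<close>, which is restricted to topologies coming from the
  type class, for arbitrary topologies.\<close>

definition covering_map :: "'a topology \<Rightarrow> 'b topology \<Rightarrow> ('a \<Rightarrow> 'b) \<Rightarrow> bool" where
  "covering_map X Y q \<longleftrightarrow>
     continuous_map X Y q \<and> q ` topspace X = topspace Y \<and>
     (\<forall>b \<in> topspace Y. \<exists>V. openin Y V \<and> b \<in> V \<and>
        (\<exists>\<V>. \<Union>\<V> = {t \<in> topspace X. q t \<in> V} \<and> (\<forall>W \<in> \<V>. openin X W) \<and> pairwise disjnt \<V> \<and>
           (\<forall>W \<in> \<V>. homeomorphic_map (subtopology X W) (subtopology Y V) q)))"

definition universal_covering :: "'u topology \<Rightarrow> 'u \<Rightarrow> 'b topology \<Rightarrow> 'b \<Rightarrow> ('u \<Rightarrow> 'b) \<Rightarrow> bool" where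
  "universal_covering U w B y u \<longleftrightarrow>
     covering_map U B u \<and> w \<in> topspace U \<and> u w = y \<and>
     connected_space U \<and> simply_connected_space U"

text \<open>\<open>h: (Z, z) \<rightarrow> (X, x)\<close> is base-point preserving with \<open>q \<circ> h = k\<close>.\<close>

definition is_lift ::
    "'a topology \<Rightarrow> 'a \<Rightarrow> ('a \<Rightarrow> 'b) \<Rightarrow> 'z topology \<Rightarrow> 'z \<Rightarrow> ('z \<Rightarrow> 'b) \<Rightarrow> ('z \<Rightarrow> 'a) \<Rightarrow> bool" where
  "is_lift X x q Z z k h \<longleftrightarrow> continuous_map Z X h \<and> h z = x \<and> (\<forall>t \<in> topspace Z. q (h t) = k t)"

definition has_unique_lift ::
    "'a topology \<Rightarrow> 'a \<Rightarrow> ('a \<Rightarrow> 'b) \<Rightarrow> 'z topology \<Rightarrow> 'z \<Rightarrow> ('z \<Rightarrow> 'b) \<Rightarrow> bool" where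
  "has_unique_lift X x q Z z k \<longleftrightarrow>
     (\<exists>h. is_lift X x q Z z k h \<and> (\<forall>h'. is_lift X x q Z z k h' \<longrightarrow> (\<forall>t \<in> topspace Z. h' t = h t)))"

definition the_lift ::
    "'a topology \<Rightarrow> 'a \<Rightarrow> ('a \<Rightarrow> 'b) \<Rightarrow> 'z topology \<Rightarrow> 'z \<Rightarrow> ('z \<Rightarrow> 'b) \<Rightarrow> 'z \<Rightarrow> 'a" where
  "the_lift X x q Z z k = (SOME h. is_lift X x q Z z k h)"

text \<open>\<open>t\<close> is the endpoint of a lift, starting at \<open>x\<close>, of a loop in the homotopy class \<open>c\<close>.\<close>

definition is_lift_end :: "'a topology \<Rightarrow> 'a \<Rightarrow> ('a \<Rightarrow> 'b) \<Rightarrow> (real \<Rightarrow> 'b) set \<Rightarrow> 'a \<Rightarrow> bool" where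
  "is_lift_end X x q c t \<longleftrightarrow>
     (\<exists>\<omega> \<in> c. \<exists>\<sigma>. is_lift X x q (top_of_set {0..1}) 0 \<omega> \<sigma> \<and> \<sigma> 1 = t)"

definition lift_end :: "'a topology \<Rightarrow> 'a \<Rightarrow> ('a \<Rightarrow> 'b) \<Rightarrow> (real \<Rightarrow> 'b) set \<Rightarrow> 'a" where
  "lift_end X x q c = (THE t. is_lift_end X x q c t)"

text \<open>The boundary map of the classical homotopy sequence of a fibration \<open>p: (E, x) \<rightarrow> (B, y)\<close>.\<close>

definition boundary :: "'e topology \<Rightarrow> 'e \<Rightarrow> ('e \<Rightarrow> 'b) \<Rightarrow> 'b \<Rightarrow> (real \<Rightarrow> 'b) set \<Rightarrow> 'e set" where
  "boundary E x p y c = eta (fibre E p y) (lift_end E x p c)"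

text \<open>The underlying set of the Galois group of a universal covering \<open>u: (U, w) \<rightarrow> (B, y)\<close>:
  the intersection of the kernels of \<open>u\<close> and of the unit at \<open>U\<close>.\<close>

definition galois_pi1 :: "'u topology \<Rightarrow> 'u \<Rightarrow> ('u \<Rightarrow> 'b) \<Rightarrow> 'b \<Rightarrow> 'u set" where
  "galois_pi1 U w u y = {z \<in> topspace U. u z = y} \<inter> {z \<in> topspace U. eta U z = eta U w}"

text \<open>The action of \<open>\<pi>\<^sub>1(-, \<pi>\<^sub>0)\<close> on \<open>g: (B, y) \<rightarrow> (B', y')\<close>, computed with universal coverings \<open>u\<close>
  of the domain and \<open>u'\<close> of the codomain.\<close>

definition galois_pi1_map ::
    "'u topology \<Rightarrow> 'u \<Rightarrow> ('u \<Rightarrow> 'b) \<Rightarrow> 'v topology \<Rightarrow> 'v \<Rightarrow> ('v \<Rightarrow> 'c) \<Rightarrow> ('b \<Rightarrow> 'c) \<Rightarrow> 'u \<Rightarrow> 'v" where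
  "galois_pi1_map U w u U' w' u' g = the_lift U' w' u' U w (g \<circ> u)"

text \<open>The component at \<open>p: (E, x) \<rightarrow> (B, y)\<close> of \<open>\<delta>\<close>, to be applied to elements of
  \<open>galois_pi1 U w u y\<close>.\<close>

definition delta ::
    "'u topology \<Rightarrow> 'u \<Rightarrow> ('u \<Rightarrow> 'b) \<Rightarrow> 'e topology \<Rightarrow> 'e \<Rightarrow> ('e \<Rightarrow> 'b) \<Rightarrow> 'u \<Rightarrow> 'e" where
  "delta U w u E x p = the_lift E x p U w u"


section \<open>Monadic extensions are the surjective local homeomorphisms\<close>


lemma local_homeomorphism_iff:
  "local_homeomorphism X Y f \<longleftrightarrow>
     continuous_map X Y f \<and> open_map X Y f \<and>
     (\<forall>t \<in> topspace X. \<exists>V. openin X V \<and> t \<in> V \<and> inj_on f V)" (is "?L \<longleftrightarrow> ?R")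
proof
  assume L: ?L
  have "openin Y (f ` W)" if W: "openin X W" for W
  proof (subst openin_subopen, intro ballI)
    fix s assume "s \<in> f ` W"
    then obtain t where t: "t \<in> W" "s = f t" by blast
    with W have "t \<in> topspace X" using openin_subset by blast
    then obtain V where V: "openin X V" "t \<in> V" "openin Y (f ` V)"
      "homeomorphic_map (subtopology X V) (subtopology Y (f ` V)) f"
      using L unfolding local_homeomorphism_def by blast
    have "openin (subtopology X V) (V \<inter> W)"
      using W by (auto simp: openin_subtopology)
    then have "openin (subtopology Y (f ` V)) (f ` (V \<inter> W))"
      using V(4) homeomorphic_imp_open_map open_map_def by blast
    then have "openin Y (f ` (V \<inter> W))"
      using V(3) openin_trans_full by blast
    then show "\<exists>T. openin Y T \<and> s \<in> T \<and> T \<subseteq> f ` W"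
      using t V(2) by blast
  qed
  moreover have "\<exists>V. openin X V \<and> t \<in> V \<and> inj_on f V" if "t \<in> topspace X" for t
  proof -
    obtain V where V: "openin X V" "t \<in> V" 
      "homeomorphic_map (subtopology X V) (subtopology Y (f ` V)) f"
      using L \<open>t \<in> topspace X\<close> unfolding local_homeomorphism_def by blast
    have "inj_on f V"
      using V(3) homeomorphic_imp_injective_map[OF V(3)] openin_subset[OF V(1)]
      by (simp add: topspace_subtopology Int_absorb1)
    then show ?thesis using V by blast
  qed
  ultimately show ?R
    using L unfolding local_homeomorphism_def open_map_def by blast
next
  assume R: ?R
  have "\<exists>V. openin X V \<and> t \<in> V \<and> openin Y (f ` V) \<and>
        homeomorphic_map (subtopology X V) (subtopology Y (f ` V)) f" if "t \<in> topspace X" for t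
  proof -
    obtain V where V: "openin X V" "t \<in> V" "inj_on f V" using R \<open>t \<in> topspace X\<close> by blast
    have oV: "openin Y (f ` V)" using R V(1) by (auto simp: open_map_def)
    have VX: "V \<subseteq> topspace X" using V(1) openin_subset by blast
    have fV: "f ` V \<subseteq> topspace Y" using oV openin_subset by blast
    have "homeomorphic_map (subtopology X V) (subtopology Y (f ` V)) f"
    proof (rule bijective_open_imp_homeomorphic_map)
      show "continuous_map (subtopology X V) (subtopology Y (f ` V)) f"
        using R by (auto simp: continuous_map_in_subtopology continuous_map_from_subtopology)
      show "open_map (subtopology X V) (subtopology Y (f ` V)) f"
        unfolding open_map_def
      proof (intro allI impI)
        fix W assume "openin (subtopology X V) W"
        then have "openin X W" "W \<subseteq> V" using V(1) openin_open_subtopology by blast+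
        then show "openin (subtopology Y (f ` V)) (f ` W)"
          using R oV by (simp add: openin_open_subtopology open_map_def image_mono)
      qed
    qed (use VX fV V(3) in \<open>auto simp: topspace_subtopology Int_absorb1\<close>)
    then show ?thesis using V oV by blast
  qed
  with R show ?L unfolding local_homeomorphism_def by blast
qed

lemma local_homeomorphism_locally_connected:
  assumes f: "local_homeomorphism X Y f" and Y: "locally_connected_space Y"
  shows "locally_connected_space X"
  unfolding locally_connected_space
proof (intro allI impI)
  fix W t assume W: "openin X W \<and> t \<in> W"
  then have "t \<in> topspace X" using openin_subset by blast
  then obtain V where V: "openin X V" "t \<in> V" "openin Y (f ` V)"
      "homeomorphic_map (subtopology X V) (subtopology Y (f ` V)) f"
    using f unfolding local_homeomorphism_def by blast
  have "locally_connected_space (subtopology Y (f ` V))"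
    using Y V(3) locally_connected_space_open_subset by blast
  then have "locally_connected_space (subtopology X V)"
    using V(4) homeomorphic_locally_connected_space homeomorphic_map_imp_homeomorphic_space by blast
  moreover have "openin (subtopology X V) (V \<inter> W)" using W by (auto simp: openin_subtopology)
  ultimately obtain U where "openin (subtopology X V) U" "connectedin (subtopology X V) U"
      "t \<in> U" "U \<subseteq> V \<inter> W"
    unfolding locally_connected_space using V(2) W by (metis IntI)
  then show "\<exists>U. openin X U \<and> connectedin X U \<and> t \<in> U \<and> U \<subseteq> W"
    using V(1) openin_trans_full connectedin_subtopology by (metis Int_subset_iff)
qed

lemma topspace_fibre_product:
  "topspace (fibre_product X f Y g) = {(s, t). s \<in> topspace X \<and> t \<in> topspace Y \<and> f s = g t}"
  by (auto simp: fibre_product_def topspace_subtopology)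

lemma continuous_map_fibre_product_fst: "continuous_map (fibre_product X f Y g) X fst"
  by (simp add: fibre_product_def continuous_map_from_subtopology continuous_map_fst)

lemma continuous_map_fibre_product_snd: "continuous_map (fibre_product X f Y g) Y snd"
  by (simp add: fibre_product_def continuous_map_from_subtopology continuous_map_snd)

lemma continuous_map_into_fibre_product:
  "continuous_map Z (fibre_product X f Y g) h \<longleftrightarrow>
     continuous_map Z X (fst \<circ> h) \<and> continuous_map Z Y (snd \<circ> h) \<and>
     (\<forall>z \<in> topspace Z. f (fst (h z)) = g (snd (h z)))"
  by (fastforce simp: fibre_product_def continuous_map_in_subtopology continuous_map_pairwise Pi_iff
      split: prod.splits)

lemma openin_fibre_product_Times:
  assumes "openin X V" "openin Y W"
  shows "openin (fibre_product X f Y g) {(s, t). s \<in> V \<and> t \<in> W \<and> f s = g t}"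
proof -
  have "{(s, t). s \<in> V \<and> t \<in> W \<and> f s = g t} = (V \<times> W) \<inter> {(s, t). f s = g t}" by auto
  then show ?thesis
    unfolding fibre_product_def openin_subtopology
    using assms openin_prod_Times_iff[of X Y V W] by (intro exI[of _ "V \<times> W"]) simp
qed

lemma openin_fibre_product_D:
  assumes "openin (fibre_product X f Y g) Q" "(s, t) \<in> Q"
  obtains V W where "openin X V" "openin Y W" "s \<in> V" "t \<in> W"
    "\<And>s' t'. s' \<in> V \<Longrightarrow> t' \<in> W \<Longrightarrow> f s' = g t' \<Longrightarrow> (s', t') \<in> Q"
proof -
  obtain Q' where Q': "openin (prod_topology X Y) Q'" "Q = Q' \<inter> {(s, t). f s = g t}"
    using assms(1) unfolding fibre_product_def openin_subtopology by blast
  then obtain V W where "openin X V" "openin Y W" "s \<in> V" "t \<in> W" "V \<times> W \<subseteq> Q'"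
    using assms(2) unfolding openin_prod_topology_alt by (meson IntD1)
  then show thesis using that Q'(2) by blast
qed

lemma local_homeomorphism_fibre_product_fst:
  assumes g: "local_homeomorphism Y Z g" and f: "continuous_map X Z f"
  shows "local_homeomorphism (fibre_product X f Y g) X fst"
  unfolding local_homeomorphism_iff
proof (intro conjI ballI continuous_map_fibre_product_fst)
  show "open_map (fibre_product X f Y g) X fst"
    unfolding open_map_def
  proof (intro allI impI)
    fix Q assume Q: "openin (fibre_product X f Y g) Q"
    show "openin X (fst ` Q)"
    proof (subst openin_subopen, intro ballI)
      fix s assume "s \<in> fst ` Q"
      then obtain t where st: "(s, t) \<in> Q" by force
      obtain V W where VW: "openin X V" "openin Y W" "s \<in> V" "t \<in> W"
        "\<And>s' t'. s' \<in> V \<Longrightarrow> t' \<in> W \<Longrightarrow> f s' = g t' \<Longrightarrow> (s', t') \<in> Q"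
        using openin_fibre_product_D[OF Q st] by metis
      have "openin Z (g ` W)" using g VW(2) by (simp add: local_homeomorphism_iff open_map_def)
      then have "openin X {s' \<in> topspace X. f s' \<in> g ` W}"
        using f openin_continuous_map_preimage by blast
      then have o: "openin X (V \<inter> {s' \<in> topspace X. f s' \<in> g ` W})" using VW(1) by blast
      have "(s, t) \<in> topspace (fibre_product X f Y g)" using Q st openin_subset by blast
      then have "s \<in> topspace X" "f s = g t" by (auto simp: topspace_fibre_product)
      moreover have "V \<inter> {s' \<in> topspace X. f s' \<in> g ` W} \<subseteq> fst ` Q"
        using VW(5) by force
      ultimately show "\<exists>T. openin X T \<and> s \<in> T \<and> T \<subseteq> fst ` Q"
        using o VW(3,4) by blast
    qed
  qed
next
  fix z assume "z \<in> topspace (fibre_product X f Y g)"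
  then obtain s t where z: "z = (s, t)" "s \<in> topspace X" "t \<in> topspace Y" "f s = g t"
    by (auto simp: topspace_fibre_product)
  obtain W where W: "openin Y W" "t \<in> W" "inj_on g W"
    using g z(3) unfolding local_homeomorphism_iff by blast
  have "inj_on fst {(s, t). s \<in> topspace X \<and> t \<in> W \<and> f s = g t}"
    using W(3) by (auto simp: inj_on_def)
  then show "\<exists>V. openin (fibre_product X f Y g) V \<and> z \<in> V \<and> inj_on fst V"
    using openin_fibre_product_Times[OF openin_topspace W(1), of X f g] z W(2) by blast
qed

lemma homeomorphic_map_fibre_product_swap:
  "homeomorphic_map (fibre_product X f Y g) (fibre_product Y g X f) prod.swap"
proof -
  have "homeomorphic_maps (fibre_product X f Y g) (fibre_product Y g X f) prod.swap prod.swap"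
    unfolding homeomorphic_maps_def continuous_map_into_fibre_product
    by (auto simp: topspace_fibre_product comp_def continuous_map_fibre_product_fst
        continuous_map_fibre_product_snd)
  then show ?thesis using homeomorphic_maps_map by blast
qed

lemma open_map_fibre_product_snd:
  assumes f: "local_homeomorphism X Z f" and g: "continuous_map Y Z g"
  shows "open_map (fibre_product X f Y g) Y snd"
proof -
  have "open_map (fibre_product X f Y g) Y (fst \<circ> prod.swap)"
    using homeomorphic_imp_open_map[OF homeomorphic_map_fibre_product_swap[of X f Y g]]
      local_homeomorphism_fibre_product_fst[OF f g]
    by (auto simp: local_homeomorphism_iff intro: open_map_compose)
  then show ?thesis by (simp add: comp_def prod.swap_def)
qed

lemma etale_map_fibre_product_fst:
  assumes p: "etale_map E x B y p" and f: "etale_map A a B y f"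
  shows "etale_map (fibre_product E p A f) (x, a) E x fst"
proof -
  have lh: "local_homeomorphism (fibre_product E p A f) E fst"
    using p f by (intro local_homeomorphism_fibre_product_fst) (auto simp: etale_map_def loco_map_def)
  then have "locally_connected_space (fibre_product E p A f)"
    using p local_homeomorphism_locally_connected
    by (auto simp: etale_map_def loco_map_def pointed_loco_def)
  then show ?thesis
    using lh p f by (auto simp: etale_map_def loco_map_def pointed_loco_def topspace_fibre_product
        continuous_map_fibre_product_fst)
qed

lemma etale_map_compose:
  assumes "etale_map C c E x g" "etale_map E x B y p"
  shows "etale_map C c B y (p \<circ> g)"
proof -
  have g: "continuous_map C E g" "open_map C E g" 
    "\<And>t. t \<in> topspace C \<Longrightarrow> \<exists>V. openin C V \<and> t \<in> V \<and> inj_on g V"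
    using assms(1) by (auto simp: etale_map_def local_homeomorphism_iff)
  have p: "continuous_map E B p" "open_map E B p" 
    "\<And>t. t \<in> topspace E \<Longrightarrow> \<exists>V. openin E V \<and> t \<in> V \<and> inj_on p V"
    using assms(2) by (auto simp: etale_map_def local_homeomorphism_iff)
  have "\<exists>V. openin C V \<and> t \<in> V \<and> inj_on (p \<circ> g) V" if t: "t \<in> topspace C" for t
  proof -
    obtain V where V: "openin C V" "t \<in> V" "inj_on g V" using g(3) t by blast
    have "g t \<in> topspace E" using g(1) t by (auto simp: continuous_map_def Pi_iff)
    then obtain W where W: "openin E W" "g t \<in> W" "inj_on p W" using p(3) by blast
    have "openin C {s \<in> topspace C. g s \<in> W}" using g(1) W(1) openin_continuous_map_preimage by blast
    then have "openin C (V \<inter> {s \<in> topspace C. g s \<in> W})" using V(1) by blast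
    moreover have "inj_on (p \<circ> g) (V \<inter> {s \<in> topspace C. g s \<in> W})"
      using V(3) W(3) by (auto simp: inj_on_def)
    ultimately show ?thesis using V(2) W(2) t by blast
  qed
  then have "local_homeomorphism C B (p \<circ> g)"
    unfolding local_homeomorphism_iff
    using g(1,2) p(1,2) by (blast intro: continuous_map_compose open_map_compose)
  then show ?thesis
    using assms by (auto simp: etale_map_def loco_map_def intro: continuous_map_compose)
qed

text \<open>Maps between etale spaces are open.\<close>

lemma open_map_over:
  assumes p: "local_homeomorphism X Z p" and q: "local_homeomorphism Y Z q"
    and h: "continuous_map X Y h" "\<And>t. t \<in> topspace X \<Longrightarrow> q (h t) = p t"
  shows "open_map X Y h"
  unfolding open_map_def
proof (intro allI impI)
  fix W assume W: "openin X W"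
  show "openin Y (h ` W)"
  proof (subst openin_subopen, intro ballI)
    fix s assume "s \<in> h ` W"
    then obtain t where t: "t \<in> W" "s = h t" by blast
    have tX: "t \<in> topspace X" using t W openin_subset by blast
    have "s \<in> topspace Y" using t h(1) tX by (auto simp: continuous_map_def Pi_iff)
    then obtain V where V: "openin Y V" "s \<in> V" "inj_on q V"
      using q unfolding local_homeomorphism_iff by blast
    define W' where "W' = W \<inter> {t \<in> topspace X. h t \<in> V}"
    have "openin X W'"
      unfolding W'_def using W openin_continuous_map_preimage[OF h(1) V(1)] by blast
    then have "openin Z (p ` W')" using p by (simp add: local_homeomorphism_iff open_map_def)
    moreover have "continuous_map Y Z q" using q by (simp add: local_homeomorphism_iff)
    ultimately have "openin Y (V \<inter> {s \<in> topspace Y. q s \<in> p ` W'})"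
      using V(1) openin_continuous_map_preimage by blast
    moreover have "V \<inter> {s \<in> topspace Y. q s \<in> p ` W'} \<subseteq> h ` W"
    proof
      fix s' assume s': "s' \<in> V \<inter> {s \<in> topspace Y. q s \<in> p ` W'}"
      then obtain t' where "t' \<in> W'" "q s' = p t'" by blast
      then have "q s' = q (h t')" "h t' \<in> V" "t' \<in> W" using h(2) by (auto simp: W'_def)
      then show "s' \<in> h ` W" using V(3) s' by (auto simp: inj_on_def)
    qed
    moreover have "t \<in> W'" using t V(2) tX by (simp add: W'_def)
    then have "s \<in> V \<inter> {s \<in> topspace Y. q s \<in> p ` W'}"
      using V(2) \<open>s \<in> topspace Y\<close> h(2)[OF tX] t(2) by auto
    ultimately show "\<exists>T. openin Y T \<and> s \<in> T \<and> T \<subseteq> h ` W" by blast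
  qed
qed


lemma surj_of_monadic_extension:
  fixes i :: "'b \<Rightarrow> 'u" and p :: "'e \<Rightarrow> 'b"
  assumes i: "inj i" and mon: "monadic_extension TYPE('u) E x B y p"
  shows "p ` topspace E = topspace B"
proof -
  have et: "etale_map E x B y p" using mon unfolding monadic_extension_def by (rule conjunct1)
  then have p: "continuous_map E B p" "p x = y" "x \<in> topspace E" "y \<in> topspace B"
    "local_homeomorphism E B p" "locally_connected_space B" "open_map E B p"
    by (auto simp: etale_map_def loco_map_def pointed_loco_def local_homeomorphism_iff)
  define P where "P = p ` topspace E"
  have P: "openin B P" using p(7) by (simp add: P_def open_map_def)
  have PB: "P \<subseteq> topspace B" using P openin_subset by blast
  define j where "j = inv i"
  have ji [simp]: "j (i t) = t" for t by (simp add: j_def i)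
  \<comment> \<open>copies in \<open>'u\<close> of \<open>B\<close> and of its open subspace \<open>P\<close>\<close>
  define T where "T S = pullback_topology (i ` S) j (subtopology B S)" for S
  have hom: "homeomorphic_maps (T S) (subtopology B S) j i" if "S \<subseteq> topspace B" for S
  proof -
    have "continuous_map (T S) (subtopology B S) j"
      unfolding T_def using continuous_map_pullback[OF continuous_map_id, of "i ` S" j "subtopology B S"]
      by simp
    moreover have "continuous_map (subtopology B S) (T S) i"
      unfolding T_def
      by (rule continuous_map_pullback')
         (use that in \<open>auto simp: comp_def continuous_map_id[unfolded id_def] topspace_subtopology\<close>)
    ultimately show ?thesis
      unfolding homeomorphic_maps_def
      using that by (auto simp: T_def topspace_pullback_topology)
  qed
  have top: "topspace (T S) = i ` S" if "S \<subseteq> topspace B" for S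
    using that by (auto simp: T_def topspace_pullback_topology)
  have etT: "etale_map (T S) (i y) B y j" if S: "openin B S" "y \<in> S" for S
  proof -
    have SB: "S \<subseteq> topspace B" using S openin_subset by blast
    have cj: "continuous_map (T S) B j"
      using hom[OF SB] by (auto simp: homeomorphic_maps_def continuous_map_in_subtopology)
    have "open_map (T S) (subtopology B S) j"
      using hom[OF SB] by (simp add: homeomorphic_maps_map homeomorphic_imp_open_map)
    then have oj: "open_map (T S) B j"
      using S(1) by (metis open_map_def openin_trans_full)
    have "inj_on j (topspace (T S))" unfolding top[OF SB] by (auto simp: inj_on_def)
    then have lh: "local_homeomorphism (T S) B j"
      unfolding local_homeomorphism_iff using cj oj by blast
    show ?thesis
      unfolding etale_map_def loco_map_def pointed_loco_def
      using lh cj p(4,6) local_homeomorphism_locally_connected[OF lh] S top[OF SB] by auto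
  qed
  let ?A = "T (topspace B)" and ?A' = "T P"
  have yP: "y \<in> P" using p by (auto simp: P_def)
  have A: "etale_map ?A (i y) B y j" using etT[of "topspace B"] p by simp
  have A': "etale_map ?A' (i y) B y j" using etT[OF P yP] .
  note topA = top[OF order_refl] and topA' = top[OF PB]
  let ?F = "fibre_product E p ?A j" and ?F' = "fibre_product E p ?A' j"
  have F: "pointed_loco ?F (x, i y)" and F': "pointed_loco ?F' (x, i y)"
    using etale_map_fibre_product_fst[OF et A] etale_map_fibre_product_fst[OF et A']
    by (auto simp: etale_map_def loco_map_def)
  have cont: "continuous_map ?F ?F' (\<lambda>z. z)"
  proof -
    have "continuous_map ?F (T P) (i \<circ> (p \<circ> fst))"
    proof (rule continuous_map_compose)
      show "continuous_map ?F (subtopology B P) (p \<circ> fst)"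
        unfolding continuous_map_in_subtopology
        using continuous_map_compose[OF continuous_map_fibre_product_fst p(1)]
        by (auto simp: topspace_fibre_product P_def intro: rev_image_eqI)
      show "continuous_map (subtopology B P) (T P) i"
        using hom[OF PB] by (auto simp: homeomorphic_maps_def)
    qed
    then have "continuous_map ?F (T P) (snd \<circ> (\<lambda>z. z))"
      by (rule continuous_map_eq) (auto simp: topspace_fibre_product topA)
    then show ?thesis
      unfolding continuous_map_into_fibre_product
      by (auto simp: comp_def topspace_fibre_product continuous_map_fibre_product_fst)
  qed
  have k: "T_algebra_map E p ?F (x, i y) fst comparison_str ?F' (x, i y) fst comparison_str (\<lambda>z. z)"
    unfolding T_algebra_map_def over_map_def loco_map_def using F F' cont by auto
  then obtain h where h: "over_map ?A (i y) j ?A' (i y) j h"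
    using mon A A' unfolding monadic_extension_def by blast
  have "b \<in> P" if b: "b \<in> topspace B" for b
  proof -
    have ib: "i b \<in> topspace ?A" using b topA by blast
    then have "h (i b) \<in> topspace ?A'" "j (h (i b)) = b"
      using h by (auto simp: over_map_def loco_map_def continuous_map_def Pi_iff)
    then show ?thesis unfolding topA' by auto
  qed
  then show ?thesis using PB P_def by blast
qed

lemma over_map_unique_descent:
  assumes "p ` topspace E = topspace B" "etale_map A a B y f"
    "\<forall>(e, t) \<in> topspace (fibre_product E p A f). (e, h t) = (e, h' t)"
    "t \<in> topspace A"
  shows "h t = h' t"
proof -
  have "f t \<in> topspace B"
    using assms(2,4) by (auto simp: etale_map_def loco_map_def continuous_map_def Pi_iff)
  then obtain e where "e \<in> topspace E" "p e = f t" using assms(1) by force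
  then have "(e, t) \<in> topspace (fibre_product E p A f)" using assms(4) by (simp add: topspace_fibre_product)
  then show ?thesis using assms(3) by auto
qed

lemma over_map_descent:
  assumes et: "etale_map E x B y p" and surj: "p ` topspace E = topspace B"
    and A: "etale_map A a B y f" and A': "etale_map A' a' B y f'"
    and k: "T_algebra_map E p (fibre_product E p A f) (x, a) fst comparison_str
              (fibre_product E p A' f') (x, a') fst comparison_str k"
  shows "\<exists>h. over_map A a f A' a' f' h \<and>
           (\<forall>(e, t) \<in> topspace (fibre_product E p A f). k (e, t) = (e, h t))"
proof -
  let ?F = "fibre_product E p A f" and ?F' = "fibre_product E p A' f'"
  have kc: "continuous_map ?F ?F' k" "k (x, a) = (x, a')"
    and kf: "\<And>z. z \<in> topspace ?F \<Longrightarrow> fst (k z) = fst z"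
    and ka: "\<And>e z. e \<in> topspace E \<Longrightarrow> z \<in> topspace ?F \<Longrightarrow> p e = p (fst z) \<Longrightarrow>
              k (comparison_str (e, z)) = comparison_str (e, k z)"
    using k by (auto simp: T_algebra_map_def over_map_def loco_map_def)
  define e0 where "e0 t = (SOME e. e \<in> topspace E \<and> p e = f t)" for t
  have fB: "f t \<in> topspace B" if "t \<in> topspace A" for t
    using A that by (auto simp: etale_map_def loco_map_def continuous_map_def Pi_iff)
  have e0: "e0 t \<in> topspace E \<and> p (e0 t) = f t" if "t \<in> topspace A" for t
    unfolding e0_def by (rule someI_ex) (use fB[OF that] surj in force)
  define h where "h t = snd (k (e0 t, t))" for t
  have kh: "k (e, t) = (e, h t)" if et: "(e, t) \<in> topspace ?F" for e t
  proof -
    have t: "e \<in> topspace E" "t \<in> topspace A" "p e = f t"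
      using et by (auto simp: topspace_fibre_product)
    have z: "(e0 t, t) \<in> topspace ?F" using e0[OF t(2)] t(2) by (simp add: topspace_fibre_product)
    have "k (comparison_str (e, (e0 t, t))) = comparison_str (e, k (e0 t, t))"
      using ka[OF t(1) z] t(3) e0[OF t(2)] by simp
    then show ?thesis by (simp add: comparison_str_def h_def split: prod.splits)
  qed
  have q: "quotient_map ?F A snd"
  proof (rule continuous_open_imp_quotient_map)
    show "continuous_map ?F A snd" by (rule continuous_map_fibre_product_snd)
    show "open_map ?F A snd"
      using et A by (intro open_map_fibre_product_snd) (auto simp: etale_map_def loco_map_def)
    show "snd ` topspace ?F = topspace A"
    proof
      show "topspace A \<subseteq> snd ` topspace ?F"
      proof
        fix t assume "t \<in> topspace A"
        then have "(e0 t, t) \<in> topspace ?F" using e0 by (simp add: topspace_fibre_product)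
        then show "t \<in> snd ` topspace ?F" by force
      qed
    qed (auto simp: topspace_fibre_product)
  qed
  have "continuous_map ?F A' (snd \<circ> k)"
    by (rule continuous_map_compose[OF kc(1) continuous_map_fibre_product_snd])
  then have "continuous_map ?F A' (h \<circ> snd)"
    by (rule continuous_map_eq) (use kh in auto)
  then have hc: "continuous_map A A' h"
    using q continuous_compose_quotient_map_eq by blast
  have hf: "f' (h t) = f t" if t: "t \<in> topspace A" for t
  proof -
    have z: "(e0 t, t) \<in> topspace ?F" using e0[OF t] t by (simp add: topspace_fibre_product)
    then have "k (e0 t, t) \<in> topspace ?F'" using kc(1) by (auto simp: continuous_map_def Pi_iff)
    then show ?thesis using kh[OF z] e0[OF t] by (simp add: topspace_fibre_product)
  qed
  have "(x, a) \<in> topspace ?F"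
    using et A by (auto simp: etale_map_def loco_map_def pointed_loco_def topspace_fibre_product)
  then have "h a = a'" using kh kc(2) by force
  then have "over_map A a f A' a' f' h"
    using hc hf A A' by (auto simp: over_map_def loco_map_def etale_map_def)
  then show ?thesis using kh by (intro exI[of _ h]) auto
qed

lemma T_algebra_descent:
  fixes C :: "'u topology"
  assumes et: "etale_map E x B y p"
    and alg: "T_algebra E x p C c \<gamma> \<xi>"
  shows "\<exists>(A :: 'u topology) a f k. etale_map A a B y f \<and>
           homeomorphic_map (fibre_product E p A f) C k \<and>
           T_algebra_map E p (fibre_product E p A f) (x, a) fst comparison_str C c \<gamma> \<xi> k"
proof -
  let ?G = "fibre_product E p C (p \<circ> \<gamma>)"
  have gam: "etale_map C c E x \<gamma>"
    and xi: "continuous_map ?G C \<xi>" "\<xi> (x, c) = c"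
    and gx: "\<And>e t. e \<in> topspace E \<Longrightarrow> t \<in> topspace C \<Longrightarrow> p e = p (\<gamma> t) \<Longrightarrow> \<gamma> (\<xi> (e, t)) = e"
    and unit: "\<And>t. t \<in> topspace C \<Longrightarrow> \<xi> (\<gamma> t, t) = t"
    and assoc: "\<And>e e' t. e \<in> topspace E \<Longrightarrow> e' \<in> topspace E \<Longrightarrow> t \<in> topspace C \<Longrightarrow>
        p e = p e' \<Longrightarrow> p e' = p (\<gamma> t) \<Longrightarrow> \<xi> (e, \<xi> (e', t)) = \<xi> (e, t)"
    using alg unfolding T_algebra_def over_map_def loco_map_def
    by (auto simp: topspace_fibre_product)
  have pg: "etale_map C c B y (p \<circ> \<gamma>)" using etale_map_compose[OF gam et] .
  have gE: "\<gamma> t \<in> topspace E" if "t \<in> topspace C" for t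
    using gam that by (auto simp: etale_map_def loco_map_def continuous_map_def Pi_iff)
  have xC: "\<xi> (e, t) \<in> topspace C" if "e \<in> topspace E" "t \<in> topspace C" "p e = p (\<gamma> t)" for e t
    using continuous_map_funspace[OF xi(1)] that by (force simp: topspace_fibre_product)
  define R where "R s t \<longleftrightarrow> s \<in> topspace C \<and> t \<in> topspace C \<and> p (\<gamma> s) = p (\<gamma> t) \<and> \<xi> (\<gamma> s, t) = s" for s t
  have Rrefl: "R t t" if "t \<in> topspace C" for t using that unit by (simp add: R_def)
  have Rsym: "R t s" if "R s t" for s t
    using that assoc[of "\<gamma> t" "\<gamma> s" t] unit[of t] gE by (auto simp: R_def)
  have Rtrans: "R s v" if "R s t" "R t v" for s t v
    using that assoc[of "\<gamma> s" "\<gamma> t" v] gE by (auto simp: R_def)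
  have Rxi: "R (\<xi> (e, t)) t" if "e \<in> topspace E" "t \<in> topspace C" "p e = p (\<gamma> t)" for e t
    using that gx xC by (auto simp: R_def)
  define r where "r t = (SOME s. R s t)" for t
  have rR: "R (r t) t" if "t \<in> topspace C" for t
    unfolding r_def by (rule someI) (rule Rrefl[OF that])
  have r_eq: "r s = r t \<longleftrightarrow> R s t" if "s \<in> topspace C" "t \<in> topspace C" for s t
  proof
    assume "r s = r t" then show "R s t" using rR that Rsym Rtrans by metis
  next
    assume "R s t"
    then have "R v s \<longleftrightarrow> R v t" for v using Rsym Rtrans by blast
    then show "r s = r t" by (simp add: r_def)
  qed
  have rC: "r t \<in> topspace C" if "t \<in> topspace C" for t using rR[OF that] by (simp add: R_def)
  define A where "A = topology (\<lambda>W. W \<subseteq> r ` topspace C \<and> openin C {t \<in> topspace C. r t \<in> W})"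
  have "istopology (\<lambda>W. W \<subseteq> r ` topspace C \<and> openin C {t \<in> topspace C. r t \<in> W})"
    unfolding istopology_def
  proof (intro conjI allI impI)
    fix S T assume "S \<subseteq> r ` topspace C \<and> openin C {t \<in> topspace C. r t \<in> S}"
      "T \<subseteq> r ` topspace C \<and> openin C {t \<in> topspace C. r t \<in> T}"
    moreover have "{t \<in> topspace C. r t \<in> S \<inter> T} =
      {t \<in> topspace C. r t \<in> S} \<inter> {t \<in> topspace C. r t \<in> T}" by blast
    ultimately show "S \<inter> T \<subseteq> r ` topspace C" "openin C {t \<in> topspace C. r t \<in> S \<inter> T}" by auto
  next
    fix K assume K: "\<forall>S\<in>K. S \<subseteq> r ` topspace C \<and> openin C {t \<in> topspace C. r t \<in> S}"
    have "{t \<in> topspace C. r t \<in> \<Union>K} = (\<Union>S\<in>K. {t \<in> topspace C. r t \<in> S})" by blast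
    then show "openin C {t \<in> topspace C. r t \<in> \<Union>K}" using K by auto
    show "\<Union>K \<subseteq> r ` topspace C" using K by blast
  qed
  then have oA: "openin A W \<longleftrightarrow> W \<subseteq> r ` topspace C \<and> openin C {t \<in> topspace C. r t \<in> W}" for W
    by (simp add: A_def)
  have topA: "topspace A = r ` topspace C"
  proof
    show "topspace A \<subseteq> r ` topspace C" using oA[of "topspace A"] by simp
    have "{t \<in> topspace C. r t \<in> r ` topspace C} = topspace C" by auto
    then have "openin A (r ` topspace C)" unfolding oA by simp
    then show "r ` topspace C \<subseteq> topspace A" by (rule openin_subset)
  qed
  have q: "quotient_map C A r" unfolding quotient_map_def using topA oA by auto
  then have rc: "continuous_map C A r" by (rule quotient_imp_continuous_map)
  have lhp: "local_homeomorphism E B p" and lhg: "local_homeomorphism C E \<gamma>"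
    and lhpg: "local_homeomorphism C B (p \<circ> \<gamma>)"
    using et gam pg by (auto simp: etale_map_def)
  have cp: "continuous_map E B p" and cg: "continuous_map C E \<gamma>" and cpg: "continuous_map C B (p \<circ> \<gamma>)"
    using lhp lhg lhpg by (auto simp: local_homeomorphism_iff)
  have xio: "open_map ?G C \<xi>"
  proof (rule open_map_over[OF local_homeomorphism_fibre_product_fst[OF lhpg cp] lhg xi(1)])
    show "\<gamma> (\<xi> z) = fst z" if "z \<in> topspace ?G" for z
      using that gx by (auto simp: topspace_fibre_product)
  qed
  have ro: "open_map C A r"
    unfolding open_map_def oA
  proof (intro allI impI conjI)
    fix W assume W: "openin C W"
    have WC: "W \<subseteq> topspace C" using W openin_subset by blast
    then show "r ` W \<subseteq> r ` topspace C" by blast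
    have "{t \<in> topspace C. r t \<in> r ` W} = \<xi> ` {(e, t). e \<in> topspace E \<and> t \<in> W \<and> p e = (p \<circ> \<gamma>) t}"
      (is "?l = ?r")
    proof
      show "?l \<subseteq> ?r"
      proof
        fix t assume "t \<in> ?l"
        then obtain w where w: "t \<in> topspace C" "w \<in> W" "r t = r w" by blast
        then have "R t w" using r_eq WC by blast
        then have "t = \<xi> (\<gamma> t, w)" "p (\<gamma> t) = p (\<gamma> w)" by (auto simp: R_def)
        then show "t \<in> ?r" using w gE by (auto intro!: image_eqI[of _ _ "(\<gamma> t, w)"])
      qed
      show "?r \<subseteq> ?l"
      proof
        fix t assume "t \<in> ?r"
        then obtain e w where ew: "e \<in> topspace E" "w \<in> W" "p e = p (\<gamma> w)" "t = \<xi> (e, w)" by auto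
        then have "R t w" using Rxi WC by auto
        then have "t \<in> topspace C" "r t = r w" using r_eq WC ew(2) by (auto simp: R_def)
        then show "t \<in> ?l" using ew(2) by blast
      qed
    qed
    moreover have "openin C ?r"
      using xio openin_fibre_product_Times[OF openin_topspace W] unfolding open_map_def by blast
    ultimately show "openin C ?l" by simp
  qed
  define f where "f t = p (\<gamma> t)" for t
  have fr: "f (r t) = p (\<gamma> t)" if "t \<in> topspace C" for t
    using rR[OF that] by (simp add: f_def R_def)
  have fc: "continuous_map A B f"
  proof -
    have "continuous_map C B (f \<circ> r)"
      by (rule continuous_map_eq[OF cpg]) (simp add: fr)
    then show ?thesis using q continuous_compose_quotient_map_eq by blast
  qed
  have fo: "open_map A B f"
    unfolding open_map_def
  proof (intro allI impI)
    fix W assume W: "openin A W"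
    have "f ` W = (p \<circ> \<gamma>) ` {t \<in> topspace C. r t \<in> W}"
    proof
      show "f ` W \<subseteq> (p \<circ> \<gamma>) ` {t \<in> topspace C. r t \<in> W}"
      proof
        fix b assume "b \<in> f ` W"
        then obtain s where s: "s \<in> W" "b = f s" by blast
        then obtain t where "t \<in> topspace C" "s = r t" using W oA by blast
        then show "b \<in> (p \<circ> \<gamma>) ` {t \<in> topspace C. r t \<in> W}" using s fr by auto
      qed
      show "(p \<circ> \<gamma>) ` {t \<in> topspace C. r t \<in> W} \<subseteq> f ` W" using fr by force
    qed
    then show "openin B (f ` W)" using lhpg W oA by (simp add: local_homeomorphism_iff open_map_def)
  qed
  have lhf: "local_homeomorphism A B f"
    unfolding local_homeomorphism_iff
  proof (intro conjI ballI fc fo)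
    fix s assume "s \<in> topspace A"
    then obtain t where t: "t \<in> topspace C" "s = r t" using topA by blast
    obtain V where V: "openin C V" "t \<in> V" "inj_on (p \<circ> \<gamma>) V"
      using lhpg t(1) unfolding local_homeomorphism_iff by blast
    have VC: "V \<subseteq> topspace C" using V openin_subset by blast
    have "openin A (r ` V)" using ro V(1) by (simp add: open_map_def)
    moreover have "inj_on f (r ` V)"
    proof (rule inj_onI, clarify)
      fix t t' assume "t \<in> V" "t' \<in> V" "f (r t) = f (r t')"
      then have "(p \<circ> \<gamma>) t = (p \<circ> \<gamma>) t'" using fr[of t] fr[of t'] subsetD[OF VC] by simp
      then have "t = t'" using V(3) \<open>t \<in> V\<close> \<open>t' \<in> V\<close> by (meson inj_onD)
      then show "r t = r t'" by simp
    qed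
    ultimately show "\<exists>V. openin A V \<and> s \<in> V \<and> inj_on f V" using t V(2) by blast
  qed
  have cC: "c \<in> topspace C" and gc: "\<gamma> c = x" and px: "p x = y"
    using gam et by (auto simp: etale_map_def loco_map_def pointed_loco_def)
  have A: "etale_map A (r c) B y f"
    using lhf fc fr[OF cC] gc px cC topA et local_homeomorphism_locally_connected[OF lhf]
    by (auto simp: etale_map_def loco_map_def pointed_loco_def)
  let ?F = "fibre_product E p A f"
  define k where "k = (\<lambda>(e, s). \<xi> (e, s))"
  have krt: "\<xi> (e, r t) = \<xi> (e, t)" if "e \<in> topspace E" "t \<in> topspace C" "p e = p (\<gamma> t)" for e t
  proof -
    have R: "R (r t) t" using rR that(2) .
    then show ?thesis using assoc[of e "\<gamma> (r t)" t] that gE by (auto simp: R_def)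
  qed
  have inF: "\<exists>t \<in> topspace C. z = (e, r t) \<and> p e = p (\<gamma> t) \<and> e \<in> topspace E"
    if "z \<in> topspace ?F" "fst z = e" for z e
    using that by (auto simp: topspace_fibre_product topA fr)
  define m where "m t = (\<gamma> t, r t)" for t
  have mc: "continuous_map C ?F m"
    unfolding continuous_map_into_fibre_product m_def using cg rc
    by (auto simp: comp_def fr)
  have km: "k (m t) = t" if "t \<in> topspace C" for t
    using krt[OF gE[OF that] that] unit[OF that] by (simp add: k_def m_def)
  have mk: "m (k z) = z" "k z \<in> topspace C" if z: "z \<in> topspace ?F" for z
  proof -
    obtain e t where t: "t \<in> topspace C" "z = (e, r t)" "p e = p (\<gamma> t)" "e \<in> topspace E"
      using inF[OF z refl] by (metis surj_pair)
    have kz: "k z = \<xi> (e, t)" using krt t by (simp add: k_def)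
    have "R (\<xi> (e, t)) t" using Rxi t by blast
    then have "r (\<xi> (e, t)) = r t" using r_eq t(1) by (auto simp: R_def)
    then show "m (k z) = z" using kz t gx by (simp add: m_def)
    show "k z \<in> topspace C" using kz xC t by simp
  qed
  have mo: "open_map C ?F m"
  proof (rule open_map_over[OF lhg local_homeomorphism_fibre_product_fst[OF lhf cp] mc])
  qed (simp add: m_def)
  have m: "homeomorphic_map C ?F m"
  proof (rule bijective_open_imp_homeomorphic_map[OF mc mo])
    show "m ` topspace C = topspace ?F"
      using continuous_map_funspace[OF mc] mk by force
    show "inj_on m (topspace C)" using km by (metis inj_onI)
  qed
  have kc: "continuous_map ?F C k"
  proof -
    obtain k' where k': "homeomorphic_maps C ?F m k'" using m homeomorphic_map_maps by blast
    have "k' z = k z" if "z \<in> topspace ?F" for z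
      using k' that mk[OF that] by (metis homeomorphic_maps_def)
    moreover have "continuous_map ?F C k'" using k' by (simp add: homeomorphic_maps_def)
    ultimately show ?thesis using continuous_map_eq by blast
  qed
  have kh: "homeomorphic_maps C ?F m k"
    using mc kc km mk by (simp add: homeomorphic_maps_def)
  have kmap: "homeomorphic_map ?F C k"
    using kh homeomorphic_maps_sym homeomorphic_maps_map by blast
  have "T_algebra_map E p ?F (x, r c) fst comparison_str C c \<gamma> \<xi> k"
    unfolding T_algebra_map_def over_map_def loco_map_def
  proof (intro conjI ballI impI kc)
    show "pointed_loco ?F (x, r c)"
      using etale_map_fibre_product_fst[OF et A] by (simp add: etale_map_def loco_map_def)
    show "pointed_loco C c" using gam by (simp add: etale_map_def loco_map_def)
    show "k (x, r c) = c" using km[OF cC] gc by (simp add: m_def)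
    show "\<gamma> (k z) = fst z" if "z \<in> topspace ?F" for z
      using mk(1)[OF that] by (metis fst_conv m_def)
    show "k (comparison_str (e, z)) = \<xi> (e, k z)"
      if e: "e \<in> topspace E" and z: "z \<in> topspace ?F" and ez: "p e = p (fst z)" for e z
    proof -
      obtain e' t where t: "t \<in> topspace C" "z = (e', r t)" "p e' = p (\<gamma> t)" "e' \<in> topspace E"
        using inF[OF z refl] by (metis surj_pair)
      then show ?thesis
        using ez krt e assoc[of e e' t] by (simp add: comparison_str_def k_def)
    qed
  qed
  then show ?thesis using A kmap by blast
qed

lemma monadic_extension_iff:
  fixes i :: "'b \<Rightarrow> 'u" and p :: "'e \<Rightarrow> 'b"
  assumes "inj i"
  shows "monadic_extension TYPE('u) E x B y p \<longleftrightarrow>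
           etale_map E x B y p \<and> p ` topspace E = topspace B" (is "?L \<longleftrightarrow> ?R")
proof
  assume L: ?L
  then have "etale_map E x B y p" unfolding monadic_extension_def by (rule conjunct1)
  then show ?R using surj_of_monadic_extension[OF assms L] by (rule conjI)
next
  assume R: ?R
  have surj: "p ` topspace E = topspace B" and et: "etale_map E x B y p" using R by blast+
  show ?L
    unfolding monadic_extension_def
  proof (intro conjI allI impI ballI)
    show "etale_map E x B y p" by (rule et)
  next
    fix A :: "'u topology" and a f and A' :: "'u topology" and a' f' h h' t
    assume A: "etale_map A a B y f \<and> etale_map A' a' B y f'"
      and h: "over_map A a f A' a' f' h \<and> over_map A a f A' a' f' h' \<and>
         (\<forall>(e, t) \<in> topspace (fibre_product E p A f). (e, h t) = (e, h' t))" and t: "t \<in> topspace A"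
    show "h t = h' t"
      by (rule over_map_unique_descent[OF surj conjunct1[OF A] conjunct2[OF conjunct2[OF h]] t])
  next
    fix A :: "'u topology" and a f and A' :: "'u topology" and a' f' k
    assume A: "etale_map A a B y f \<and> etale_map A' a' B y f'"
      and k: "T_algebra_map E p (fibre_product E p A f) (x, a) fst comparison_str
              (fibre_product E p A' f') (x, a') fst comparison_str k"
    show "\<exists>h. over_map A a f A' a' f' h \<and>
           (\<forall>(e, t) \<in> topspace (fibre_product E p A f). k (e, t) = (e, h t))"
      by (rule over_map_descent[OF et surj conjunct1[OF A] conjunct2[OF A] k])
  next
    fix C :: "'u topology" and c \<gamma> \<xi>
    assume "T_algebra E x p C c \<gamma> \<xi>"
    then show "\<exists>(A :: 'u topology) a f k. etale_map A a B y f \<and>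
           homeomorphic_map (fibre_product E p A f) C k \<and>
           T_algebra_map E p (fibre_product E p A f) (x, a) fst comparison_str C c \<gamma> \<xi> k"
      by (rule T_algebra_descent[OF et])
  qed
qed

corollary monadic_extension_sum_iff:
  fixes p :: "'e \<Rightarrow> 'b"
  shows "monadic_extension TYPE('e + 'b) E x B y p \<longleftrightarrow>
           etale_map E x B y p \<and> p ` topspace E = topspace B"
  by (rule monadic_extension_iff[OF inj_Inr])

end

theory Submission
  imports Defs
begin

text \<open>The point is that a normal extension \<open>p\<close> is a covering map
  (\<open>normal_extension_covering_map\<close>).  It is a surjective local homeomorphism, and its pullback along
  itself is a trivial covering, that is, over each component of \<open>E\<close> a disjoint union of copies of that
  component.  A small open set in \<open>B\<close> is the homeomorphic image of an open set \<open>V\<close> inside one component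
  of \<open>E\<close>, and the part of the kernel pair over \<open>V\<close> is a copy of the preimage of \<open>p ` V\<close>; so \<open>p ` V\<close>
  is evenly covered.

  After that the theorem is classical covering theory.  Paths and homotopies lift uniquely
  (\<open>covering_map_unique_lift\<close>, \<open>covering_map_liftable_square\<close>, \<open>path_lift_homotopic\<close>), hence the
  endpoint of a lifted loop depends only on its homotopy class.  Exactness reads off this endpoint:
  null-homotopies lift, so \<open>\<pi>\<^sub>1(E) \<rightarrow> \<pi>\<^sub>1(B)\<close> has trivial kernel (\<open>pi1_map_covering_kernel\<close>); a loop lifts
  to a loop exactly if its class comes from \<open>\<pi>\<^sub>1(E)\<close> (\<open>lift_end_kernel\<close>); the endpoints of lifted loops
  are the points of the fibre that a path joins to \<open>x\<close> (\<open>lift_end_image\<close>); and lifting a path to \<open>y\<close>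
  shows that every component of \<open>E\<close> meets the fibre (\<open>covering_path_to_fibre\<close>).  All spaces are locally
  path-connected, so components are path components.

  A universal covering is constructed as the space of homotopy classes of paths from \<open>y\<close>
  (\<open>universal_covering_ucover\<close>).  For an arbitrary universal covering \<open>u\<close>, the lifting theorem for simply
  connected, locally path-connected spaces (\<open>covering_map_lift_exists\<close>) gives the map \<open>U \<rightarrow> E\<close> over \<open>B\<close>
  that defines \<open>\<delta>\<^sub>p\<close>.  It takes lifts of loops to \<open>U\<close> to lifts of loops to \<open>E\<close>, so \<open>\<delta>\<^sub>p\<close> is the
  classical boundary once \<open>\<pi>\<^sub>1(B)\<close> is identified with the fibre of \<open>u\<close> (\<open>bij_betw_lift_end\<close>,
  \<open>lift_end_delta\<close>); its naturality is uniqueness of lifts (\<open>delta_natural\<close>).\<close>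

section \<open>The path groupoid of a topology\<close>

lemma continuous_map_compose_euclidean:
  assumes "continuous_map (top_of_set T) X h" "continuous_on S \<phi>" "\<And>s. s \<in> S \<Longrightarrow> \<phi> s \<in> T"
  shows "continuous_map (top_of_set S) X (\<lambda>s. h (\<phi> s))"
proof -
  have "continuous_map (top_of_set S) (top_of_set T) \<phi>"
    using assms(2,3) by (auto simp: continuous_map_in_subtopology)
  from continuous_map_compose[OF this assms(1)] show ?thesis by (simp add: comp_def)
qed

lemma continuous_map_paste_euclidean:
  fixes a :: "'a::topological_space \<Rightarrow> real"
  assumes f: "continuous_map (top_of_set {s \<in> S. a s \<le> c}) X f"
    and g: "continuous_map (top_of_set {s \<in> S. c \<le> a s}) X g"
    and a: "continuous_on S a" and fg: "\<And>s. s \<in> S \<Longrightarrow> a s = c \<Longrightarrow> f s = g s"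
  shows "continuous_map (top_of_set S) X (\<lambda>s. if a s \<le> c then f s else g s)"
proof (rule continuous_map_cases_le)
  have "{s \<in> topspace (top_of_set S). a s \<le> c} = {s \<in> S. a s \<le> c}"
    "{s \<in> topspace (top_of_set S). c \<le> a s} = {s \<in> S. c \<le> a s}" by auto
  then show "continuous_map (subtopology (top_of_set S) {s \<in> topspace (top_of_set S). a s \<le> c}) X f"
    "continuous_map (subtopology (top_of_set S) {s \<in> topspace (top_of_set S). c \<le> a s}) X g"
    using f g by (simp_all add: subtopology_subtopology Int_absorb1 Collect_mono_iff subset_iff)
qed (use a fg in auto)

definition path_homotopic :: "'a topology \<Rightarrow> 'a \<Rightarrow> 'a \<Rightarrow> (real \<Rightarrow> 'a) \<Rightarrow> (real \<Rightarrow> 'a) \<Rightarrow> bool" where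
  "path_homotopic X a b = homotopic_with (\<lambda>\<sigma>. \<sigma> 0 = a \<and> \<sigma> 1 = b) (top_of_set {0..1}) X"

lemma path_homotopic_iff:
  "path_homotopic X a b \<alpha> \<beta> \<longleftrightarrow>
     (\<exists>H. continuous_map (top_of_set ({0..1 :: real} \<times> {0..1 :: real})) X H \<and>
        (\<forall>s \<in> {0..1}. H (0, s) = \<alpha> s \<and> H (1, s) = \<beta> s) \<and>
        (\<forall>t \<in> {0..1}. H (t, 0) = a \<and> H (t, 1) = b))"
  unfolding path_homotopic_def
  by (subst homotopic_with) (auto simp: prod_topology_subtopology_eu ball_conj_distrib)

lemma path_homotopicI:
  assumes "continuous_map (top_of_set ({0..1 :: real} \<times> {0..1 :: real})) X (\<lambda>(t, s). H t s)"
    and "\<And>s. s \<in> {0..1} \<Longrightarrow> H 0 s = \<alpha> s" "\<And>s. s \<in> {0..1} \<Longrightarrow> H 1 s = \<beta> s"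
    and "\<And>t. t \<in> {0..1} \<Longrightarrow> H t 0 = a" "\<And>t. t \<in> {0..1} \<Longrightarrow> H t 1 = b"
  shows "path_homotopic X a b \<alpha> \<beta>"
  unfolding path_homotopic_iff using assms by (intro exI[of _ "\<lambda>(t, s). H t s"]) auto

lemma path_homotopic_sym: "path_homotopic X a b \<alpha> \<beta> \<Longrightarrow> path_homotopic X a b \<beta> \<alpha>"
  unfolding path_homotopic_def by (rule homotopic_with_symD)

lemma path_homotopic_trans [trans]:
  "path_homotopic X a b \<alpha> \<beta> \<Longrightarrow> path_homotopic X a b \<beta> \<gamma> \<Longrightarrow> path_homotopic X a b \<alpha> \<gamma>"
  unfolding path_homotopic_def by (rule homotopic_with_trans)

lemma path_homotopic_imp:
  assumes "path_homotopic X a b \<alpha> \<beta>"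
  shows "pathin X \<alpha>" "pathin X \<beta>" "\<alpha> 0 = a" "\<alpha> 1 = b" "\<beta> 0 = a" "\<beta> 1 = b"
  using homotopic_with_imp_continuous_maps[OF assms[unfolded path_homotopic_def]]
    homotopic_with_imp_property[OF assms[unfolded path_homotopic_def]] by (auto simp: pathin_def)

lemma path_homotopic_refl: "pathin X \<alpha> \<Longrightarrow> \<alpha> 0 = a \<Longrightarrow> \<alpha> 1 = b \<Longrightarrow> path_homotopic X a b \<alpha> \<alpha>"
  by (simp add: path_homotopic_def pathin_def)

lemma path_homotopic_equal:
  assumes "pathin X \<alpha>" "\<And>s. s \<in> {0..1} \<Longrightarrow> \<alpha> s = \<beta> s" "\<alpha> 0 = a" "\<alpha> 1 = b"
  shows "path_homotopic X a b \<alpha> \<beta>"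
  unfolding path_homotopic_def
  by (rule homotopic_with_equal) (use assms in \<open>auto simp: pathin_def\<close>)

lemma path_homotopic_compose:
  assumes "path_homotopic X a b \<alpha> \<beta>" "continuous_map X Y f"
  shows "path_homotopic Y (f a) (f b) (f \<circ> \<alpha>) (f \<circ> \<beta>)"
  using assms unfolding path_homotopic_def
  by (rule homotopic_with_compose_continuous_map_left) auto

lemma pathin_compose_euclidean:
  assumes "pathin X \<gamma>" "continuous_on {0..1} \<phi>" "\<phi> \<in> {0..1} \<rightarrow> {0..1}"
  shows "pathin X (\<lambda>s. \<gamma> (\<phi> s))"
  unfolding pathin_def
  by (rule continuous_map_compose_euclidean[OF assms(1)[unfolded pathin_def] assms(2)]) (use assms(3) in auto)

text \<open>The unit interval is convex, so the straight-line homotopy from \<open>\<phi>\<close> to \<open>\<psi>\<close> stays in it.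
  Associativity, units and inverses for \<open>pjoin\<close> are instances.\<close>

lemma path_homotopic_reparam:
  assumes \<gamma>: "pathin X \<gamma>" and \<phi>: "continuous_on {0..1} \<phi>" "\<phi> \<in> {0..1} \<rightarrow> {0..1}"
    and \<psi>: "continuous_on {0..1} \<psi>" "\<psi> \<in> {0..1} \<rightarrow> {0..1}"
    and eq: "\<psi> 0 = \<phi> 0" "\<psi> 1 = \<phi> 1" and ab: "a = \<gamma> (\<phi> 0)" "b = \<gamma> (\<phi> 1)"
    and \<alpha>: "\<And>s. s \<in> {0..1} \<Longrightarrow> \<alpha> s = \<gamma> (\<phi> s)" and \<beta>: "\<And>s. s \<in> {0..1} \<Longrightarrow> \<beta> s = \<gamma> (\<psi> s)"
  shows "path_homotopic X a b \<alpha> \<beta>"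
proof (rule path_homotopicI)
  let ?k = "\<lambda>z. (1 - fst z) * \<phi> (snd z) + fst z * \<psi> (snd z)"
  have "continuous_map (top_of_set ({0..1 :: real} \<times> {0..1 :: real})) X (\<lambda>z. \<gamma> (?k z))"
  proof (rule continuous_map_compose_euclidean[OF \<gamma>[unfolded pathin_def]])
    show "continuous_on ({0..1 :: real} \<times> {0..1 :: real}) ?k"
      by (intro continuous_intros continuous_on_compose2[OF \<phi>(1)] continuous_on_compose2[OF \<psi>(1)])
        auto
    fix z :: "real \<times> real" assume "z \<in> {0..1} \<times> {0..1}"
    moreover from this have "\<phi> (snd z) \<in> {0..1}" "\<psi> (snd z) \<in> {0..1}" using \<phi>(2) \<psi>(2) by auto
    ultimately show "?k z \<in> {0..1}"
      using convexD_alt[of "{0..1::real}" "\<phi> (snd z)" "\<psi> (snd z)" "fst z"] by auto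
  qed
  then show "continuous_map (top_of_set ({0..1 :: real} \<times> {0..1 :: real})) X
      (\<lambda>(t, s). \<gamma> ((1 - t) * \<phi> s + t * \<psi> s))" by (simp add: case_prod_beta')
qed (use eq ab \<alpha> \<beta> in \<open>auto simp: algebra_simps\<close>)

text \<open>Concatenation as in \<open>(+++)\<close>, without the sort constraint on the codomain.\<close>

definition pjoin :: "(real \<Rightarrow> 'a) \<Rightarrow> (real \<Rightarrow> 'a) \<Rightarrow> real \<Rightarrow> 'a" where
  "pjoin \<alpha> \<beta> s = (if s \<le> 1/2 then \<alpha> (2 * s) else \<beta> (2 * s - 1))"

definition prev :: "(real \<Rightarrow> 'a) \<Rightarrow> real \<Rightarrow> 'a" where
  "prev \<alpha> s = \<alpha> (1 - s)"

lemma pjoin_0 [simp]: "pjoin \<alpha> \<beta> 0 = \<alpha> 0" and pjoin_1 [simp]: "pjoin \<alpha> \<beta> 1 = \<beta> 1"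
  by (simp_all add: pjoin_def)

lemma prev_0 [simp]: "prev \<alpha> 0 = \<alpha> 1" and prev_1 [simp]: "prev \<alpha> 1 = \<alpha> 0"
  and prev_prev [simp]: "prev (prev \<alpha>) = \<alpha>"
  by (simp_all add: prev_def fun_eq_iff)

lemma pathin_prev: "pathin X \<alpha> \<Longrightarrow> pathin X (prev \<alpha>)"
  unfolding prev_def by (rule pathin_compose_euclidean) (auto intro!: continuous_intros)

lemma pathin_pjoin:
  assumes "pathin X \<alpha>" "pathin X \<beta>" "\<alpha> 1 = \<beta> 0"
  shows "pathin X (pjoin \<alpha> \<beta>)"
proof -
  have "\<alpha> (2 * s) = \<beta> (2 * s - 1)" if "s * 2 = 1" for s
    using that assms(3) by (simp add: mult.commute)
  then show ?thesis
    unfolding pathin_def pjoin_def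
    by (intro continuous_map_paste_euclidean
        continuous_map_compose_euclidean[OF assms(1)[unfolded pathin_def]]
        continuous_map_compose_euclidean[OF assms(2)[unfolded pathin_def]])
      (auto intro!: continuous_intros)
qed

lemma pjoin_cong:
  assumes "path_homotopic X a b \<alpha> \<alpha>'" "path_homotopic X b c \<beta> \<beta>'"
  shows "path_homotopic X a c (pjoin \<alpha> \<beta>) (pjoin \<alpha>' \<beta>')"
proof -
  obtain H where H: "continuous_map (top_of_set ({0..1 :: real} \<times> {0..1 :: real})) X H"
      "\<And>s. s \<in> {0..1} \<Longrightarrow> H (0, s) = \<alpha> s \<and> H (1, s) = \<alpha>' s"
      "\<And>t. t \<in> {0..1} \<Longrightarrow> H (t, 0) = a \<and> H (t, 1) = b"
    using assms(1) unfolding path_homotopic_iff by meson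
  obtain K where K: "continuous_map (top_of_set ({0..1 :: real} \<times> {0..1 :: real})) X K"
      "\<And>s. s \<in> {0..1} \<Longrightarrow> K (0, s) = \<beta> s \<and> K (1, s) = \<beta>' s"
      "\<And>t. t \<in> {0..1} \<Longrightarrow> K (t, 0) = b \<and> K (t, 1) = c"
    using assms(2) unfolding path_homotopic_iff by meson
  have "H (t, 2 * s) = K (t, 2 * s - 1)" if "s * 2 = 1" "0 \<le> t" "t \<le> 1" for t s
    using that H(3)[of t] K(3)[of t] by (simp add: mult.commute)
  note this [simp]
  show ?thesis
  proof (rule path_homotopicI)
    have "continuous_map (top_of_set ({0..1 :: real} \<times> {0..1 :: real})) X
        (\<lambda>z. if snd z \<le> 1/2 then H (fst z, 2 * snd z) else K (fst z, 2 * snd z - 1))"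
      by (intro continuous_map_paste_euclidean continuous_map_compose_euclidean[OF H(1)]
          continuous_map_compose_euclidean[OF K(1)])
        (auto intro!: continuous_intros simp: H K)
    then show "continuous_map (top_of_set ({0..1 :: real} \<times> {0..1 :: real})) X
        (\<lambda>(t, s). pjoin (\<lambda>s. H (t, s)) (\<lambda>s. K (t, s)) s)"
      by (simp add: pjoin_def case_prod_beta')
  qed (auto simp: H K pjoin_def)
qed

lemma pjoin_assoc:
  assumes "pathin X \<alpha>" "pathin X \<beta>" "pathin X \<gamma>" "\<alpha> 1 = \<beta> 0" "\<beta> 1 = \<gamma> 0" "a = \<alpha> 0" "c = \<gamma> 1"
  shows "path_homotopic X a c (pjoin (pjoin \<alpha> \<beta>) \<gamma>) (pjoin \<alpha> (pjoin \<beta> \<gamma>))"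
proof (rule path_homotopic_reparam)
  show "pathin X (pjoin \<alpha> (pjoin \<beta> \<gamma>))" using assms by (auto intro!: pathin_pjoin)
  \<comment> \<open>The reparametrization has slopes 2, 1 and 1/2; being concave, it is the minimum of its pieces.\<close>
  let ?\<phi> = "\<lambda>s::real. min (2 * s) (min (s + 1/4) (s / 2 + 1/2))"
  show "continuous_on {0..1} ?\<phi>" by (intro continuous_intros) auto
  show "?\<phi> \<in> {0..1} \<rightarrow> {0..1}" by (auto simp: min_def)
  show "pjoin (pjoin \<alpha> \<beta>) \<gamma> s = pjoin \<alpha> (pjoin \<beta> \<gamma>) (?\<phi> s)" if "s \<in> {0..1}" for s
  proof -
    consider "s \<le> 1/4" | "1/4 < s" "s \<le> 1/2" | "1/2 < s" by linarith
    then show ?thesis by cases (auto simp: pjoin_def min_def algebra_simps add_divide_distrib)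
  qed
  show "continuous_on {0..1} (\<lambda>s::real. s)" by (rule continuous_on_id)
qed (use assms in auto)

lemma pjoin_const_right:
  assumes "pathin X \<alpha>" "a = \<alpha> 0" "b = \<alpha> 1"
  shows "path_homotopic X a b (pjoin \<alpha> (\<lambda>_. b)) \<alpha>"
proof (rule path_homotopic_reparam[OF assms(1)])
  show "continuous_on {0..1} (\<lambda>s::real. min (2 * s) 1)" by (intro continuous_intros)
  show "continuous_on {0..1} (\<lambda>s::real. s)" by (rule continuous_on_id)
qed (use assms in \<open>auto simp: pjoin_def min_def\<close>)

lemma pjoin_const_left:
  assumes "pathin X \<alpha>" "a = \<alpha> 0" "b = \<alpha> 1"
  shows "path_homotopic X a b (pjoin (\<lambda>_. a) \<alpha>) \<alpha>"
proof (rule path_homotopic_reparam[OF assms(1)])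
  show "continuous_on {0..1} (\<lambda>s::real. max 0 (2 * s - 1))" by (intro continuous_intros)
  show "continuous_on {0..1} (\<lambda>s::real. s)" by (rule continuous_on_id)
qed (use assms in \<open>auto simp: pjoin_def max_def intro!: arg_cong[of _ _ \<alpha>]\<close>)

lemma pjoin_prev_right:
  assumes "pathin X \<alpha>" "a = \<alpha> 0"
  shows "path_homotopic X a a (pjoin \<alpha> (prev \<alpha>)) (\<lambda>_. a)"
proof (rule path_homotopic_reparam[OF assms(1)])
  show "continuous_on {0..1} (\<lambda>s::real. min (2 * s) (2 - 2 * s))" by (intro continuous_intros)
  show "continuous_on {0..1} (\<lambda>s::real. 0::real)" by (rule continuous_on_const)
qed (use assms in \<open>auto simp: pjoin_def prev_def min_def algebra_simps\<close>)

lemma pjoin_prev_left: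
  assumes "pathin X \<alpha>" "b = \<alpha> 1"
  shows "path_homotopic X b b (pjoin (prev \<alpha>) \<alpha>) (\<lambda>_. b)"
  using pjoin_prev_right[OF pathin_prev[OF assms(1)], of b] assms(2) by simp

text \<open>Cancellation of \<open>\<gamma>\<close>: prepend its inverse.\<close>

lemma pjoin_cancel_left:
  assumes \<gamma>: "pathin X \<gamma>" and \<eta>: "pathin X \<eta>" "\<gamma> 1 = \<eta> 0" and \<eta>': "pathin X \<eta>'" "\<gamma> 1 = \<eta>' 0"
    and h: "path_homotopic X a b (pjoin \<gamma> \<eta>) (pjoin \<gamma> \<eta>')"
  shows "path_homotopic X (\<gamma> 1) b \<eta> \<eta>'"
proof -
  have ab: "a = \<gamma> 0" "b = \<eta> 1" "b = \<eta>' 1" using path_homotopic_imp[OF h] by auto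
  have *: "path_homotopic X (\<gamma> 1) b \<zeta> (pjoin (prev \<gamma>) (pjoin \<gamma> \<zeta>))"
    if \<zeta>: "pathin X \<zeta>" "\<gamma> 1 = \<zeta> 0" "b = \<zeta> 1" for \<zeta>
  proof -
    have "path_homotopic X (\<gamma> 1) b \<zeta> (pjoin (\<lambda>_. \<gamma> 1) \<zeta>)"
      using \<zeta> by (intro path_homotopic_sym[OF pjoin_const_left]) auto
    also have "path_homotopic X (\<gamma> 1) b \<dots> (pjoin (pjoin (prev \<gamma>) \<gamma>) \<zeta>)"
      using \<zeta> by (intro pjoin_cong[OF path_homotopic_sym[OF pjoin_prev_left[OF \<gamma> refl]]] path_homotopic_refl) auto
    also have "path_homotopic X (\<gamma> 1) b \<dots> (pjoin (prev \<gamma>) (pjoin \<gamma> \<zeta>))"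
      using \<zeta> \<gamma> by (intro pjoin_assoc pathin_prev) auto
    finally show ?thesis .
  qed
  have "path_homotopic X (\<gamma> 1) b \<eta> (pjoin (prev \<gamma>) (pjoin \<gamma> \<eta>))" using * \<eta> ab by auto
  also have "path_homotopic X (\<gamma> 1) b \<dots> (pjoin (prev \<gamma>) (pjoin \<gamma> \<eta>'))"
    by (rule pjoin_cong[OF path_homotopic_refl h[unfolded ab(1)]]) (use \<gamma> pathin_prev ab in auto)
  also have "path_homotopic X (\<gamma> 1) b \<dots> \<eta>'" by (rule path_homotopic_sym[OF *]) (use \<eta>' ab in auto)
  finally show ?thesis .
qed

lemma path_homotopic_of_loop:
  assumes \<alpha>: "pathin X \<alpha>" and \<beta>: "pathin X \<beta>" "\<alpha> 1 = \<beta> 1"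
    and h: "path_homotopic X a a (pjoin \<alpha> (prev \<beta>)) (\<lambda>_. a)"
  shows "path_homotopic X a (\<alpha> 1) \<alpha> \<beta>"
proof -
  have a: "\<alpha> 0 = a" "\<beta> 0 = a" using path_homotopic_imp[OF h] by auto
  have "path_homotopic X a (\<alpha> 1) \<alpha> (pjoin \<alpha> (\<lambda>_. \<alpha> 1))"
    using \<alpha> a by (intro path_homotopic_sym[OF pjoin_const_right]) auto
  also have "path_homotopic X a (\<alpha> 1) \<dots> (pjoin \<alpha> (pjoin (prev \<beta>) \<beta>))"
    using \<alpha> a by (intro pjoin_cong[OF _ path_homotopic_sym[OF pjoin_prev_left[OF \<beta>(1,2)]]] path_homotopic_refl) auto
  also have "path_homotopic X a (\<alpha> 1) \<dots> (pjoin (pjoin \<alpha> (prev \<beta>)) \<beta>)"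
    using \<alpha> \<beta> a by (intro path_homotopic_sym[OF pjoin_assoc] pathin_prev) auto
  also have "path_homotopic X a (\<alpha> 1) \<dots> (pjoin (\<lambda>_. a) \<beta>)"
    using h \<beta> a by (intro pjoin_cong path_homotopic_refl) auto
  also have "path_homotopic X a (\<alpha> 1) \<dots> \<beta>" using \<beta> a by (intro pjoin_const_left) auto
  finally show ?thesis .
qed

lemma loop_homotopic_eq: "loop_homotopic X x = path_homotopic X x x"
  by (simp add: loop_homotopic_def path_homotopic_def)

lemma simply_connected_path_homotopic:
  assumes "simply_connected_space X" "pathin X \<alpha>" "pathin X \<beta>" "\<alpha> 0 = \<beta> 0" "\<alpha> 1 = \<beta> 1"
  shows "path_homotopic X (\<alpha> 0) (\<alpha> 1) \<alpha> \<beta>"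
proof -
  let ?l = "pjoin \<alpha> (prev \<beta>)"
  have l: "pathin X ?l" using assms by (intro pathin_pjoin pathin_prev) auto
  have a: "\<alpha> 0 \<in> topspace X" using assms(2) path_start_in_topspace by blast
  have "loop_class X (\<alpha> 0) ?l \<in> pi1 X (\<alpha> 0)"
    unfolding pi1_def using l assms(4) by (intro imageI) (simp add: loops_def)
  then have "loop_class X (\<alpha> 0) ?l = pi1_one X (\<alpha> 0)"
    using assms(1) a by (simp add: simply_connected_space_def)
  moreover have "(\<lambda>_. \<alpha> 0) \<in> pi1_one X (\<alpha> 0)"
    using a by (simp add: pi1_one_def loop_class_def loop_homotopic_eq path_homotopic_refl)
  ultimately have "path_homotopic X (\<alpha> 0) (\<alpha> 0) ?l (\<lambda>_. \<alpha> 0)"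
    by (auto simp: loop_class_def loop_homotopic_eq)
  then show ?thesis using assms by (intro path_homotopic_of_loop) auto
qed

lemma loop_class_eq_iff:
  assumes "\<omega> \<in> loops X x"
  shows "loop_class X x \<omega> = loop_class X x \<sigma> \<longleftrightarrow> path_homotopic X x x \<omega> \<sigma>"
proof
  assume "loop_class X x \<omega> = loop_class X x \<sigma>"
  moreover have "\<omega> \<in> loop_class X x \<omega>"
    using assms by (simp add: loop_class_def loop_homotopic_eq loops_def path_homotopic_refl)
  ultimately show "path_homotopic X x x \<omega> \<sigma>"
    by (auto simp: loop_class_def loop_homotopic_eq intro: path_homotopic_sym)
next
  assume "path_homotopic X x x \<omega> \<sigma>"
  then show "loop_class X x \<omega> = loop_class X x \<sigma>"
    unfolding loop_class_def loop_homotopic_eq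
    by (blast intro: path_homotopic_sym path_homotopic_trans)
qed

lemma pi1_trivialI:
  assumes x: "x \<in> topspace X" and h: "\<And>\<omega>. \<omega> \<in> loops X x \<Longrightarrow> path_homotopic X x x \<omega> (\<lambda>_. x)"
  shows "pi1 X x = {pi1_one X x}"
proof -
  have "loop_class X x \<omega> = pi1_one X x" if "\<omega> \<in> loops X x" for \<omega>
    unfolding pi1_one_def loop_class_eq_iff[OF that] by (rule h[OF that])
  then have "pi1 X x = (\<lambda>_. pi1_one X x) ` loops X x"
    unfolding pi1_def by (rule image_cong[OF refl])
  moreover have "(\<lambda>_. x) \<in> loops X x" using x by (simp add: loops_def)
  ultimately show ?thesis using image_constant by metis
qed

section \<open>Covering maps\<close>

text \<open>All that lifting needs from an evenly covered set \<open>V\<close>: each point over \<open>V\<close> lies on a section,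
  and a map into \<open>V\<close> is lifted by composing it with that section.\<close>

lemma covering_map_section:
  assumes cov: "covering_map E B p" and b: "b \<in> topspace B"
  obtains V where "openin B V" "b \<in> V"
    "\<And>e. e \<in> topspace E \<Longrightarrow> p e \<in> V \<Longrightarrow> \<exists>s. continuous_map (subtopology B V) E s \<and> s (p e) = e \<and>
            (\<forall>v \<in> V. p (s v) = v)"
proof -
  obtain V \<V> where V: "openin B V" "b \<in> V"
    and \<V>: "\<Union>\<V> = {t \<in> topspace E. p t \<in> V}" "\<And>W. W \<in> \<V> \<Longrightarrow> openin E W"
      "\<And>W. W \<in> \<V> \<Longrightarrow> homeomorphic_map (subtopology E W) (subtopology B V) p"
    using cov b unfolding covering_map_def by meson
  show thesis
  proof (rule that[OF V])
    fix e assume "e \<in> topspace E" "p e \<in> V"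
    then have "e \<in> \<Union>\<V>" by (simp add: \<V>(1))
    then obtain W where W: "W \<in> \<V>" "e \<in> W" by blast
    obtain s where s: "homeomorphic_maps (subtopology E W) (subtopology B V) p s"
      using \<V>(3)[OF W(1)] homeomorphic_map_maps by blast
    have top: "topspace (subtopology E W) = W" "topspace (subtopology B V) = V"
      using \<V>(2)[OF W(1)] V(1) openin_subset by (auto simp: Int_absorb1)
    show "\<exists>s. continuous_map (subtopology B V) E s \<and> s (p e) = e \<and>
            (\<forall>v \<in> V. p (s v) = v)"
      using s W(2) top
      by (intro exI[of _ s]) (auto simp: homeomorphic_maps_def continuous_map_in_subtopology)
  qed
qed

lemma covering_map_local_homeomorphism:
  assumes cov: "covering_map E B p"
  shows "local_homeomorphism E B p"
  unfolding local_homeomorphism_def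
proof (intro conjI ballI)
  show "continuous_map E B p" using cov by (simp add: covering_map_def)
  fix e assume e: "e \<in> topspace E"
  then have "p e \<in> topspace B" using cov by (auto simp: covering_map_def)
  then obtain V \<V> where V: "openin B V" "p e \<in> V"
    and \<V>: "\<Union>\<V> = {t \<in> topspace E. p t \<in> V}" "\<And>W. W \<in> \<V> \<Longrightarrow> openin E W"
      "\<And>W. W \<in> \<V> \<Longrightarrow> homeomorphic_map (subtopology E W) (subtopology B V) p"
    using cov unfolding covering_map_def by meson
  obtain W where W: "W \<in> \<V>" "e \<in> W" using \<V>(1) e V(2) by blast
  have "p ` W = V"
    using homeomorphic_imp_surjective_map[OF \<V>(3)[OF W(1)]] openin_subset[OF \<V>(2)[OF W(1)]]
      openin_subset[OF V(1)] by (simp add: Int_absorb1)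
  then show "\<exists>W. openin E W \<and> e \<in> W \<and> openin B (p ` W) \<and>
        homeomorphic_map (subtopology E W) (subtopology B (p ` W)) p"
    using W V(1) \<V> by blast
qed

lemma local_homeomorphism_locally_path_connected:
  assumes f: "local_homeomorphism X Y f" and Y: "locally_path_connected_space Y"
  shows "locally_path_connected_space X"
  unfolding locally_path_connected_space
proof (intro allI impI)
  fix W t assume W: "openin X W \<and> t \<in> W"
  then have "t \<in> topspace X" using openin_subset by blast
  then obtain V where V: "openin X V" "t \<in> V" "openin Y (f ` V)"
      "homeomorphic_map (subtopology X V) (subtopology Y (f ` V)) f"
    using f unfolding local_homeomorphism_def by blast
  have "locally_path_connected_space (subtopology Y (f ` V))"
    using Y V(3) locally_path_connected_space_open_subset by blast
  then have "locally_path_connected_space (subtopology X V)"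
    using V(4) homeomorphic_locally_path_connected_space homeomorphic_map_imp_homeomorphic_space
    by blast
  moreover have "openin (subtopology X V) (V \<inter> W)" using W by (auto simp: openin_subtopology)
  ultimately obtain U where "openin (subtopology X V) U" "path_connectedin (subtopology X V) U"
      "t \<in> U" "U \<subseteq> V \<inter> W"
    unfolding locally_path_connected_space using V(2) W by (metis IntI)
  then show "\<exists>U. openin X U \<and> path_connectedin X U \<and> t \<in> U \<and> U \<subseteq> W"
    using V(1) openin_trans_full path_connectedin_subtopology by (metis Int_subset_iff)
qed

text \<open>The equalizer of two lifts is open because \<open>p\<close> is locally injective, and closed because
  distinct points of a fibre lie in disjoint sheets.\<close>

lemma covering_map_unique_lift:
  assumes cov: "covering_map E B p" and Z: "connected_space Z"
    and h: "continuous_map Z E h" and h': "continuous_map Z E h'"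
    and eq: "\<And>t. t \<in> topspace Z \<Longrightarrow> p (h t) = p (h' t)"
    and z: "z \<in> topspace Z" "h z = h' z" and t: "t \<in> topspace Z"
  shows "h t = h' t"
proof -
  define S where "S = {t \<in> topspace Z. h t = h' t}"
  have sheets: "\<exists>W W'. openin E W \<and> openin E W' \<and> h s \<in> W \<and> h' s \<in> W' \<and>
      inj_on p W \<and> inj_on p W' \<and> (W = W' \<or> disjnt W W')" if s: "s \<in> topspace Z" for s
  proof -
    have hs: "h s \<in> topspace E" "h' s \<in> topspace E" using h h' s by (auto simp: continuous_map_def)
    then have "p (h s) \<in> topspace B" using cov by (auto simp: covering_map_def)
    then obtain V \<V> where V: "p (h s) \<in> V"
      and \<V>: "\<Union>\<V> = {t \<in> topspace E. p t \<in> V}" "\<And>W. W \<in> \<V> \<Longrightarrow> openin E W" "pairwise disjnt \<V>"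
        "\<And>W. W \<in> \<V> \<Longrightarrow> homeomorphic_map (subtopology E W) (subtopology B V) p"
      using cov unfolding covering_map_def by meson
    have inj: "inj_on p W" if "W \<in> \<V>" for W
      using homeomorphic_imp_injective_map[OF \<V>(4)[OF that]] openin_subset[OF \<V>(2)[OF that]]
      by (simp add: Int_absorb1)
    have "h s \<in> \<Union>\<V>" "h' s \<in> \<Union>\<V>" using V hs eq[OF s] by (auto simp: \<V>(1))
    then show ?thesis using \<V>(2,3) inj unfolding pairwise_def by (metis UnionE)
  qed
  have nb: "\<exists>T. openin Z T \<and> s \<in> T \<and> (if h s = h' s then T \<subseteq> S else T \<inter> S = {})"
    if s: "s \<in> topspace Z" for s
  proof -
    obtain W W' where W: "openin E W" "openin E W'" "h s \<in> W" "h' s \<in> W'"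
      "inj_on p W" "inj_on p W'" "W = W' \<or> disjnt W W'" using sheets[OF s] by blast
    define T where "T = {t \<in> topspace Z. h t \<in> W} \<inter> {t \<in> topspace Z. h' t \<in> W'}"
    have T: "openin Z T" "s \<in> T"
      unfolding T_def using openin_continuous_map_preimage[OF h W(1)]
        openin_continuous_map_preimage[OF h' W(2)] W(3,4) s by auto
    have same: "T \<subseteq> S" if "W = W'"
      using that W(5) eq by (auto simp: T_def S_def inj_on_def)
    have diff: "T \<inter> S = {}" if "disjnt W W'"
      using that by (auto simp: T_def S_def disjnt_iff)
    show ?thesis
    proof (cases "h s = h' s")
      case True
      then have "W = W'" using W(3,4,7) by (auto simp: disjnt_iff)
      then show ?thesis using True T same by auto
    next
      case False
      then have "W \<noteq> W'" using W eq[OF s] by (auto simp: inj_on_def)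
      then show ?thesis using False T diff W(7) by auto
    qed
  qed
  have "openin Z S"
    by (subst openin_subopen) (use nb in \<open>force simp: S_def\<close>)
  moreover have "openin Z (topspace Z - S)"
  proof (subst openin_subopen, intro ballI)
    fix s assume "s \<in> topspace Z - S"
    then have s: "s \<in> topspace Z" "h s \<noteq> h' s" by (auto simp: S_def)
    then obtain T where "openin Z T" "s \<in> T" "T \<inter> S = {}" using nb by metis
    then show "\<exists>T. openin Z T \<and> s \<in> T \<and> T \<subseteq> topspace Z - S" using openin_subset by blast
  qed
  ultimately have "S = {} \<or> S = topspace Z"
    using Z unfolding connected_space_clopen_in closedin_def by (auto simp: S_def)
  then show ?thesis using z t by (auto simp: S_def)
qed

text \<open>The starting point \<open>z\<close> of the lift is arbitrary, so that a lift on one piece of \<open>Z\<close> can be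
  continued on another piece from any common point.\<close>

definition liftable :: "'a topology \<Rightarrow> ('a \<Rightarrow> 'b) \<Rightarrow> 'z topology \<Rightarrow> ('z \<Rightarrow> 'b) \<Rightarrow> bool" where
  "liftable E p Z f \<longleftrightarrow>
     (\<forall>z \<in> topspace Z. \<forall>e \<in> topspace E. p e = f z \<longrightarrow> (\<exists>k. is_lift E e p Z z f k))"

text \<open>A lift on \<open>S\<close> is continued on \<open>T\<close> from one point of the intersection; as the intersection is
  connected, the two lifts agree on all of it and can be pasted.\<close>

lemma liftable_glue:
  assumes cov: "covering_map E B p"
    and S: "closedin Z S" and T: "closedin Z T" and ST: "S \<union> T = topspace Z"
    and con: "connectedin Z (S \<inter> T)" "S \<inter> T \<noteq> {}"
    and lS: "liftable E p (subtopology Z S) f" and lT: "liftable E p (subtopology Z T) f"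
  shows "liftable E p Z f"
proof -
  have *: "\<exists>k. is_lift E e p Z z f k"
    if S: "closedin Z S" and T: "closedin Z T" and ST: "S \<union> T = topspace Z"
      and con: "connectedin Z (S \<inter> T)" "S \<inter> T \<noteq> {}"
      and lS: "liftable E p (subtopology Z S) f" and lT: "liftable E p (subtopology Z T) f"
      and z: "z \<in> S" and e: "e \<in> topspace E" "p e = f z" for S T z e
  proof -
    have top: "topspace (subtopology Z S) = S" "topspace (subtopology Z T) = T"
      using S T closedin_subset by (auto simp: Int_absorb1)
    obtain \<sigma> where \<sigma>: "is_lift E e p (subtopology Z S) z f \<sigma>"
      using lS z e top unfolding liftable_def by metis
    obtain c where c: "c \<in> S" "c \<in> T" using con(2) by blast
    have "\<sigma> c \<in> topspace E" "p (\<sigma> c) = f c"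
      using \<sigma> c top by (auto simp: is_lift_def continuous_map_def)
    then obtain \<tau> where \<tau>: "is_lift E (\<sigma> c) p (subtopology Z T) c f \<tau>"
      using lT c top unfolding liftable_def by metis
    have topST: "topspace (subtopology Z (S \<inter> T)) = S \<inter> T" using ST by auto
    have agree: "\<sigma> t = \<tau> t" if "t \<in> S \<inter> T" for t
    proof (rule covering_map_unique_lift[OF cov, where z = c])
      show "connected_space (subtopology Z (S \<inter> T))" using con(1) by (simp add: connectedin_def)
      show "continuous_map (subtopology Z (S \<inter> T)) E \<sigma>" "continuous_map (subtopology Z (S \<inter> T)) E \<tau>"
        using \<sigma> \<tau> continuous_map_from_subtopology_mono unfolding is_lift_def by blast+
    qed (use c \<sigma> \<tau> that top topST in \<open>auto simp: is_lift_def\<close>)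
    define k where "k t = (if t \<in> S then \<sigma> t else \<tau> t)" for t
    have "continuous_map Z E k"
    proof (rule pasting_lemma_closed)
      let ?T = "\<lambda>b. if b then S else T" and ?f = "\<lambda>b. if b then \<sigma> else \<tau>"
      show "finite (UNIV :: bool set)" by simp
      show "closedin Z (?T b)" for b using S T by simp
      show "continuous_map (subtopology Z (?T b)) E (?f b)" for b
        using \<sigma> \<tau> by (simp add: is_lift_def)
      show "?f b t = ?f b' t" if "t \<in> topspace Z \<inter> ?T b \<inter> ?T b'" for b b' t
        using that agree by (auto split: if_splits)
      show "\<exists>b. b \<in> UNIV \<and> t \<in> ?T b \<and> k t = ?f b t" if "t \<in> topspace Z" for t
        using that ST by (intro exI[of _ "t \<in> S"]) (auto simp: k_def)
    qed
    then have "is_lift E e p Z z f k"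
      using \<sigma> \<tau> z top ST unfolding is_lift_def by (auto simp: k_def)
    then show ?thesis by blast
  qed
  show ?thesis
    unfolding liftable_def
  proof (intro ballI impI)
    fix z e assume "z \<in> topspace Z" and e: "e \<in> topspace E" "p e = f z"
    then consider "z \<in> S" | "z \<in> T" using ST by blast
    then show "\<exists>k. is_lift E e p Z z f k"
    proof cases
      case 1
      show ?thesis by (rule *[OF S T ST con lS lT 1 e])
    next
      case 2
      show ?thesis by (rule *[OF T S _ _ _ lT lS 2 e]) (use ST con in \<open>auto simp: Int_commute Un_commute\<close>)
    qed
  qed
qed

text \<open>Rectangles over an evenly covered set have the lifting property, and it is inherited by the
  union of two rectangles with a common side.  Bisection in the first coordinate gives it for all
  sufficiently thin horizontal strips, and bisection in the second coordinate for the square.\<close>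

lemma covering_map_liftable_square:
  assumes cov: "covering_map E B p"
    and f: "continuous_map (top_of_set ({0..1} \<times> {0..1 :: real})) B (f :: real \<times> real \<Rightarrow> 'b)"
  shows "liftable E p (top_of_set ({0..1 :: real} \<times> {0..1 :: real})) f"
proof -
  let ?R = "\<lambda>a b c d. liftable E p (top_of_set ({a..b} \<times> {c..d})) f"
  have con: "connected ({a..b} \<times> {c..d})" for a b c d :: real
    by (intro convex_connected convex_Times) auto
  have hglue: "?R a c l u" if "?R a b l u" "?R b c l u" "a \<le> b" "b \<le> c" "l \<le> u" for a b l u c
  proof (rule liftable_glue[OF cov])
    have int: "({a..b} \<times> {l..u}) \<inter> ({b..c} \<times> {l..u}) = {b..b} \<times> {l..u}" using that by auto
    show "connectedin (top_of_set ({a..c} \<times> {l..u})) (({a..b} \<times> {l..u}) \<inter> ({b..c} \<times> {l..u}))"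
      unfolding int connectedin_subtopology connectedin_iff_connected using con that by auto
    show "({a..b} \<times> {l..u}) \<inter> ({b..c} \<times> {l..u}) \<noteq> {}" unfolding int using that by auto
    have "{a..b} \<times> {l..u} \<subseteq> {a..c} \<times> {l..u}" "{b..c} \<times> {l..u} \<subseteq> {a..c} \<times> {l..u}" using that by auto
    then show "liftable E p (subtopology (top_of_set ({a..c} \<times> {l..u})) ({a..b} \<times> {l..u})) f"
      "liftable E p (subtopology (top_of_set ({a..c} \<times> {l..u})) ({b..c} \<times> {l..u})) f"
      using that by (simp_all add: subtopology_subtopology Int_absorb1)
  qed (use that in \<open>auto intro!: closed_subset closed_Times\<close>)
  have vglue: "?R l u a c" if "?R l u a b" "?R l u b c" "a \<le> b" "b \<le> c" "l \<le> u" for a b c l u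
  proof (rule liftable_glue[OF cov])
    have int: "({l..u} \<times> {a..b}) \<inter> ({l..u} \<times> {b..c}) = {l..u} \<times> {b..b}" using that by auto
    show "connectedin (top_of_set ({l..u} \<times> {a..c})) (({l..u} \<times> {a..b}) \<inter> ({l..u} \<times> {b..c}))"
      unfolding int connectedin_subtopology connectedin_iff_connected using con that by auto
    show "({l..u} \<times> {a..b}) \<inter> ({l..u} \<times> {b..c}) \<noteq> {}" unfolding int using that by auto
    have "{l..u} \<times> {a..b} \<subseteq> {l..u} \<times> {a..c}" "{l..u} \<times> {b..c} \<subseteq> {l..u} \<times> {a..c}" using that by auto
    then show "liftable E p (subtopology (top_of_set ({l..u} \<times> {a..c})) ({l..u} \<times> {a..b})) f"
      "liftable E p (subtopology (top_of_set ({l..u} \<times> {a..c})) ({l..u} \<times> {b..c})) f"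
      using that by (simp_all add: subtopology_subtopology Int_absorb1)
  qed (use that in \<open>auto intro!: closed_subset closed_Times\<close>)
  have local: "\<exists>\<delta>>0. \<forall>a b c d. 0 \<le> a \<and> a \<le> x \<and> x \<le> b \<and> b \<le> 1 \<and> b - a < \<delta> \<and>
      0 \<le> c \<and> c \<le> y \<and> y \<le> d \<and> d \<le> 1 \<and> d - c < \<delta> \<longrightarrow> ?R a b c d"
    if x: "x \<in> {0..1}" and y: "y \<in> {0..1}" for x y :: real
  proof -
    have "f (x, y) \<in> topspace B" using f x y by (auto simp: continuous_map_def)
    then obtain V where V: "openin B V" "f (x, y) \<in> V" and sec:
      "\<And>e. e \<in> topspace E \<Longrightarrow> p e \<in> V \<Longrightarrow> \<exists>s. continuous_map (subtopology B V) E s \<and> s (p e) = e \<and>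
            (\<forall>v \<in> V. p (s v) = v)"
      using covering_map_section[OF cov] by metis
    have o: "openin (top_of_set ({0..1} \<times> {0..1})) {z \<in> {0..1} \<times> {0..1}. f z \<in> V}"
      using openin_continuous_map_preimage[OF f V(1)] by simp
    have i: "(x, y) \<in> {z \<in> {0..1} \<times> {0..1}. f z \<in> V}" using x y V(2) by simp
    obtain \<epsilon> where \<epsilon>: "\<epsilon> > 0"
      "ball (x, y) \<epsilon> \<inter> ({0..1} \<times> {0..1}) \<subseteq> {z \<in> {0..1} \<times> {0..1}. f z \<in> V}"
      using bspec[OF conjunct2[OF o[unfolded openin_contains_ball]] i] by auto
    have "?R a b c d" if r: "0 \<le> a" "a \<le> x" "x \<le> b" "b \<le> 1" "b - a < \<epsilon> / 2"
      "0 \<le> c" "c \<le> y" "y \<le> d" "d \<le> 1" "d - c < \<epsilon> / 2" for a b c d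
    proof -
      have fV: "f z \<in> V" if z: "z \<in> {a..b} \<times> {c..d}" for z
      proof -
        obtain x' y' where z': "z = (x', y')" "a \<le> x'" "x' \<le> b" "c \<le> y'" "y' \<le> d" using z by auto
        have "dist (x, y) z \<le> \<bar>x - x'\<bar> + \<bar>y - y'\<bar>"
          using sqrt_sum_squares_le_sum_abs[of "x - x'" "y - y'"]
          by (simp add: z' dist_Pair_Pair dist_real_def)
        also have "\<dots> < \<epsilon>" using r z' by (auto simp: abs_if)
        finally have "z \<in> ball (x, y) \<epsilon>" by simp
        moreover have "z \<in> {0..1} \<times> {0..1}" using r z' by auto
        ultimately show ?thesis using \<epsilon>(2) by blast
      qed
      have "{a..b} \<times> {c..d} \<subseteq> {0..1} \<times> {0..1}" using r by auto
      then have "continuous_map (top_of_set ({a..b} \<times> {c..d})) B f"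
        by (intro continuous_map_from_subtopology_mono[OF f])
      then have fV': "continuous_map (top_of_set ({a..b} \<times> {c..d})) (subtopology B V) f"
        using fV by (auto simp: continuous_map_in_subtopology)
      show ?thesis
        unfolding liftable_def
      proof (intro ballI impI)
        fix z e assume z: "z \<in> topspace (top_of_set ({a..b} \<times> {c..d}))" and e: "e \<in> topspace E" "p e = f z"
        then obtain s where s: "continuous_map (subtopology B V) E s" "s (p e) = e"
          "\<forall>v \<in> V. p (s v) = v" using sec fV by force
        have "is_lift E e p (top_of_set ({a..b} \<times> {c..d})) z f (s \<circ> f)"
          unfolding is_lift_def using continuous_map_compose[OF fV' s(1)] s(2,3) e fV by auto
        then show "\<exists>k. is_lift E e p (top_of_set ({a..b} \<times> {c..d})) z f k" by blast
      qed
    qed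
    then show ?thesis using \<epsilon>(1) by (intro exI[of _ "\<epsilon> / 2"]) auto
  qed
  have strip: "\<exists>\<delta>>0. \<forall>c d. 0 \<le> c \<and> c \<le> y \<and> y \<le> d \<and> d \<le> 1 \<and> d - c < \<delta> \<longrightarrow> ?R 0 1 c d"
    if y: "y \<in> {0..1}" for y :: real
  proof -
    define Q where "Q a b \<longleftrightarrow> (0 \<le> a \<and> b \<le> 1 \<longrightarrow>
      (\<exists>\<delta>>0. \<forall>c d. 0 \<le> c \<and> c \<le> y \<and> y \<le> d \<and> d \<le> 1 \<and> d - c < \<delta> \<longrightarrow> ?R a b c d))" for a b
    have "Q 0 1"
    proof (rule Bolzano)
      fix a b c assume Q: "Q a b" "Q b c" and le: "a \<le> b" "b \<le> c"
      show "Q a c"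
        unfolding Q_def
      proof
        assume ac: "0 \<le> a \<and> c \<le> 1"
        then have "0 \<le> a \<and> b \<le> 1" "0 \<le> b \<and> c \<le> 1" using le by auto
        then obtain \<delta> \<delta>' where d: "\<delta> > 0" "\<delta>' > 0"
          "\<forall>l u. 0 \<le> l \<and> l \<le> y \<and> y \<le> u \<and> u \<le> 1 \<and> u - l < \<delta> \<longrightarrow> ?R a b l u"
          "\<forall>l u. 0 \<le> l \<and> l \<le> y \<and> y \<le> u \<and> u \<le> 1 \<and> u - l < \<delta>' \<longrightarrow> ?R b c l u"
          using Q unfolding Q_def by auto
        show "\<exists>\<delta>>0. \<forall>l u. 0 \<le> l \<and> l \<le> y \<and> y \<le> u \<and> u \<le> 1 \<and> u - l < \<delta> \<longrightarrow> ?R a c l u"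
        proof (intro exI[of _ "min \<delta> \<delta>'"] conjI allI impI)
          fix l u assume "0 \<le> l \<and> l \<le> y \<and> y \<le> u \<and> u \<le> 1 \<and> u - l < min \<delta> \<delta>'"
          then show "?R a c l u" using d le by (intro hglue[of a b l u c]) auto
        qed (use d in auto)
      qed
    next
      fix x :: real assume "0 \<le> x" "x \<le> 1"
      then obtain \<delta> where d: "\<delta> > 0" "\<And>a b c d. 0 \<le> a \<and> a \<le> x \<and> x \<le> b \<and> b \<le> 1 \<and> b - a < \<delta> \<and>
        0 \<le> c \<and> c \<le> y \<and> y \<le> d \<and> d \<le> 1 \<and> d - c < \<delta> \<Longrightarrow> ?R a b c d"
        using local[of x y] y by auto
      show "\<exists>\<delta>>0. \<forall>a b. a \<le> x \<and> x \<le> b \<and> b - a < \<delta> \<longrightarrow> Q a b"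
      proof (intro exI[of _ \<delta>] conjI allI impI)
        fix a b assume ab: "a \<le> x \<and> x \<le> b \<and> b - a < \<delta>"
        show "Q a b"
          unfolding Q_def
        proof
          assume "0 \<le> a \<and> b \<le> 1"
          then show "\<exists>\<delta>>0. \<forall>c d. 0 \<le> c \<and> c \<le> y \<and> y \<le> d \<and> d \<le> 1 \<and> d - c < \<delta> \<longrightarrow> ?R a b c d"
            using d ab by (intro exI[of _ \<delta>]) auto
        qed
      qed (rule d)
    qed simp
    then show ?thesis by (simp add: Q_def)
  qed
  define P where "P c d \<longleftrightarrow> (0 \<le> c \<and> d \<le> 1 \<longrightarrow> ?R 0 1 c d)" for c d
  have "P 0 1"
  proof (rule Bolzano)
    fix a b c assume "P a b" "P b c" "a \<le> b" "b \<le> c"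
    then show "P a c" unfolding P_def using vglue[of 0 1 a b c] by auto
  next
    fix y :: real assume y: "0 \<le> y" "y \<le> 1"
    then obtain \<delta> where "\<delta> > 0" "\<And>c d. 0 \<le> c \<and> c \<le> y \<and> y \<le> d \<and> d \<le> 1 \<and> d - c < \<delta> \<Longrightarrow> ?R 0 1 c d"
      using strip[of y] by auto
    then show "\<exists>\<delta>>0. \<forall>c d. c \<le> y \<and> y \<le> d \<and> d - c < \<delta> \<longrightarrow> P c d"
      unfolding P_def by (intro exI[of _ \<delta>]) auto
  qed simp
  then show ?thesis by (simp add: P_def)
qed

abbreviation path_lift :: "'e topology \<Rightarrow> 'e \<Rightarrow> ('e \<Rightarrow> 'b) \<Rightarrow> (real \<Rightarrow> 'b) \<Rightarrow> (real \<Rightarrow> 'e) \<Rightarrow> bool" where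
  "path_lift E e p \<equiv> is_lift E e p (top_of_set {0..1}) 0"

lemma path_lift_iff:
  "path_lift E e p \<gamma> \<sigma> \<longleftrightarrow> pathin E \<sigma> \<and> \<sigma> 0 = e \<and> (\<forall>s \<in> {0..1}. p (\<sigma> s) = \<gamma> s)"
  by (simp add: is_lift_def pathin_def)

lemma path_lift_exists:
  assumes cov: "covering_map E B p" and \<gamma>: "pathin B \<gamma>" and e: "e \<in> topspace E" "p e = \<gamma> 0"
  obtains \<sigma> where "path_lift E e p \<gamma> \<sigma>"
proof -
  have "continuous_map (top_of_set ({0..1} \<times> {0..1 :: real})) B (\<lambda>z. \<gamma> (fst z))"
    by (rule continuous_map_compose_euclidean[OF \<gamma>[unfolded pathin_def]]) (auto intro: continuous_intros)
  then have "liftable E p (top_of_set ({0..1} \<times> {0..1 :: real})) (\<lambda>z. \<gamma> (fst z))"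
    by (rule covering_map_liftable_square[OF cov])
  then obtain k where k: "is_lift E e p (top_of_set ({0..1} \<times> {0..1 :: real})) (0, 0) (\<lambda>z. \<gamma> (fst z)) k"
    using e unfolding liftable_def by force
  have "path_lift E e p \<gamma> (\<lambda>s. k (s, 0))"
    unfolding is_lift_def
  proof (intro conjI)
    show "continuous_map (top_of_set {0..1}) E (\<lambda>s. k (s, 0))"
      by (rule continuous_map_compose_euclidean[of "{0..1} \<times> {0..1}"])
        (use k in \<open>auto simp: is_lift_def intro!: continuous_intros\<close>)
  qed (use k in \<open>auto simp: is_lift_def\<close>)
  then show thesis by (rule that)
qed

lemma path_lift_unique:
  assumes cov: "covering_map E B p" and "path_lift E e p \<gamma> \<sigma>" "path_lift E e p \<gamma> \<sigma>'" "s \<in> {0..1}"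
  shows "\<sigma> s = \<sigma>' s"
  by (rule covering_map_unique_lift[OF cov, of "top_of_set {0..1 :: real}" _ _ 0])
    (use assms in \<open>auto simp: is_lift_def\<close>)

text \<open>The sides \<open>s = 0\<close> and \<open>s = 1\<close> of the lifted square lie over constant paths, so they are constant.\<close>

lemma path_lift_homotopic:
  assumes cov: "covering_map E B p" and h: "path_homotopic B a b \<gamma> \<gamma>'"
    and \<sigma>: "path_lift E e p \<gamma> \<sigma>" and \<sigma>': "path_lift E e p \<gamma>' \<sigma>'"
  shows "path_homotopic E e (\<sigma> 1) \<sigma> \<sigma>'"
proof -
  obtain H where H: "continuous_map (top_of_set ({0..1 :: real} \<times> {0..1 :: real})) B H"
      "\<And>s. s \<in> {0..1} \<Longrightarrow> H (0, s) = \<gamma> s \<and> H (1, s) = \<gamma>' s"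
      "\<And>t. t \<in> {0..1} \<Longrightarrow> H (t, 0) = a \<and> H (t, 1) = b"
    using h unfolding path_homotopic_iff by meson
  have e: "e \<in> topspace E" "p e = H (0, 0)"
    using \<sigma> H(2)[of 0] path_start_in_topspace[of E \<sigma>] by (auto simp: path_lift_iff)
  then obtain K where K: "is_lift E e p (top_of_set ({0..1 :: real} \<times> {0..1 :: real})) (0, 0) H K"
    using covering_map_liftable_square[OF cov H(1)] unfolding liftable_def by force
  have Kc: "continuous_map (top_of_set ({0..1 :: real} \<times> {0..1 :: real})) E K" and K0: "K (0, 0) = e"
    and pK: "\<And>t s. t \<in> {0..1} \<Longrightarrow> s \<in> {0..1} \<Longrightarrow> p (K (t, s)) = H (t, s)"
    using K by (auto simp: is_lift_def)
  have along_s: "path_lift E (K (t, 0)) p (\<lambda>s. H (t, s)) (\<lambda>s. K (t, s))" if "t \<in> {0..1}" for t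
    unfolding is_lift_def
    using that pK by (auto intro!: continuous_map_compose_euclidean[OF Kc] continuous_intros)
  have along_t: "path_lift E (K (0, s)) p (\<lambda>t. H (t, s)) (\<lambda>t. K (t, s))" if "s \<in> {0..1}" for s
    unfolding is_lift_def
    using that pK by (auto intro!: continuous_map_compose_euclidean[OF Kc] continuous_intros)
  have const: "K (t, s) = K (0, s)" if ts: "t \<in> {0..1}" "s \<in> {0, 1}" for t s
  proof -
    have s: "s \<in> {0..1}" using ts by auto
    have "K (0, s) \<in> topspace E" using Kc s by (auto simp: continuous_map_def)
    then have "path_lift E (K (0, s)) p (\<lambda>t. H (t, s)) (\<lambda>_. K (0, s))"
      unfolding path_lift_iff using pK[of 0 s] H(3) ts by auto
    from path_lift_unique[OF cov along_t[OF s] this ts(1)] show ?thesis .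
  qed
  have left: "K (0, s) = \<sigma> s" if s: "s \<in> {0..1}" for s
  proof -
    have "path_lift E e p \<gamma> (\<lambda>s. K (0, s))" using along_s[of 0] H(2) K0 by (simp add: path_lift_iff)
    from path_lift_unique[OF cov this \<sigma> s] show ?thesis .
  qed
  have right: "K (1, s) = \<sigma>' s" if s: "s \<in> {0..1}" for s
  proof -
    have "K (1, 0) = e" using const[of 1 0] K0 by simp
    then have "path_lift E e p \<gamma>' (\<lambda>s. K (1, s))" using along_s[of 1] H(2) by (simp add: path_lift_iff)
    from path_lift_unique[OF cov this \<sigma>' s] show ?thesis .
  qed
  have "K (t, 0) = e \<and> K (t, 1) = \<sigma> 1" if t: "t \<in> {0..1}" for t
    using const[OF t, of 0] const[OF t, of 1] K0 left[of 1] by simp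
  then show ?thesis
    unfolding path_homotopic_iff using Kc left right by blast
qed

text \<open>The lift at \<open>t\<close> is the end of the lift of \<open>k\<close> along a path from \<open>z\<close> to \<open>t\<close>; simple connectivity
  makes it independent of the path.  Continuity: on a path-connected neighbourhood of \<open>t\<close> that \<open>k\<close>
  maps into an evenly covered set, the path to a point can be taken through \<open>t\<close>, so that there the
  lift is \<open>k\<close> followed by one section.\<close>

lemma covering_map_lift_exists:
  assumes cov: "covering_map E B p"
    and Z: "simply_connected_space Z" "locally_path_connected_space Z" "z \<in> topspace Z"
    and k: "continuous_map Z B k" and e: "e \<in> topspace E" "p e = k z"
  obtains h where "is_lift E e p Z z k h"
proof -
  have "\<exists>\<tau>. pathin Z \<tau> \<and> \<tau> 0 = z \<and> \<tau> 1 = t" if "t \<in> topspace Z" for t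
    using Z that by (auto simp: simply_connected_space_def path_connected_space_def)
  then obtain \<tau> where \<tau>: "\<And>t. t \<in> topspace Z \<Longrightarrow> pathin Z (\<tau> t) \<and> \<tau> t 0 = z \<and> \<tau> t 1 = t" by metis
  have "\<exists>\<sigma>. path_lift E e p (k \<circ> \<tau> t) \<sigma>" if "t \<in> topspace Z" for t
    using path_lift_exists[OF cov pathin_compose[OF _ k], of "\<tau> t" e] \<tau>[OF that] e by force
  then obtain L where L: "\<And>t. t \<in> topspace Z \<Longrightarrow> path_lift E e p (k \<circ> \<tau> t) (L t)" by metis
  define h where "h t = L t 1" for t
  have end_unique: "h t = \<sigma> 1"
    if "path_lift E e p (k \<circ> \<alpha>) \<sigma>" "pathin Z \<alpha>" "\<alpha> 0 = z" "\<alpha> 1 = t" for \<alpha> \<sigma> t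
  proof -
    have t: "t \<in> topspace Z" using that path_finish_in_topspace by blast
    have "path_homotopic Z z t (\<tau> t) \<alpha>"
      using simply_connected_path_homotopic[OF Z(1), of "\<tau> t" \<alpha>] \<tau>[OF t] that by auto
    then have "path_homotopic E e (L t 1) (L t) \<sigma>"
      using path_lift_homotopic[OF cov path_homotopic_compose[OF _ k] L[OF t] that(1)] by blast
    then show ?thesis using path_homotopic_imp by (fastforce simp: h_def)
  qed
  have ph: "p (h t) = k t" "h t \<in> topspace E" if "t \<in> topspace Z" for t
    using L[OF that] \<tau>[OF that] path_finish_in_topspace[of E "L t"] by (auto simp: path_lift_iff h_def)
  have "\<exists>N g. openin Z N \<and> t \<in> N \<and> continuous_map (subtopology Z N) E g \<and> (\<forall>t' \<in> N. h t' = g t')"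
    if t: "t \<in> topspace Z" for t
  proof -
    have "k t \<in> topspace B" using k t by (auto simp: continuous_map_def)
    then obtain V where V: "openin B V" "k t \<in> V" and sec:
      "\<And>e. e \<in> topspace E \<Longrightarrow> p e \<in> V \<Longrightarrow> \<exists>s. continuous_map (subtopology B V) E s \<and> s (p e) = e \<and>
            (\<forall>v \<in> V. p (s v) = v)"
      using covering_map_section[OF cov] by metis
    obtain s where s: "continuous_map (subtopology B V) E s" "s (k t) = h t" "\<forall>v \<in> V. p (s v) = v"
      using sec[of "h t"] ph[OF t] V(2) by auto
    obtain N where N: "openin Z N" "path_connectedin Z N" "t \<in> N" "N \<subseteq> {t \<in> topspace Z. k t \<in> V}"
      using Z(2) openin_continuous_map_preimage[OF k V(1)] t V(2)
      unfolding locally_path_connected_space by (metis (mono_tags, lifting) mem_Collect_eq)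
    have sk: "continuous_map (subtopology Z N) E (s \<circ> k)"
      using continuous_map_from_subtopology[OF k] N(4) s(1)
      by (intro continuous_map_compose[of _ "subtopology B V"]) (auto simp: continuous_map_in_subtopology)
    have "h t' = (s \<circ> k) t'" if t': "t' \<in> N" for t'
    proof -
      have "path_connected_space (subtopology Z N)" "t \<in> topspace (subtopology Z N)"
        "t' \<in> topspace (subtopology Z N)"
        using N t' t by (auto simp: path_connectedin_def)
      then obtain \<eta> where \<eta>: "pathin (subtopology Z N) \<eta>" "\<eta> 0 = t" "\<eta> 1 = t'"
        unfolding path_connected_space_def by blast
      have \<eta>Z: "pathin Z \<eta>" "\<And>s. s \<in> {0..1} \<Longrightarrow> k (\<eta> s) \<in> V"
        using \<eta>(1) N(4) by (auto simp: pathin_subtopology)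
      have "path_lift E e p (k \<circ> pjoin (\<tau> t) \<eta>) (pjoin (L t) ((s \<circ> k) \<circ> \<eta>))"
        unfolding path_lift_iff
      proof (intro conjI ballI)
        show "pathin E (pjoin (L t) ((s \<circ> k) \<circ> \<eta>))"
          using L[OF t] pathin_compose[OF \<eta>(1) sk] \<eta>(2) s(2)
          by (intro pathin_pjoin) (auto simp: path_lift_iff h_def)
        show "p (pjoin (L t) ((s \<circ> k) \<circ> \<eta>) r) = (k \<circ> pjoin (\<tau> t) \<eta>) r" if "r \<in> {0..1}" for r
          using L[OF t] that s(3) \<eta>Z(2) by (auto simp: path_lift_iff pjoin_def)
      qed (use L[OF t] in \<open>auto simp: path_lift_iff\<close>)
      then show ?thesis
        using end_unique[OF _ pathin_pjoin[OF _ \<eta>Z(1)]] \<tau>[OF t] \<eta> by fastforce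
    qed
    then show ?thesis using N(1,3) sk by blast
  qed
  then obtain N g where N: "\<And>t. t \<in> topspace Z \<Longrightarrow> openin Z (N t) \<and> t \<in> N t \<and>
      continuous_map (subtopology Z (N t)) E (g t) \<and> (\<forall>t' \<in> N t. h t' = g t t')" by metis
  have "continuous_map Z E h"
  proof (rule pasting_lemma[of "topspace Z" Z N E g])
    show "g i t = g j t" if "i \<in> topspace Z" "j \<in> topspace Z" "t \<in> topspace Z \<inter> N i \<inter> N j" for i j t
      using N[OF that(1)] N[OF that(2)] that(3) by (metis IntD1 IntD2)
    show "\<exists>j. j \<in> topspace Z \<and> t \<in> N j \<and> h t = g j t" if "t \<in> topspace Z" for t
      using N[OF that] that by blast
  qed (use N in auto)
  moreover have "h z = e"
    using end_unique[of "\<lambda>_. z" "\<lambda>_. e" z] e Z(3) by (simp add: path_lift_iff)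
  ultimately show thesis using that ph by (auto simp: is_lift_def)
qed

lemma covering_map_has_unique_lift:
  assumes cov: "covering_map E B p"
    and Z: "simply_connected_space Z" "connected_space Z" "locally_path_connected_space Z"
      "z \<in> topspace Z"
    and k: "continuous_map Z B k" and e: "e \<in> topspace E" "p e = k z"
  shows "has_unique_lift E e p Z z k"
proof -
  obtain h where h: "is_lift E e p Z z k h"
    by (rule covering_map_lift_exists[OF cov Z(1,3,4) k e])
  have "h' t = h t" if "is_lift E e p Z z k h'" "t \<in> topspace Z" for h' t
    by (rule covering_map_unique_lift[OF cov Z(2) _ _ _ Z(4)])
      (use that h in \<open>auto simp: is_lift_def\<close>)
  then show ?thesis using h unfolding has_unique_lift_def by blast
qed

lemma the_lift:
  assumes "has_unique_lift E e p Z z k"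
  shows "is_lift E e p Z z k (the_lift E e p Z z k)"
  using assms unfolding has_unique_lift_def the_lift_def by (metis someI)

section \<open>Normal extensions are covering maps\<close>

lemma mem_eta_iff:
  assumes "z \<in> topspace X"
  shows "z' \<in> eta X z \<longleftrightarrow> z' \<in> topspace X \<and> eta X z' = eta X z"
proof -
  have "eta X z' = eta X z \<longleftrightarrow> connected_component_of X z' = connected_component_of X z"
    unfolding set_eq_iff fun_eq_iff mem_Collect_eq ..
  moreover have "z' \<in> eta X z \<longleftrightarrow> connected_component_of X z z'" by (rule mem_Collect_eq)
  ultimately show ?thesis using connected_component_of_equiv[of X z z'] assms
    by (simp only: eq_commute[of "connected_component_of X z"]) blast
qed

lemma homeomorphic_map_restrict_open_map:
  assumes "continuous_map X Y f" "open_map X Y f" "openin X W" "inj_on f W"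
  shows "homeomorphic_map (subtopology X W) (subtopology Y (f ` W)) f"
proof (rule bijective_open_imp_homeomorphic_map)
  have W: "W \<subseteq> topspace X" using assms(3) openin_subset by blast
  have fW: "openin Y (f ` W)" using assms(2,3) by (simp add: open_map_def)
  then have fWY: "f ` W \<subseteq> topspace Y" using openin_subset by blast
  show "continuous_map (subtopology X W) (subtopology Y (f ` W)) f"
    using assms(1) by (auto simp: continuous_map_in_subtopology continuous_map_from_subtopology)
  show "open_map (subtopology X W) (subtopology Y (f ` W)) f"
    unfolding open_map_def openin_open_subtopology[OF assms(3)] openin_open_subtopology[OF fW]
    using assms(2) by (auto simp: open_map_def)
  show "f ` topspace (subtopology X W) = topspace (subtopology Y (f ` W))"
    using W fWY by (simp add: Int_absorb1)
  show "inj_on f (topspace (subtopology X W))" using W assms(4) by (simp add: Int_absorb1)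
qed

text \<open>Write \<open>G\<close> for the kernel pair.  If \<open>p\<close> is injective on an open set \<open>V\<close>, then the preimage of
  \<open>p ` V\<close> is the image under the second projection of the part of \<open>G\<close> over \<open>V\<close>, and the sheets are
  the images of the intersections of that part with the components of \<open>G\<close>.  Triviality of the first
  projection says that each component of \<open>G\<close> that meets the part over \<open>V\<close> maps bijectively to a
  component of \<open>E\<close>; hence \<open>V\<close> is taken inside one component.\<close>

theorem normal_extension_covering_map:
  assumes N: "normal_extension E x B y p"
  shows "covering_map E B p"
proof -
  let ?G = "fibre_product E p E p"
  have et: "etale_map E x B y p" and surj: "p ` topspace E = topspace B"
    using N monadic_extension_sum_iff[of E x B y p] by (auto simp: normal_extension_def)
  then have p: "continuous_map E B p" "open_map E B p" "local_homeomorphism E B p"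
    "locally_connected_space E"
    by (auto simp: etale_map_def loco_map_def pointed_loco_def local_homeomorphism_iff)
  have lG: "locally_connected_space ?G"
    using etale_map_fibre_product_fst[OF et et]
    by (auto simp: etale_map_def loco_map_def pointed_loco_def)
  have tG: "topspace ?G = {(s, t). s \<in> topspace E \<and> t \<in> topspace E \<and> p s = p t}"
    by (rule topspace_fibre_product)
  let ?P = "fibre_product E (eta E) (discrete_topology (pi0 ?G)) (pi0_map E fst)"
  let ?\<tau> = "\<lambda>t. (fst t, eta ?G t)"
  have "homeomorphic_map ?G ?P ?\<tau>"
    using N by (simp add: normal_extension_def trivial_covering_def)
  then have inj: "inj_on ?\<tau> (topspace ?G)" and im: "?\<tau> ` topspace ?G = topspace ?P"
    using homeomorphic_imp_injective_map homeomorphic_imp_surjective_map by blast+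
  have tP: "topspace ?P = {(s, C). s \<in> topspace E \<and> C \<in> pi0 ?G \<and> eta E s = pi0_map E fst C}"
    by (simp add: topspace_fibre_product)
  have eta_fst: "eta E (fst z) = pi0_map E fst (eta ?G z)" if "z \<in> topspace ?G" for z
  proof -
    have "?\<tau> z \<in> topspace ?P" using im that by blast
    then show ?thesis by (simp add: tP)
  qed
  have eta_eq: "z' \<in> eta ?G z \<longleftrightarrow> eta ?G z' = eta ?G z" if "z \<in> topspace ?G" "z' \<in> topspace ?G" for z z'
    by (rule trans[OF mem_eta_iff[OF that(1)]]) (simp only: that(2) simp_thms)
  show ?thesis
    unfolding covering_map_def
  proof (rule conjI[OF p(1) conjI[OF surj ballI]])
    fix b assume "b \<in> topspace B"
    then have "b \<in> p ` topspace E" using surj by simp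
    then obtain e where e: "e \<in> topspace E" "p e = b" by (rule imageE) simp
    obtain V0 where V0: "openin E V0" "e \<in> V0" "inj_on p V0"
      using p(3) e(1) unfolding local_homeomorphism_iff by blast
    define V where "V = V0 \<inter> eta E e"
    have V: "openin E V" "e \<in> V" "inj_on p V"
      unfolding V_def
      using V0 openin_connected_component_of_locally_connected_space[OF p(4)] e(1)
      by (auto simp: connected_component_of_refl inj_on_def)
    have VE: "V \<subseteq> topspace E" using V(1) openin_subset by blast
    have etaV: "eta E v = eta E e" if "v \<in> V" for v
      using that mem_eta_iff[OF e(1)] by (auto simp: V_def)
    define S where "S z = {z' \<in> topspace ?G. fst z' \<in> V} \<inter> eta ?G z" for z
    define \<V> where "\<V> = (\<lambda>z. snd ` S z) ` {z \<in> topspace ?G. fst z \<in> V}"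
    have S: "S z = {z' \<in> topspace ?G. fst z' \<in> V \<and> eta ?G z' = eta ?G z}" if "z \<in> topspace ?G" for z
      using eta_eq[OF that] by (auto simp: S_def)
    have base_eq: "fst z = fst z'"
      if "z \<in> topspace ?G" "z' \<in> topspace ?G" "fst z \<in> V" "fst z' \<in> V" "p (snd z) = p (snd z')" for z z'
      using that V(3) tG by (auto simp: inj_on_def)
    show "\<exists>N. openin B N \<and> b \<in> N \<and>
        (\<exists>\<V>. \<Union>\<V> = {t \<in> topspace E. p t \<in> N} \<and> (\<forall>W \<in> \<V>. openin E W) \<and> pairwise disjnt \<V> \<and>
           (\<forall>W \<in> \<V>. homeomorphic_map (subtopology E W) (subtopology B N) p))"
    proof (intro exI[of _ "p ` V"] exI[of _ \<V>] conjI ballI)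
      show "openin B (p ` V)" using p(2) V(1) by (simp add: open_map_def)
      show "b \<in> p ` V" using V(2) e(2) by blast
      show "\<Union>\<V> = {t \<in> topspace E. p t \<in> p ` V}"
      proof
        show "\<Union>\<V> \<subseteq> {t \<in> topspace E. p t \<in> p ` V}"
          using tG by (fastforce simp: \<V>_def S_def)
        show "{t \<in> topspace E. p t \<in> p ` V} \<subseteq> \<Union>\<V>"
        proof
          fix t assume "t \<in> {t \<in> topspace E. p t \<in> p ` V}"
          then obtain v where v: "v \<in> V" "p v = p t" "t \<in> topspace E" by auto
          then have G: "(v, t) \<in> topspace ?G" using VE by (auto simp: tG)
          then have "(v, t) \<in> S (v, t)" using v by (simp add: S)
          then have "t \<in> snd ` S (v, t)" by force
          then show "t \<in> \<Union>\<V>" using G v(1) by (auto simp: \<V>_def)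
        qed
      qed
      show opn: "openin E W" if "W \<in> \<V>" for W
      proof -
        obtain z where z: "z \<in> topspace ?G" "W = snd ` S z" using \<open>W \<in> \<V>\<close> by (auto simp: \<V>_def)
        have "openin ?G {z' \<in> topspace ?G. fst z' \<in> V}"
          using openin_continuous_map_preimage[OF continuous_map_fibre_product_fst V(1)] .
        then have "openin ?G (S z)"
          unfolding S_def using openin_connected_component_of_locally_connected_space[OF lG] by blast
        then show ?thesis using open_map_fibre_product_snd[OF p(3,1)] z(2) by (simp add: open_map_def)
      qed
      show "pairwise disjnt \<V>"
      proof (rule pairwiseI)
        fix W W' assume W: "W \<in> \<V>" "W' \<in> \<V>" "W \<noteq> W'"
        obtain z where z: "z \<in> topspace ?G" "W = snd ` S z" using W(1) by (auto simp: \<V>_def)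
        obtain z' where z': "z' \<in> topspace ?G" "W' = snd ` S z'" using W(2) by (auto simp: \<V>_def)
        have "W = W'" if "t \<in> W" "t \<in> W'" for t
        proof -
          obtain a a' where a: "a \<in> S z" "a' \<in> S z'" "snd a = t" "snd a' = t"
            using \<open>t \<in> W\<close> \<open>t \<in> W'\<close> z(2) z'(2) by (metis imageE)
          have aG: "a \<in> topspace ?G" "a' \<in> topspace ?G" "fst a \<in> V" "fst a' \<in> V"
            "eta ?G a = eta ?G z" "eta ?G a' = eta ?G z'" using a by (simp_all add: S[OF z(1)] S[OF z'(1)])
          have "fst a = fst a'" using base_eq[OF aG(1-4)] a by simp
          then have "a = a'" using a by (simp add: prod_eq_iff)
          then have "eta ?G z = eta ?G z'" using aG by simp
          then show ?thesis using z z' by (simp add: S_def)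
        qed
        then show "disjnt W W'" using W(3) by (auto simp: disjnt_iff)
      qed
      show "homeomorphic_map (subtopology E W) (subtopology B (p ` V)) p" if W: "W \<in> \<V>" for W
      proof -
        obtain z where z: "z \<in> topspace ?G" "fst z \<in> V" "W = snd ` S z" using W by (auto simp: \<V>_def)
        have "inj_on p W"
        proof (rule inj_onI)
          fix t t' assume t: "t \<in> W" "t' \<in> W" "p t = p t'"
          then obtain a a' where a: "a \<in> S z" "a' \<in> S z" "snd a = t" "snd a' = t'"
            using z(3) by (metis imageE)
          have aG: "a \<in> topspace ?G" "a' \<in> topspace ?G" "fst a \<in> V" "fst a' \<in> V"
            "eta ?G a = eta ?G a'" using a by (simp_all add: S[OF z(1)])
          have "fst a = fst a'" using base_eq[OF aG(1-4)] a t by simp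
          then have "a = a'" using aG inj by (auto simp: inj_on_def)
          then show "t = t'" using a by simp
        qed
        moreover have "p ` W = p ` V"
        proof
          show "p ` W \<subseteq> p ` V" using z tG by (fastforce simp: S)
          show "p ` V \<subseteq> p ` W"
          proof
            fix c assume "c \<in> p ` V"
            then obtain v where v: "v \<in> V" "c = p v" by blast
            have "eta E v = pi0_map E fst (eta ?G z)"
              using etaV[OF v(1)] etaV[OF z(2)] eta_fst[OF z(1)] by simp
            moreover have "eta ?G z \<in> pi0 ?G" using z(1) by (simp add: connected_components_of_def)
            ultimately have "(v, eta ?G z) \<in> topspace ?P" using v(1) VE by (auto simp: tP)
            then have "(v, eta ?G z) \<in> ?\<tau> ` topspace ?G" by (simp only: im)
            then obtain a where a: "a \<in> topspace ?G" "(v, eta ?G z) = ?\<tau> a" by (rule imageE)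
            have av: "fst a = v" "eta ?G a = eta ?G z" using a(2) by (simp_all only: prod.inject)
            then have "a \<in> S z" unfolding S[OF z(1)] using a(1) v(1) by blast
            then have "snd a \<in> W" using z(3) by blast
            moreover have "p (snd a) = c" using a(1) av(1) v(2) tG by auto
            ultimately show "c \<in> p ` W" by blast
          qed
        qed
        ultimately show ?thesis
          using homeomorphic_map_restrict_open_map[OF p(1,2) opn[OF W]] by simp
      qed
    qed
  qed
qed

section \<open>The universal covering of an admissible space\<close>

text \<open>Semi-local simple connectivity speaks of loops at \<open>b\<close> only.  For two
  paths in \<open>V\<close> with common endpoints, a path in \<open>V\<close> from \<open>b\<close> to their start makes them into a loop
  at \<open>b\<close>, and this path is cancelled afterwards.\<close>

lemma semilocally_simply_connected_nbhd:
  assumes lpc: "locally_path_connected_space X" and sl: "semilocally_simply_connected_space X"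
    and b: "b \<in> topspace X"
  obtains V where "openin X V" "b \<in> V" "path_connectedin X V"
    "\<And>\<eta> \<eta>'. pathin (subtopology X V) \<eta> \<Longrightarrow> pathin (subtopology X V) \<eta>' \<Longrightarrow> \<eta> 0 = \<eta>' 0 \<Longrightarrow> \<eta> 1 = \<eta>' 1 \<Longrightarrow>
       path_homotopic X (\<eta> 0) (\<eta> 1) \<eta> \<eta>'"
proof -
  obtain V0 where V0: "openin X V0" "b \<in> V0"
    "\<And>\<omega>. \<omega> \<in> loops (subtopology X V0) b \<Longrightarrow> path_homotopic X b b \<omega> (\<lambda>_. b)"
    using sl b unfolding semilocally_simply_connected_space_def loop_homotopic_eq by meson
  obtain V where V: "openin X V" "path_connectedin X V" "b \<in> V" "V \<subseteq> V0"
    using lpc V0(1,2) unfolding locally_path_connected_space by meson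
  show thesis
  proof (rule that[OF V(1,3,2)])
    fix \<eta> \<eta>' assume \<eta>: "pathin (subtopology X V) \<eta>" "pathin (subtopology X V) \<eta>'"
      and eq: "\<eta> 0 = \<eta>' 0" "\<eta> 1 = \<eta>' 1"
    have "\<eta> 0 \<in> topspace (subtopology X V)" "b \<in> topspace (subtopology X V)"
      using path_start_in_topspace[OF \<eta>(1)] V(3) b by auto
    moreover have "path_connected_space (subtopology X V)" using V(2) by (simp add: path_connectedin_def)
    ultimately obtain \<tau> where \<tau>: "pathin (subtopology X V) \<tau>" "\<tau> 0 = b" "\<tau> 1 = \<eta> 0"
      unfolding path_connected_space_def by blast
    note X = \<eta>[THEN pathin_subtopology[THEN iffD1, THEN conjunct1]]
      \<tau>(1)[THEN pathin_subtopology[THEN iffD1, THEN conjunct1]]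
    let ?\<alpha> = "pjoin \<tau> \<eta>" and ?\<beta> = "pjoin \<tau> \<eta>'"
    have "pathin (subtopology X V) (pjoin ?\<alpha> (prev ?\<beta>))"
      using \<eta> \<tau> eq by (intro pathin_pjoin pathin_prev) auto
    then have "pjoin ?\<alpha> (prev ?\<beta>) \<in> loops (subtopology X V0) b"
      using V(4) \<tau>(2) by (auto simp: loops_def pathin_subtopology)
    then have "path_homotopic X b b (pjoin ?\<alpha> (prev ?\<beta>)) (\<lambda>_. b)" by (rule V0(3))
    then have "path_homotopic X b (?\<alpha> 1) ?\<alpha> ?\<beta>"
      by (rule path_homotopic_of_loop[rotated 3]) (use X \<tau> eq in \<open>auto intro!: pathin_pjoin\<close>)
    then have "path_homotopic X (\<tau> 1) (?\<alpha> 1) \<eta> \<eta>'"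
      by (rule pjoin_cancel_left[rotated 5]) (use X \<tau> eq in auto)
    then show "path_homotopic X (\<eta> 0) (\<eta> 1) \<eta> \<eta>'" using \<tau> by simp
  qed
qed

definition paths_from :: "'a topology \<Rightarrow> 'a \<Rightarrow> (real \<Rightarrow> 'a) set" where
  "paths_from X y = {\<gamma>. pathin X \<gamma> \<and> \<gamma> 0 = y}"

definition path_class :: "'a topology \<Rightarrow> (real \<Rightarrow> 'a) \<Rightarrow> (real \<Rightarrow> 'a) set" where
  "path_class X \<gamma> = {\<sigma>. path_homotopic X (\<gamma> 0) (\<gamma> 1) \<gamma> \<sigma>}"

text \<open>The standard basic neighbourhoods of the class of \<open>\<gamma>\<close> in the space of path classes.\<close>

definition sheet :: "'a topology \<Rightarrow> (real \<Rightarrow> 'a) \<Rightarrow> 'a set \<Rightarrow> (real \<Rightarrow> 'a) set set" where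
  "sheet X \<gamma> V = (\<lambda>\<eta>. path_class X (pjoin \<gamma> \<eta>)) ` {\<eta>. pathin (subtopology X V) \<eta> \<and> \<eta> 0 = \<gamma> 1}"

text \<open>The points of the universal covering are the homotopy classes of paths from \<open>y\<close>.  The topology
  with the sheets over open sets as a basis is given here by its open sets, which spares the basis
  axioms: that open sets are closed under intersection only needs monotonicity of sheets in \<open>V\<close>.\<close>

definition ucover :: "'a topology \<Rightarrow> 'a \<Rightarrow> (real \<Rightarrow> 'a) set topology" where
  "ucover X y = topology (\<lambda>W. W \<subseteq> path_class X ` paths_from X y \<and>
     (\<forall>\<gamma> \<in> paths_from X y. path_class X \<gamma> \<in> W \<longrightarrow>
        (\<exists>V. openin X V \<and> \<gamma> 1 \<in> V \<and> sheet X \<gamma> V \<subseteq> W)))"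

text \<open>Homotopic paths have the same endpoint, so the chosen representative does not matter.\<close>

definition uproj :: "(real \<Rightarrow> 'a) set \<Rightarrow> 'a" where
  "uproj c = (SOME \<sigma>. \<sigma> \<in> c) 1"

lemma path_class_eq_iff:
  assumes "\<gamma> \<in> paths_from X y" "\<delta> \<in> paths_from X y"
  shows "path_class X \<gamma> = path_class X \<delta> \<longleftrightarrow> path_homotopic X y (\<gamma> 1) \<gamma> \<delta>"
proof
  assume eq: "path_class X \<gamma> = path_class X \<delta>"
  have "\<delta> \<in> path_class X \<delta>"
    using assms(2) by (simp add: path_class_def paths_from_def path_homotopic_refl)
  then have "\<delta> \<in> path_class X \<gamma>" by (simp only: eq)
  then show "path_homotopic X y (\<gamma> 1) \<gamma> \<delta>"
    using assms(1) by (simp add: path_class_def paths_from_def)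
next
  assume h: "path_homotopic X y (\<gamma> 1) \<gamma> \<delta>"
  have "\<gamma> 0 = y" "\<delta> 0 = y" "\<delta> 1 = \<gamma> 1" using path_homotopic_imp[OF h] by auto
  then show "path_class X \<gamma> = path_class X \<delta>"
    unfolding path_class_def using h by (auto intro: path_homotopic_sym path_homotopic_trans)
qed

lemma uproj_path_class:
  assumes "pathin X \<gamma>"
  shows "uproj (path_class X \<gamma>) = \<gamma> 1"
proof -
  have "\<gamma> \<in> path_class X \<gamma>" using assms by (simp add: path_class_def path_homotopic_refl)
  then have "(SOME \<sigma>. \<sigma> \<in> path_class X \<gamma>) \<in> path_class X \<gamma>"
    by (rule someI[of "\<lambda>\<sigma>. \<sigma> \<in> path_class X \<gamma>"])
  then show ?thesis unfolding uproj_def path_class_def by (auto dest: path_homotopic_imp)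
qed

lemma sheet_mono: "V \<subseteq> V' \<Longrightarrow> sheet X \<gamma> V \<subseteq> sheet X \<gamma> V'"
  unfolding sheet_def by (intro image_mono) (auto simp: pathin_subtopology)

lemma mem_sheetE:
  assumes \<delta>: "path_class X \<delta> \<in> sheet X \<gamma> V" "\<delta> \<in> paths_from X y" and \<gamma>: "\<gamma> \<in> paths_from X y"
  obtains \<eta> where "pathin X \<eta>" "pathin (subtopology X V) \<eta>" "\<eta> 0 = \<gamma> 1" "\<eta> 1 = \<delta> 1" "\<delta> 1 \<in> V"
    "path_homotopic X y (\<delta> 1) \<delta> (pjoin \<gamma> \<eta>)"
proof -
  obtain \<eta> where \<eta>: "pathin (subtopology X V) \<eta>" "\<eta> 0 = \<gamma> 1" "path_class X \<delta> = path_class X (pjoin \<gamma> \<eta>)"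
    using \<delta>(1) unfolding sheet_def by blast
  have X: "pathin X \<eta>" using \<eta>(1) by (simp add: pathin_subtopology)
  have P: "pjoin \<gamma> \<eta> \<in> paths_from X y" using X \<eta>(2) \<gamma> by (simp add: paths_from_def pathin_pjoin)
  have h: "path_homotopic X y (\<delta> 1) \<delta> (pjoin \<gamma> \<eta>)"
    using \<eta>(3) by (rule path_class_eq_iff[OF \<delta>(2) P, THEN iffD1])
  then have "\<eta> 1 = \<delta> 1" using path_homotopic_imp(6)[OF h] by simp
  moreover have "\<eta> 1 \<in> V" using path_finish_in_topspace[OF \<eta>(1)] by simp
  ultimately show thesis using that X \<eta> h by simp
qed

lemma sheet_subset:
  assumes "\<gamma> \<in> paths_from X y"
  shows "sheet X \<gamma> V \<subseteq> path_class X ` paths_from X y"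
  using assms unfolding sheet_def paths_from_def
  by (auto simp: pathin_subtopology intro!: imageI pathin_pjoin)

lemma sheet_refl:
  assumes "\<gamma> \<in> paths_from X y" "\<gamma> 1 \<in> V"
  shows "path_class X \<gamma> \<in> sheet X \<gamma> V"
proof -
  have \<gamma>: "pathin X \<gamma>" "\<gamma> 0 = y" using assms(1) by (auto simp: paths_from_def)
  have V: "\<gamma> 1 \<in> topspace X" using path_finish_in_topspace[OF \<gamma>(1)] .
  have "path_class X (pjoin \<gamma> (\<lambda>_. \<gamma> 1)) = path_class X \<gamma>"
    using \<gamma> V pjoin_const_right[OF \<gamma>(1), of y "\<gamma> 1"]
    by (subst path_class_eq_iff[of _ X y]) (auto simp: paths_from_def pathin_pjoin)
  then show ?thesis
    unfolding sheet_def using V assms(2)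
    by (intro image_eqI[of _ _ "\<lambda>_. \<gamma> 1"]) (auto simp: pathin_subtopology)
qed

text \<open>By the next two lemmas, lying in a sheet over a fixed \<open>V\<close> is an equivalence relation on the path
  classes that end in \<open>V\<close>.  Transitivity makes the sheets open, and together with symmetry it makes
  them disjoint or equal.\<close>

lemma sheet_trans:
  assumes \<gamma>: "\<gamma> \<in> paths_from X y" and \<delta>: "\<delta> \<in> paths_from X y" "path_class X \<delta> \<in> sheet X \<gamma> V"
  shows "sheet X \<delta> V \<subseteq> sheet X \<gamma> V"
proof
  fix c assume "c \<in> sheet X \<delta> V"
  then obtain \<zeta> where \<zeta>: "pathin (subtopology X V) \<zeta>" "\<zeta> 0 = \<delta> 1" "c = path_class X (pjoin \<delta> \<zeta>)"
    unfolding sheet_def by blast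
  obtain \<eta> where \<eta>: "pathin X \<eta>" "pathin (subtopology X V) \<eta>" "\<eta> 0 = \<gamma> 1" "\<eta> 1 = \<delta> 1"
    and h: "path_homotopic X y (\<delta> 1) \<delta> (pjoin \<gamma> \<eta>)" by (rule mem_sheetE[OF \<delta>(2,1) \<gamma>])
  have X: "pathin X \<zeta>" "pathin X \<gamma>" "\<gamma> 0 = y" "pathin X \<delta>" "\<delta> 0 = y"
    using \<zeta>(1) \<gamma> \<delta> by (auto simp: pathin_subtopology paths_from_def)
  have "path_homotopic X y (\<zeta> 1) (pjoin \<delta> \<zeta>) (pjoin (pjoin \<gamma> \<eta>) \<zeta>)"
    using X \<zeta>(2) by (intro pjoin_cong[OF h] path_homotopic_refl) auto
  also have "path_homotopic X y (\<zeta> 1) \<dots> (pjoin \<gamma> (pjoin \<eta> \<zeta>))"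
    using X \<eta> \<zeta>(2) by (intro pjoin_assoc) auto
  finally have "c = path_class X (pjoin \<gamma> (pjoin \<eta> \<zeta>))"
    unfolding \<zeta>(3) using X \<eta> \<zeta>(2)
    by (subst path_class_eq_iff[of _ X y]) (auto simp: paths_from_def pathin_pjoin)
  then show "c \<in> sheet X \<gamma> V"
    unfolding sheet_def using \<eta> \<zeta>(1,2)
    by (intro image_eqI[of _ _ "pjoin \<eta> \<zeta>"]) (auto intro: pathin_pjoin)
qed

lemma sheet_sym:
  assumes \<gamma>: "\<gamma> \<in> paths_from X y" and \<delta>: "\<delta> \<in> paths_from X y" "path_class X \<delta> \<in> sheet X \<gamma> V"
  shows "path_class X \<gamma> \<in> sheet X \<delta> V"
proof -
  obtain \<eta> where \<eta>: "pathin X \<eta>" "pathin (subtopology X V) \<eta>" "\<eta> 0 = \<gamma> 1" "\<eta> 1 = \<delta> 1"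
    and h: "path_homotopic X y (\<delta> 1) \<delta> (pjoin \<gamma> \<eta>)" by (rule mem_sheetE[OF \<delta>(2,1) \<gamma>])
  have X: "pathin X \<gamma>" "\<gamma> 0 = y" "pathin X \<delta>" "\<delta> 0 = y" using \<gamma> \<delta> by (auto simp: paths_from_def)
  have r: "pathin X (prev \<eta>)" using pathin_prev[OF \<eta>(1)] .
  have "path_homotopic X y (\<gamma> 1) (pjoin \<delta> (prev \<eta>)) (pjoin (pjoin \<gamma> \<eta>) (prev \<eta>))"
    using r \<eta> by (intro pjoin_cong[OF h] path_homotopic_refl) auto
  also have "path_homotopic X y (\<gamma> 1) \<dots> (pjoin \<gamma> (pjoin \<eta> (prev \<eta>)))"
    using X \<eta> r by (intro pjoin_assoc) auto
  also have "path_homotopic X y (\<gamma> 1) \<dots> (pjoin \<gamma> (\<lambda>_. \<gamma> 1))"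
    using X \<eta> by (intro pjoin_cong[OF path_homotopic_refl pjoin_prev_right]) auto
  also have "path_homotopic X y (\<gamma> 1) \<dots> \<gamma>" using X by (intro pjoin_const_right) auto
  finally have "path_class X (pjoin \<delta> (prev \<eta>)) = path_class X \<gamma>"
    using X \<eta> r by (subst path_class_eq_iff[of _ X y]) (auto simp: paths_from_def pathin_pjoin)
  then show ?thesis
    unfolding sheet_def using \<eta> pathin_prev[OF \<eta>(2)]
    by (intro image_eqI[of _ _ "prev \<eta>"]) auto
qed

lemma openin_ucover:
  "openin (ucover X y) W \<longleftrightarrow> W \<subseteq> path_class X ` paths_from X y \<and>
     (\<forall>\<gamma> \<in> paths_from X y. path_class X \<gamma> \<in> W \<longrightarrow>
        (\<exists>V. openin X V \<and> \<gamma> 1 \<in> V \<and> sheet X \<gamma> V \<subseteq> W))"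
proof -
  let ?L = "\<lambda>W. W \<subseteq> path_class X ` paths_from X y \<and>
     (\<forall>\<gamma> \<in> paths_from X y. path_class X \<gamma> \<in> W \<longrightarrow>
        (\<exists>V. openin X V \<and> \<gamma> 1 \<in> V \<and> sheet X \<gamma> V \<subseteq> W))"
  have "istopology ?L"
    unfolding istopology_def
  proof (rule conjI; intro allI impI)
    fix S T assume S: "?L S" and T: "?L T"
    show "?L (S \<inter> T)"
    proof (intro conjI ballI impI)
      show "S \<inter> T \<subseteq> path_class X ` paths_from X y" using S by blast
      fix \<gamma> assume \<gamma>: "\<gamma> \<in> paths_from X y" "path_class X \<gamma> \<in> S \<inter> T"
      obtain V where V: "openin X V" "\<gamma> 1 \<in> V" "sheet X \<gamma> V \<subseteq> S" using S \<gamma> by blast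
      obtain V' where V': "openin X V'" "\<gamma> 1 \<in> V'" "sheet X \<gamma> V' \<subseteq> T" using T \<gamma> by blast
      have "sheet X \<gamma> (V \<inter> V') \<subseteq> S \<inter> T"
        using V(3) V'(3) sheet_mono[of "V \<inter> V'" V X \<gamma>] sheet_mono[of "V \<inter> V'" V' X \<gamma>] by blast
      then show "\<exists>V. openin X V \<and> \<gamma> 1 \<in> V \<and> sheet X \<gamma> V \<subseteq> S \<inter> T" using V V' by blast
    qed
  next
    fix \<K> assume K: "\<forall>S\<in>\<K>. ?L S"
    show "?L (\<Union>\<K>)"
    proof (intro conjI ballI impI)
      show "\<Union>\<K> \<subseteq> path_class X ` paths_from X y" using K by blast
      fix \<gamma> assume \<gamma>: "\<gamma> \<in> paths_from X y" "path_class X \<gamma> \<in> \<Union>\<K>"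
      then obtain S where S: "S \<in> \<K>" "path_class X \<gamma> \<in> S" by blast
      have "?L S" using K S(1) by (rule bspec)
      then obtain V where "openin X V" "\<gamma> 1 \<in> V" "sheet X \<gamma> V \<subseteq> S" using \<gamma>(1) S(2) by blast
      then show "\<exists>V. openin X V \<and> \<gamma> 1 \<in> V \<and> sheet X \<gamma> V \<subseteq> \<Union>\<K>" using S(1) by blast
    qed
  qed
  then show ?thesis unfolding ucover_def by (simp add: topology_inverse')
qed

lemma topspace_ucover: "topspace (ucover X y) = path_class X ` paths_from X y"
proof
  show "topspace (ucover X y) \<subseteq> path_class X ` paths_from X y"
    using openin_topspace[of "ucover X y"] unfolding openin_ucover by blast
  have "openin (ucover X y) (path_class X ` paths_from X y)"
    unfolding openin_ucover
  proof (intro conjI ballI impI order_refl)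
    fix \<gamma> assume \<gamma>: "\<gamma> \<in> paths_from X y"
    then have "\<gamma> 1 \<in> topspace X" using path_finish_in_topspace by (auto simp: paths_from_def)
    then show "\<exists>V. openin X V \<and> \<gamma> 1 \<in> V \<and> sheet X \<gamma> V \<subseteq> path_class X ` paths_from X y"
      using sheet_subset[OF \<gamma>] by blast
  qed
  then show "path_class X ` paths_from X y \<subseteq> topspace (ucover X y)" by (rule openin_subset)
qed

lemma openin_sheet:
  assumes "openin X V" "\<gamma> \<in> paths_from X y"
  shows "openin (ucover X y) (sheet X \<gamma> V)"
  unfolding openin_ucover
proof (intro conjI ballI impI sheet_subset[OF assms(2)])
  fix \<delta> assume \<delta>: "\<delta> \<in> paths_from X y" "path_class X \<delta> \<in> sheet X \<gamma> V"
  have "\<delta> 1 \<in> V" by (rule mem_sheetE[OF \<delta>(2,1) assms(2)])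
  then show "\<exists>V'. openin X V' \<and> \<delta> 1 \<in> V' \<and> sheet X \<delta> V' \<subseteq> sheet X \<gamma> V"
    using assms(1) sheet_trans[OF assms(2) \<delta>] by blast
qed

lemma uproj_sheet_subset:
  assumes "\<gamma> \<in> paths_from X y"
  shows "uproj ` sheet X \<gamma> V \<subseteq> V"
proof -
  have "uproj (path_class X (pjoin \<gamma> \<eta>)) \<in> V" if \<eta>: "pathin (subtopology X V) \<eta>" "\<eta> 0 = \<gamma> 1" for \<eta>
  proof -
    have "pathin X (pjoin \<gamma> \<eta>)"
      using \<eta> assms by (intro pathin_pjoin) (auto simp: pathin_subtopology paths_from_def)
    moreover have "\<eta> 1 \<in> V" using path_finish_in_topspace[OF \<eta>(1)] by simp
    ultimately show ?thesis by (simp add: uproj_path_class)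
  qed
  then show ?thesis by (auto simp: sheet_def)
qed

lemma uproj_sheet:
  assumes \<gamma>: "\<gamma> \<in> paths_from X y" and V: "path_connectedin X V" "\<gamma> 1 \<in> V"
  shows "uproj ` sheet X \<gamma> V = V"
proof
  show "V \<subseteq> uproj ` sheet X \<gamma> V"
  proof
    fix v assume v: "v \<in> V"
    have "path_connected_space (subtopology X V)" "topspace (subtopology X V) = V"
      using V(1) by (auto simp: path_connectedin_def)
    then have "\<exists>\<eta>. pathin (subtopology X V) \<eta> \<and> \<eta> 0 = \<gamma> 1 \<and> \<eta> 1 = v"
      using v V(2) by (simp add: path_connected_space_def)
    then obtain \<eta> where \<eta>: "pathin (subtopology X V) \<eta>" "\<eta> 0 = \<gamma> 1" "\<eta> 1 = v" by blast
    have "pathin X (pjoin \<gamma> \<eta>)"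
      using \<eta> \<gamma> by (intro pathin_pjoin) (auto simp: pathin_subtopology paths_from_def)
    then have "uproj (path_class X (pjoin \<gamma> \<eta>)) = v" using \<eta>(3) by (simp add: uproj_path_class)
    then show "v \<in> uproj ` sheet X \<gamma> V" using \<eta> by (force simp: sheet_def)
  qed
qed (rule uproj_sheet_subset[OF \<gamma>])

lemma continuous_map_uproj: "continuous_map (ucover X y) X uproj"
  unfolding continuous_map_def
proof (intro conjI allI impI)
  show "uproj \<in> topspace (ucover X y) \<rightarrow> topspace X"
    using path_finish_in_topspace by (fastforce simp: topspace_ucover paths_from_def uproj_path_class)
  fix V assume V: "openin X V"
  show "openin (ucover X y) {c \<in> topspace (ucover X y). uproj c \<in> V}"
    unfolding openin_ucover
  proof (intro conjI ballI impI)
    show "{c \<in> topspace (ucover X y). uproj c \<in> V} \<subseteq> path_class X ` paths_from X y"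
      by (auto simp: topspace_ucover)
    fix \<gamma> assume \<gamma>: "\<gamma> \<in> paths_from X y" "path_class X \<gamma> \<in> {c \<in> topspace (ucover X y). uproj c \<in> V}"
    then have "\<gamma> 1 \<in> V" by (simp add: uproj_path_class paths_from_def)
    moreover have "sheet X \<gamma> V \<subseteq> {c \<in> topspace (ucover X y). uproj c \<in> V}"
      using uproj_sheet_subset[OF \<gamma>(1), of V] sheet_subset[OF \<gamma>(1), of V] topspace_ucover[of X y] by blast
    ultimately show "\<exists>V'. openin X V' \<and> \<gamma> 1 \<in> V' \<and>
        sheet X \<gamma> V' \<subseteq> {c \<in> topspace (ucover X y). uproj c \<in> V}" using V by blast
  qed
qed

lemma open_map_uproj:
  assumes lpc: "locally_path_connected_space X"
  shows "open_map (ucover X y) X uproj"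
  unfolding open_map_def
proof (intro allI impI)
  fix W assume W: "openin (ucover X y) W"
  show "openin X (uproj ` W)"
  proof (subst openin_subopen, intro ballI)
    fix b assume "b \<in> uproj ` W"
    then obtain \<gamma> where \<gamma>: "\<gamma> \<in> paths_from X y" "path_class X \<gamma> \<in> W" "b = uproj (path_class X \<gamma>)"
      using W unfolding openin_ucover by blast
    then have b: "b = \<gamma> 1" by (simp add: uproj_path_class paths_from_def)
    obtain V where V: "openin X V" "\<gamma> 1 \<in> V" "sheet X \<gamma> V \<subseteq> W"
      using W \<gamma> unfolding openin_ucover by blast
    obtain V' where V': "openin X V'" "path_connectedin X V'" "\<gamma> 1 \<in> V'" "V' \<subseteq> V"
      using lpc V(1,2) unfolding locally_path_connected_space by meson
    have "V' \<subseteq> uproj ` W"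
      using uproj_sheet[OF \<gamma>(1) V'(2,3)] sheet_mono[OF V'(4), of X \<gamma>] V(3) by blast
    then show "\<exists>T. openin X T \<and> b \<in> T \<and> T \<subseteq> uproj ` W" using V'(1,3) b by blast
  qed
qed

text \<open>Over \<open>V\<close> as in \<open>semilocally_simply_connected_nbhd\<close>, two extensions of \<open>\<gamma>\<close> inside \<open>V\<close> with
  the same endpoint are homotopic, so the projection is injective on each sheet.\<close>

theorem covering_map_uproj:
  assumes con: "path_connected_space X" and lpc: "locally_path_connected_space X"
    and sl: "semilocally_simply_connected_space X" and y: "y \<in> topspace X"
  shows "covering_map (ucover X y) X uproj"
  unfolding covering_map_def
proof (rule conjI[OF continuous_map_uproj conjI[OF _ ballI]])
  show "uproj ` topspace (ucover X y) = topspace X"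
  proof
    show "uproj ` topspace (ucover X y) \<subseteq> topspace X"
      by (rule continuous_map_image_subset_topspace[OF continuous_map_uproj])
    show "topspace X \<subseteq> uproj ` topspace (ucover X y)"
    proof
      fix b assume "b \<in> topspace X"
      then obtain \<gamma> where \<gamma>: "pathin X \<gamma>" "\<gamma> 0 = y" "\<gamma> 1 = b"
        using con y unfolding path_connected_space_def by blast
      then have "path_class X \<gamma> \<in> topspace (ucover X y)" "uproj (path_class X \<gamma>) = b"
        by (auto simp: topspace_ucover paths_from_def uproj_path_class)
      then show "b \<in> uproj ` topspace (ucover X y)" by blast
    qed
  qed
  fix b assume "b \<in> topspace X"
  then obtain V where V: "openin X V" "b \<in> V" "path_connectedin X V" and nice:
    "\<And>\<eta> \<eta>'. pathin (subtopology X V) \<eta> \<Longrightarrow> pathin (subtopology X V) \<eta>' \<Longrightarrow> \<eta> 0 = \<eta>' 0 \<Longrightarrow> \<eta> 1 = \<eta>' 1 \<Longrightarrow>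
       path_homotopic X (\<eta> 0) (\<eta> 1) \<eta> \<eta>'"
    using semilocally_simply_connected_nbhd[OF lpc sl] by blast
  define \<V> where "\<V> = (\<lambda>\<gamma>. sheet X \<gamma> V) ` {\<gamma> \<in> paths_from X y. \<gamma> 1 \<in> V}"
  show "\<exists>V. openin X V \<and> b \<in> V \<and>
        (\<exists>\<V>. \<Union>\<V> = {t \<in> topspace (ucover X y). uproj t \<in> V} \<and> (\<forall>W \<in> \<V>. openin (ucover X y) W) \<and>
           pairwise disjnt \<V> \<and>
           (\<forall>W \<in> \<V>. homeomorphic_map (subtopology (ucover X y) W) (subtopology X V) uproj))"
  proof (intro exI[of _ V] exI[of _ \<V>] conjI ballI V(1,2))
    show "\<Union>\<V> = {t \<in> topspace (ucover X y). uproj t \<in> V}"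
    proof
      show "\<Union>\<V> \<subseteq> {t \<in> topspace (ucover X y). uproj t \<in> V}"
        using uproj_sheet_subset[of _ X y V] sheet_subset[of _ X y V] topspace_ucover[of X y]
        unfolding \<V>_def by blast
      show "{t \<in> topspace (ucover X y). uproj t \<in> V} \<subseteq> \<Union>\<V>"
      proof
        fix t assume t: "t \<in> {t \<in> topspace (ucover X y). uproj t \<in> V}"
        then obtain \<gamma> where \<gamma>: "\<gamma> \<in> paths_from X y" "t = path_class X \<gamma>" by (auto simp: topspace_ucover)
        then have "\<gamma> 1 \<in> V" using t by (simp add: uproj_path_class paths_from_def)
        then show "t \<in> \<Union>\<V>" using sheet_refl[OF \<gamma>(1)] \<gamma> by (auto simp: \<V>_def)
      qed
    qed
    show opn: "openin (ucover X y) W" if "W \<in> \<V>" for W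
      using that openin_sheet[OF V(1)] by (auto simp: \<V>_def)
    show "pairwise disjnt \<V>"
    proof (rule pairwiseI)
      fix W W' assume W: "W \<in> \<V>" "W' \<in> \<V>" "W \<noteq> W'"
      obtain \<gamma> where \<gamma>: "\<gamma> \<in> paths_from X y" "W = sheet X \<gamma> V" using W(1) by (auto simp: \<V>_def)
      obtain \<gamma>' where \<gamma>': "\<gamma>' \<in> paths_from X y" "W' = sheet X \<gamma>' V" using W(2) by (auto simp: \<V>_def)
      have "W = W'" if c: "c \<in> W" "c \<in> W'" for c
      proof -
        obtain \<delta> where \<delta>: "\<delta> \<in> paths_from X y" "c = path_class X \<delta>"
          using c(1) sheet_subset[OF \<gamma>(1)] unfolding \<gamma>(2) by blast
        have eq: "sheet X \<delta> V = sheet X \<epsilon> V"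
          if \<epsilon>: "\<epsilon> \<in> paths_from X y" "path_class X \<delta> \<in> sheet X \<epsilon> V" for \<epsilon>
          using sheet_trans[OF \<epsilon>(1) \<delta>(1) \<epsilon>(2)] sheet_trans[OF \<delta>(1) \<epsilon>(1) sheet_sym[OF \<epsilon>(1) \<delta>(1) \<epsilon>(2)]]
          by (rule equalityI)
        show ?thesis using eq[OF \<gamma>(1)] eq[OF \<gamma>'(1)] c \<delta>(2) \<gamma>(2) \<gamma>'(2) by simp
      qed
      then show "disjnt W W'" using W(3) by (auto simp: disjnt_iff)
    qed
    show "homeomorphic_map (subtopology (ucover X y) W) (subtopology X V) uproj" if W: "W \<in> \<V>" for W
    proof -
      obtain \<gamma> where \<gamma>: "\<gamma> \<in> paths_from X y" "\<gamma> 1 \<in> V" "W = sheet X \<gamma> V" using W by (auto simp: \<V>_def)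
      have "inj_on uproj W"
      proof (rule inj_onI)
        fix c c' assume c: "c \<in> W" "c' \<in> W" "uproj c = uproj c'"
        obtain \<eta> where \<eta>: "pathin (subtopology X V) \<eta>" "\<eta> 0 = \<gamma> 1" "c = path_class X (pjoin \<gamma> \<eta>)"
          using c(1) unfolding \<gamma>(3) sheet_def by blast
        obtain \<eta>' where \<eta>': "pathin (subtopology X V) \<eta>'" "\<eta>' 0 = \<gamma> 1" "c' = path_class X (pjoin \<gamma> \<eta>')"
          using c(2) unfolding \<gamma>(3) sheet_def by blast
        have P: "pjoin \<gamma> \<eta> \<in> paths_from X y" "pjoin \<gamma> \<eta>' \<in> paths_from X y"
          using \<eta> \<eta>' \<gamma>(1) by (auto simp: paths_from_def pathin_subtopology intro!: pathin_pjoin)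
        then have "\<eta> 1 = \<eta>' 1"
          using c(3) \<eta>(3) \<eta>'(3) by (simp add: paths_from_def uproj_path_class)
        then have "path_homotopic X (\<gamma> 1) (\<eta> 1) \<eta> \<eta>'" using nice[OF \<eta>(1) \<eta>'(1)] \<eta>(2) \<eta>'(2) by simp
        then have "path_homotopic X y (\<eta> 1) (pjoin \<gamma> \<eta>) (pjoin \<gamma> \<eta>')"
          using \<gamma>(1) by (intro pjoin_cong[OF path_homotopic_refl]) (auto simp: paths_from_def)
        then show "c = c'" unfolding \<eta>(3) \<eta>'(3) path_class_eq_iff[OF P] by simp
      qed
      moreover have "uproj ` W = V" using uproj_sheet[OF \<gamma>(1) V(3) \<gamma>(2)] \<gamma>(3) by simp
      ultimately show ?thesis
        using homeomorphic_map_restrict_open_map[OF continuous_map_uproj open_map_uproj[OF lpc] opn[OF W]]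
        by simp
    qed
  qed
qed

text \<open>The lift of \<open>\<gamma>\<close> that starts at the class of the constant path.\<close>

definition canonical_lift :: "'a topology \<Rightarrow> (real \<Rightarrow> 'a) \<Rightarrow> real \<Rightarrow> (real \<Rightarrow> 'a) set" where
  "canonical_lift X \<gamma> t = path_class X (\<lambda>s. \<gamma> (t * s))"

lemma initial_segment:
  assumes "\<gamma> \<in> paths_from X y" "t \<in> {0..1}"
  shows "(\<lambda>s. \<gamma> (t * s)) \<in> paths_from X y"
proof -
  have "pathin X (\<lambda>s. \<gamma> (t * s))"
    by (rule pathin_compose_euclidean)
      (use assms in \<open>auto simp: paths_from_def mult_le_one intro!: continuous_intros\<close>)
  then show ?thesis using assms(1) by (simp add: paths_from_def)
qed

lemma path_class_extend_segment:
  assumes \<gamma>: "\<gamma> \<in> paths_from X y" and t: "t \<in> {0..1}" "t' \<in> {0..1}"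
  shows "path_class X (\<lambda>s. \<gamma> (t' * s)) =
     path_class X (pjoin (\<lambda>s. \<gamma> (t * s)) (\<lambda>s. \<gamma> (t + (t' - t) * s)))"
proof -
  let ?\<phi> = "\<lambda>s. if s \<le> 1/2 then t * (2 * s) else t + (t' - t) * (2 * s - 1)"
  have conv: "t + (t' - t) * s \<in> {0..1}" if "s \<in> {0..1}" for s
    using convexD_alt[of "{0..1::real}" t t' s] t that by (simp add: algebra_simps)
  have "path_homotopic X (\<gamma> 0) (\<gamma> t') (\<lambda>s. \<gamma> (t' * s))
      (pjoin (\<lambda>s. \<gamma> (t * s)) (\<lambda>s. \<gamma> (t + (t' - t) * s)))"
  proof (rule path_homotopic_reparam)
    show "pathin X \<gamma>" using \<gamma> by (simp add: paths_from_def)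
    show "continuous_on {0..1} (\<lambda>s. t' * s)" by (intro continuous_intros)
    show "(\<lambda>s. t' * s) \<in> {0..1} \<rightarrow> {0..1}" using t by (auto simp: mult_le_one)
    have "continuous_on {0..1} (\<lambda>s. t * min (2 * s) 1 + (t' - t) * max (2 * s - 1) 0)"
      by (intro continuous_intros)
    then show "continuous_on {0..1} ?\<phi>"
      by (rule continuous_on_eq) (auto simp: min_def max_def)
    show "?\<phi> \<in> {0..1} \<rightarrow> {0..1}"
    proof
      fix s :: real assume s: "s \<in> {0..1}"
      show "?\<phi> s \<in> {0..1}"
      proof (cases "s \<le> 1/2")
        case True
        then show ?thesis using s t by (auto simp: mult_le_one)
      next
        case False
        then show ?thesis using s conv[of "2 * s - 1"] by auto
      qed
    qed
  qed (auto simp: pjoin_def)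
  moreover have "(\<lambda>s. \<gamma> (t' * s)) \<in> paths_from X y" using initial_segment[OF \<gamma> t(2)] .
  moreover have "\<gamma> 0 = y" using \<gamma> by (simp add: paths_from_def)
  ultimately show ?thesis
    by (subst path_class_eq_iff[of _ X y]) (auto simp: paths_from_def dest: path_homotopic_imp)
qed

text \<open>Continuity at \<open>t\<close>: if \<open>\<gamma>\<close> stays in \<open>V\<close> between \<open>t\<close> and \<open>t'\<close>, the segment up to \<open>t'\<close> is
  homotopic to the segment up to \<open>t\<close> followed by a path in \<open>V\<close>, hence its class lies in the same sheet.\<close>

lemma path_lift_canonical:
  assumes \<gamma>: "\<gamma> \<in> paths_from X y"
  shows "path_lift (ucover X y) (path_class X (\<lambda>_. y)) uproj \<gamma> (canonical_lift X \<gamma>)"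
  unfolding path_lift_iff
proof (intro conjI ballI)
  have \<gamma>': "pathin X \<gamma>" "\<gamma> 0 = y" using \<gamma> by (auto simp: paths_from_def)
  show "canonical_lift X \<gamma> 0 = path_class X (\<lambda>_. y)" using \<gamma>' by (simp add: canonical_lift_def)
  show "uproj (canonical_lift X \<gamma> t) = \<gamma> t" if "t \<in> {0..1}" for t
    using initial_segment[OF \<gamma> that] by (simp add: canonical_lift_def uproj_path_class paths_from_def)
  show "pathin (ucover X y) (canonical_lift X \<gamma>)"
    unfolding pathin_def continuous_map_def
  proof (intro conjI allI impI)
    show "canonical_lift X \<gamma> \<in> topspace (top_of_set {0..1}) \<rightarrow> topspace (ucover X y)"
      using initial_segment[OF \<gamma>] by (auto simp: canonical_lift_def topspace_ucover)
    fix W assume W: "openin (ucover X y) W"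
    show "openin (top_of_set {0..1}) {t \<in> topspace (top_of_set {0..1}). canonical_lift X \<gamma> t \<in> W}"
      unfolding openin_contains_ball
    proof (intro conjI ballI)
      fix t assume t: "t \<in> {t \<in> topspace (top_of_set {0..1}). canonical_lift X \<gamma> t \<in> W}"
      then have t01: "t \<in> {0..1}" by simp
      obtain V where V: "openin X V" "\<gamma> t \<in> V" "sheet X (\<lambda>s. \<gamma> (t * s)) V \<subseteq> W"
        using W t initial_segment[OF \<gamma> t01] unfolding openin_ucover canonical_lift_def by force
      have "openin (top_of_set {0..1}) {s \<in> {0..1}. \<gamma> s \<in> V}"
        using openin_continuous_map_preimage[OF \<gamma>'(1)[unfolded pathin_def] V(1)] by simp
      moreover have "t \<in> {s \<in> {0..1}. \<gamma> s \<in> V}" using t01 V(2) by simp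
      ultimately obtain \<epsilon> where \<epsilon>: "\<epsilon> > 0" "ball t \<epsilon> \<inter> {0..1} \<subseteq> {s \<in> {0..1}. \<gamma> s \<in> V}"
        unfolding openin_contains_ball by blast
      have "canonical_lift X \<gamma> t' \<in> W" if t': "t' \<in> ball t \<epsilon> \<inter> {0..1}" for t'
      proof -
        let ?\<eta> = "\<lambda>s. \<gamma> (t + (t' - t) * s)"
        have conv: "t + (t' - t) * s \<in> ball t \<epsilon> \<inter> {0..1}" if "s \<in> {0..1}" for s
        proof -
          have "convex (ball t \<epsilon> \<inter> {0..1})" by (intro convex_Int convex_ball) simp
          then show ?thesis
            using convexD_alt[of "ball t \<epsilon> \<inter> {0..1}" t t' s] \<epsilon>(1) t01 t' that by (simp add: algebra_simps)
        qed
        have "pathin X ?\<eta>"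
          by (rule pathin_compose_euclidean[OF \<gamma>'(1)])
            (use conv in \<open>auto intro!: continuous_intros\<close>)
        moreover have "?\<eta> s \<in> V" if "s \<in> {0..1}" for s using conv[OF that] \<epsilon>(2) by blast
        ultimately have "pathin (subtopology X V) ?\<eta>" by (simp add: pathin_subtopology)
        then have "path_class X (pjoin (\<lambda>s. \<gamma> (t * s)) ?\<eta>) \<in> sheet X (\<lambda>s. \<gamma> (t * s)) V"
          by (auto simp: sheet_def)
        then show ?thesis
          using path_class_extend_segment[OF \<gamma> t01, of t'] t' V(3) by (auto simp: canonical_lift_def)
      qed
      then show "\<exists>\<epsilon>>0. ball t \<epsilon> \<inter> {0..1} \<subseteq> {t \<in> topspace (top_of_set {0..1}). canonical_lift X \<gamma> t \<in> W}"
        using \<epsilon>(1) by auto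
    qed auto
  qed
qed

text \<open>If a loop in the universal covering is based at the class of \<open>\<gamma>\<close> and lies over \<open>\<omega>\<close>, then the
  lift of \<open>\<gamma>\<cdot>\<omega>\<close> ends at the class of \<open>\<gamma>\<close>.  So \<open>\<gamma>\<cdot>\<omega>\<close> is homotopic to \<open>\<gamma>\<close>, hence \<open>\<omega>\<close> to a constant
  path, and this homotopy lifts.\<close>

theorem universal_covering_ucover:
  assumes con: "path_connected_space X" and lpc: "locally_path_connected_space X"
    and sl: "semilocally_simply_connected_space X" and y: "y \<in> topspace X"
  shows "universal_covering (ucover X y) (path_class X (\<lambda>_. y)) X y uproj"
proof -
  let ?U = "ucover X y" and ?w = "path_class X (\<lambda>_. y)"
  have cov: "covering_map ?U X uproj" by (rule covering_map_uproj[OF assms])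
  have w: "(\<lambda>_. y) \<in> paths_from X y" using y by (simp add: paths_from_def)
  have lift: "pathin ?U (canonical_lift X \<gamma>)" "canonical_lift X \<gamma> 0 = ?w"
    "canonical_lift X \<gamma> 1 = path_class X \<gamma>" "\<And>t. t \<in> {0..1} \<Longrightarrow> uproj (canonical_lift X \<gamma> t) = \<gamma> t"
    if "\<gamma> \<in> paths_from X y" for \<gamma>
    using path_lift_canonical[OF that] by (auto simp: path_lift_iff canonical_lift_def)
  have pc: "path_connected_space ?U"
    unfolding path_connected_space_def
  proof (intro ballI)
    fix c d assume "c \<in> topspace ?U" "d \<in> topspace ?U"
    then obtain \<gamma> \<delta> where \<gamma>: "\<gamma> \<in> paths_from X y" "c = path_class X \<gamma>"
      and \<delta>: "\<delta> \<in> paths_from X y" "d = path_class X \<delta>" by (auto simp: topspace_ucover)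
    have "pathin ?U (pjoin (prev (canonical_lift X \<gamma>)) (canonical_lift X \<delta>))"
      using lift[OF \<gamma>(1)] lift[OF \<delta>(1)] by (intro pathin_pjoin pathin_prev) auto
    then show "\<exists>\<tau>. pathin ?U \<tau> \<and> \<tau> 0 = c \<and> \<tau> 1 = d"
      using lift(3)[OF \<gamma>(1)] lift(3)[OF \<delta>(1)] \<gamma>(2) \<delta>(2)
      by (intro exI[of _ "pjoin (prev (canonical_lift X \<gamma>)) (canonical_lift X \<delta>)"]) auto
  qed
  have "path_homotopic ?U z z \<omega> (\<lambda>_. z)" if z: "z \<in> topspace ?U" and \<omega>: "\<omega> \<in> loops ?U z" for z \<omega>
  proof -
    obtain \<gamma> where \<gamma>: "\<gamma> \<in> paths_from X y" "z = path_class X \<gamma>" using z by (auto simp: topspace_ucover)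
    have \<gamma>': "pathin X \<gamma>" "\<gamma> 0 = y" "\<gamma> 1 = uproj z" using \<gamma> by (auto simp: paths_from_def uproj_path_class)
    have \<omega>': "pathin ?U \<omega>" "\<omega> 0 = z" "\<omega> 1 = z" using \<omega> by (auto simp: loops_def)
    let ?u = "uproj \<circ> \<omega>"
    have u: "pathin X ?u" using pathin_compose[OF \<omega>'(1) continuous_map_uproj] .
    have P: "pjoin \<gamma> ?u \<in> paths_from X y" using \<gamma>' u \<omega>' by (auto simp: paths_from_def intro!: pathin_pjoin)
    have "path_lift ?U ?w uproj (pjoin \<gamma> ?u) (pjoin (canonical_lift X \<gamma>) \<omega>)"
      unfolding path_lift_iff
      using lift[OF \<gamma>(1)] \<omega>' \<gamma>(2) by (auto intro!: pathin_pjoin simp: pjoin_def)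
    from path_lift_unique[OF cov this path_lift_canonical[OF P], of 1]
    have "path_class X \<gamma> = path_class X (pjoin \<gamma> ?u)" using lift(3)[OF P] \<omega>' \<gamma>(2) by simp
    then have "path_homotopic X y (\<gamma> 1) \<gamma> (pjoin \<gamma> ?u)" by (simp only: path_class_eq_iff[OF \<gamma>(1) P])
    then have "path_homotopic X y (\<gamma> 1) (pjoin \<gamma> (\<lambda>_. \<gamma> 1)) (pjoin \<gamma> ?u)"
      by (rule path_homotopic_trans[OF pjoin_const_right[OF \<gamma>'(1) \<gamma>'(2)[symmetric] refl]])
    then have "path_homotopic X (\<gamma> 1) (\<gamma> 1) (\<lambda>_. \<gamma> 1) ?u"
      by (rule pjoin_cancel_left[rotated 5])
        (use \<gamma>' u \<omega>' path_finish_in_topspace[OF \<gamma>'(1)] in auto)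
    from path_lift_homotopic[OF cov path_homotopic_sym[OF this], of z \<omega> "\<lambda>_. z"]
    show ?thesis using \<omega>' z \<gamma>'(3) by (simp add: path_lift_iff)
  qed
  then have "pi1 ?U z = {pi1_one ?U z}" if "z \<in> topspace ?U" for z
    using that by (intro pi1_trivialI)
  then show ?thesis
    unfolding universal_covering_def simply_connected_space_def
    using cov pc w path_connected_imp_connected_space[OF pc] y
    by (auto simp: topspace_ucover uproj_path_class)
qed

section \<open>The exact sequence of a covering map\<close>

lemma fibre_discrete:
  assumes p: "local_homeomorphism E B p"
  shows "fibre E p y = discrete_topology (topspace (fibre E p y))"
proof -
  have "openin (fibre E p y) {t}" if t: "t \<in> topspace (fibre E p y)" for t
  proof -
    have tE: "t \<in> topspace E" "p t = y" using t by (auto simp: fibre_def)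
    then obtain V where V: "openin E V" "t \<in> V" "inj_on p V"
      using p unfolding local_homeomorphism_iff by blast
    have "{t} = V \<inter> {t. p t = y}" using V tE by (auto simp: inj_on_def)
    then show ?thesis unfolding fibre_def openin_subtopology using V(1) by blast
  qed
  then show ?thesis using discrete_topology_unique[of "topspace (fibre E p y)" "fibre E p y"] by simp
qed

lemma eta_iff_path:
  assumes "locally_path_connected_space X"
  shows "b \<in> eta X a \<longleftrightarrow> (\<exists>\<gamma>. pathin X \<gamma> \<and> \<gamma> 0 = a \<and> \<gamma> 1 = b)"
proof -
  have "b \<in> eta X a \<longleftrightarrow> b \<in> path_component_of_set X a"
    by (simp only: path_component_eq_connected_component_of[OF assms])
  then show ?thesis by (simp add: path_component_of_set)
qed

lemma mem_loop_class:
  assumes "\<omega> \<in> loops X x"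
  shows "\<omega> \<in> loop_class X x \<omega>"
  using assms by (simp add: loop_class_def loop_homotopic_eq loops_def path_homotopic_refl)

lemma pi1E:
  assumes "c \<in> pi1 X x"
  obtains \<omega> where "\<omega> \<in> loops X x" "c = loop_class X x \<omega>"
  using assms by (auto simp: pi1_def)

lemma pi1_one_in: "x \<in> topspace X \<Longrightarrow> pi1_one X x \<in> pi1 X x"
  by (auto simp: pi1_def pi1_one_def loops_def)

lemma loops_compose:
  assumes "\<sigma> \<in> loops X x" "continuous_map X Y f" "f x = y"
  shows "f \<circ> \<sigma> \<in> loops Y y"
  using assms pathin_compose by (auto simp: loops_def)

lemma pi1_map_loop_class:
  assumes \<sigma>: "\<sigma> \<in> loops X x" and f: "continuous_map X Y f" "f x = y"
  shows "pi1_map Y y f (loop_class X x \<sigma>) = loop_class Y y (f \<circ> \<sigma>)"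
proof -
  have "loop_class Y y (f \<circ> \<tau>) = loop_class Y y (f \<circ> \<sigma>)" if "\<tau> \<in> loop_class X x \<sigma>" for \<tau>
  proof -
    have "path_homotopic X x x \<sigma> \<tau>" using that by (simp add: loop_class_def loop_homotopic_eq)
    from path_homotopic_compose[OF this f(1)]
    have "path_homotopic Y y y (f \<circ> \<sigma>) (f \<circ> \<tau>)" by (simp only: f(2))
    from this[folded loop_class_eq_iff[OF loops_compose[OF \<sigma> f]]] show ?thesis ..
  qed
  moreover have "loop_class X x \<sigma> \<noteq> {}" using mem_loop_class[OF \<sigma>] by blast
  ultimately show ?thesis unfolding pi1_map_def by (rule SUP_eq_const[rotated])
qed

lemma pi1_discrete:
  assumes "x \<in> U"
  shows "pi1 (discrete_topology U) x = {pi1_one (discrete_topology U) x}"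
proof (rule pi1_trivialI)
  fix \<omega> assume "\<omega> \<in> loops (discrete_topology U) x"
  then have \<omega>: "pathin (discrete_topology U) \<omega>" "\<omega> 0 = x" "\<omega> 1 = x" by (auto simp: loops_def)
  have "path_connectedin (discrete_topology U) (\<omega> ` {0..1})"
    by (rule path_connectedin_path_image[OF \<omega>(1)])
  then obtain a where "\<omega> ` {0..1} \<subseteq> {a}" by (auto simp: path_connectedin_discrete_topology)
  then have a: "\<omega> s = a" if "s \<in> {0..1}" for s using that by blast
  then have "\<omega> s = x" if "s \<in> {0..1}" for s using a[OF that] a[of 0] \<omega>(2) by simp
  then show "path_homotopic (discrete_topology U) x x \<omega> (\<lambda>_. x)"
    using \<omega> by (intro path_homotopic_equal) auto
qed (use assms in simp)

lemma is_lift_end_iff: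
  assumes cov: "covering_map E B p" and \<omega>: "\<omega> \<in> loops B y" and \<sigma>: "path_lift E x p \<omega> \<sigma>"
  shows "is_lift_end E x p (loop_class B y \<omega>) t \<longleftrightarrow> t = \<sigma> 1"
proof
  assume "is_lift_end E x p (loop_class B y \<omega>) t"
  then obtain \<omega>' \<sigma>' where h: "path_homotopic B y y \<omega> \<omega>'" and \<sigma>': "path_lift E x p \<omega>' \<sigma>'" "\<sigma>' 1 = t"
    by (auto simp: is_lift_end_def loop_class_def loop_homotopic_eq)
  show "t = \<sigma> 1" using path_homotopic_imp(6)[OF path_lift_homotopic[OF cov h \<sigma> \<sigma>'(1)]] \<sigma>'(2) by simp
next
  assume "t = \<sigma> 1"
  then show "is_lift_end E x p (loop_class B y \<omega>) t"
    unfolding is_lift_end_def using mem_loop_class[OF \<omega>] \<sigma> by blast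
qed

lemma lift_end_eq:
  assumes "covering_map E B p" "\<omega> \<in> loops B y" "path_lift E x p \<omega> \<sigma>"
  shows "lift_end E x p (loop_class B y \<omega>) = \<sigma> 1"
  unfolding lift_end_def by (rule the_equality) (simp_all add: is_lift_end_iff[OF assms])

lemma loop_path_lift:
  assumes cov: "covering_map E B p" and x: "x \<in> topspace E" "p x = y" and \<omega>: "\<omega> \<in> loops B y"
  obtains \<sigma> where "path_lift E x p \<omega> \<sigma>" "lift_end E x p (loop_class B y \<omega>) = \<sigma> 1"
    "pathin E \<sigma>" "\<sigma> 0 = x" "p (\<sigma> 1) = y" "\<sigma> 1 \<in> topspace E"
proof -
  obtain \<sigma> where \<sigma>: "path_lift E x p \<omega> \<sigma>"
    by (rule path_lift_exists[OF cov, of \<omega> x]) (use \<omega> x in \<open>auto simp: loops_def\<close>)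
  show thesis
    by (rule that[OF \<sigma> lift_end_eq[OF cov \<omega> \<sigma>]])
      (use \<sigma> \<omega> path_finish_in_topspace[of E \<sigma>] in \<open>auto simp: path_lift_iff loops_def\<close>)
qed

lemma ex1_is_lift_end:
  assumes cov: "covering_map E B p" and x: "x \<in> topspace E" "p x = y" and c: "c \<in> pi1 B y"
  shows "\<exists>!t. is_lift_end E x p c t"
proof -
  obtain \<omega> where \<omega>: "\<omega> \<in> loops B y" "c = loop_class B y \<omega>" by (rule pi1E[OF c])
  obtain \<sigma> where "path_lift E x p \<omega> \<sigma>" by (rule loop_path_lift[OF cov x \<omega>(1)])
  from is_lift_end_iff[OF cov \<omega>(1) this] show ?thesis unfolding \<omega>(2) by simp
qed

lemma lift_end_pi1_one:
  assumes cov: "covering_map E B p" and x: "x \<in> topspace E" "p x = y" and y: "y \<in> topspace B"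
  shows "lift_end E x p (pi1_one B y) = x"
  unfolding pi1_one_def
  using lift_end_eq[OF cov, of "\<lambda>_. y" y x "\<lambda>_. x"] x y by (simp add: loops_def path_lift_iff)

lemma lift_end_in_fibre:
  assumes cov: "covering_map E B p" and x: "x \<in> topspace E" "p x = y" and c: "c \<in> pi1 B y"
  shows "lift_end E x p c \<in> {t \<in> topspace E. p t = y}"
proof -
  obtain \<omega> where \<omega>: "\<omega> \<in> loops B y" "c = loop_class B y \<omega>" by (rule pi1E[OF c])
  show ?thesis unfolding \<omega>(2) by (rule loop_path_lift[OF cov x \<omega>(1)]) auto
qed

text \<open>Injectivity on \<open>\<pi>\<^sub>1\<close> is the lifting of null-homotopies.\<close>

lemma pi1_map_covering_kernel:
  assumes cov: "covering_map E B p" and x: "x \<in> topspace E" "p x = y"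
    and c: "c \<in> pi1 E x" "pi1_map B y p c = pi1_one B y"
  shows "c = pi1_one E x"
proof -
  obtain \<sigma> where \<sigma>: "\<sigma> \<in> loops E x" "c = loop_class E x \<sigma>" by (rule pi1E[OF c(1)])
  have p: "continuous_map E B p" using cov by (simp add: covering_map_def)
  have "loop_class B y (p \<circ> \<sigma>) = loop_class B y (\<lambda>_. y)"
    using c(2) pi1_map_loop_class[OF \<sigma>(1) p x(2)] \<sigma>(2) by (simp add: pi1_one_def)
  then have "path_homotopic B y y (p \<circ> \<sigma>) (\<lambda>_. y)"
    using loop_class_eq_iff[OF loops_compose[OF \<sigma>(1) p x(2)]] by simp
  from path_lift_homotopic[OF cov this, of x \<sigma> "\<lambda>_. x"]
  have "path_homotopic E x x \<sigma> (\<lambda>_. x)" using \<sigma>(1) x by (simp add: path_lift_iff loops_def)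
  then show ?thesis using loop_class_eq_iff[OF \<sigma>(1)] \<sigma>(2) by (simp add: pi1_one_def)
qed

text \<open>If \<open>\<omega>\<close> lifts to a loop \<open>\<sigma>\<close>, its class is the image of that of \<open>\<sigma>\<close>; conversely \<open>\<sigma>\<close> is itself the
  lift of \<open>p \<circ> \<sigma>\<close>.\<close>

lemma lift_end_kernel:
  assumes cov: "covering_map E B p" and x: "x \<in> topspace E" "p x = y"
  shows "pi1_map B y p ` pi1 E x = {c \<in> pi1 B y. lift_end E x p c = x}"
proof
  have p: "continuous_map E B p" using cov by (simp add: covering_map_def)
  show "pi1_map B y p ` pi1 E x \<subseteq> {c \<in> pi1 B y. lift_end E x p c = x}"
  proof
    fix c assume "c \<in> pi1_map B y p ` pi1 E x"
    then obtain \<sigma> where \<sigma>: "\<sigma> \<in> loops E x" "c = pi1_map B y p (loop_class E x \<sigma>)"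
      by (auto simp: pi1_def)
    have c: "c = loop_class B y (p \<circ> \<sigma>)" using pi1_map_loop_class[OF \<sigma>(1) p x(2)] \<sigma>(2) by simp
    have l: "p \<circ> \<sigma> \<in> loops B y" using loops_compose[OF \<sigma>(1) p x(2)] .
    have "lift_end E x p c = \<sigma> 1"
      unfolding c by (rule lift_end_eq[OF cov l]) (use \<sigma>(1) in \<open>auto simp: path_lift_iff loops_def\<close>)
    then show "c \<in> {c \<in> pi1 B y. lift_end E x p c = x}"
      using c l \<sigma>(1) by (auto simp: pi1_def loops_def)
  qed
  show "{c \<in> pi1 B y. lift_end E x p c = x} \<subseteq> pi1_map B y p ` pi1 E x"
  proof
    fix c assume "c \<in> {c \<in> pi1 B y. lift_end E x p c = x}"
    then obtain \<omega> where \<omega>: "\<omega> \<in> loops B y" "c = loop_class B y \<omega>" "lift_end E x p c = x"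
      by (auto simp: pi1_def)
    obtain \<sigma> where \<sigma>: "path_lift E x p \<omega> \<sigma>" "lift_end E x p (loop_class B y \<omega>) = \<sigma> 1"
      by (rule loop_path_lift[OF cov x \<omega>(1)])
    have l: "\<sigma> \<in> loops E x" using \<sigma> \<omega> by (auto simp: loops_def path_lift_iff)
    have "path_homotopic B y y (p \<circ> \<sigma>) \<omega>"
      using loops_compose[OF l p x(2)] \<sigma>(1)
      by (intro path_homotopic_equal) (auto simp: loops_def path_lift_iff)
    then have "pi1_map B y p (loop_class E x \<sigma>) = c"
      unfolding pi1_map_loop_class[OF l p x(2)] \<omega>(2)
      using loop_class_eq_iff[OF loops_compose[OF l p x(2)]] by simp
    moreover have "loop_class E x \<sigma> \<in> pi1 E x" using l by (simp add: pi1_def)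
    ultimately show "c \<in> pi1_map B y p ` pi1 E x" by (metis imageI)
  qed
qed

text \<open>A path in \<open>E\<close> between two points of the fibre lies over a loop.\<close>

lemma lift_end_image:
  assumes cov: "covering_map E B p" and x: "x \<in> topspace E" "p x = y"
  shows "lift_end E x p ` pi1 B y =
     {t \<in> topspace E. p t = y \<and> (\<exists>\<gamma>. pathin E \<gamma> \<and> \<gamma> 0 = x \<and> \<gamma> 1 = t)}"
proof
  have p: "continuous_map E B p" using cov by (simp add: covering_map_def)
  show "lift_end E x p ` pi1 B y \<subseteq>
     {t \<in> topspace E. p t = y \<and> (\<exists>\<gamma>. pathin E \<gamma> \<and> \<gamma> 0 = x \<and> \<gamma> 1 = t)}"
  proof
    fix t assume "t \<in> lift_end E x p ` pi1 B y"
    then obtain \<omega> where \<omega>: "\<omega> \<in> loops B y" "t = lift_end E x p (loop_class B y \<omega>)" by (auto simp: pi1_def)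
    show "t \<in> {t \<in> topspace E. p t = y \<and> (\<exists>\<gamma>. pathin E \<gamma> \<and> \<gamma> 0 = x \<and> \<gamma> 1 = t)}"
      unfolding \<omega>(2) by (rule loop_path_lift[OF cov x \<omega>(1)]) auto
  qed
  show "{t \<in> topspace E. p t = y \<and> (\<exists>\<gamma>. pathin E \<gamma> \<and> \<gamma> 0 = x \<and> \<gamma> 1 = t)} \<subseteq> lift_end E x p ` pi1 B y"
  proof
    fix t assume "t \<in> {t \<in> topspace E. p t = y \<and> (\<exists>\<gamma>. pathin E \<gamma> \<and> \<gamma> 0 = x \<and> \<gamma> 1 = t)}"
    then obtain \<gamma> where \<gamma>: "pathin E \<gamma>" "\<gamma> 0 = x" "\<gamma> 1 = t" "p t = y" by blast
    have l: "p \<circ> \<gamma> \<in> loops B y" using pathin_compose[OF \<gamma>(1) p] \<gamma> x by (simp add: loops_def)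
    have "lift_end E x p (loop_class B y (p \<circ> \<gamma>)) = t"
      using lift_end_eq[OF cov l, of x \<gamma>] \<gamma> by (simp add: path_lift_iff)
    moreover have "loop_class B y (p \<circ> \<gamma>) \<in> pi1 B y" using l by (simp add: pi1_def)
    ultimately show "t \<in> lift_end E x p ` pi1 B y" by (metis imageI)
  qed
qed

lemma covering_path_to_fibre:
  assumes cov: "covering_map E B p" and B: "path_connected_space B" "y \<in> topspace B"
    and e: "e \<in> topspace E"
  obtains \<sigma> where "pathin E \<sigma>" "\<sigma> 0 = e" "p (\<sigma> 1) = y"
proof -
  have "p e \<in> topspace B" using cov e by (auto simp: covering_map_def)
  then obtain \<gamma> where \<gamma>: "pathin B \<gamma>" "\<gamma> 0 = p e" "\<gamma> 1 = y"
    using B unfolding path_connected_space_def by blast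
  obtain \<sigma> where "path_lift E e p \<gamma> \<sigma>" by (rule path_lift_exists[OF cov \<gamma>(1) e]) (use \<gamma> in auto)
  then show thesis using that[of \<sigma>] \<gamma>(3) by (simp add: path_lift_iff)
qed

text \<open>The fibre is discrete, so its components are the singletons and \<open>boundary\<close> is \<open>lift_end\<close> up to
  the identification of \<open>t\<close> with \<open>{t}\<close>.  Since \<open>E\<close> is locally path-connected, points lie in one
  component exactly if a path joins them; thus exactness at \<open>\<pi>\<^sub>0(F)\<close> is \<open>lift_end_image\<close>, and surjectivity of
  the last map is \<open>covering_path_to_fibre\<close>.\<close>

theorem covering_exact_sequence:
  assumes cov: "covering_map E B p" and x: "x \<in> topspace E" "p x = y"
    and B: "path_connected_space B" "locally_path_connected_space B"
  shows "exact_sequence_0ABCD0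
       (pi1 E x, pi1_one E x) (pi1_map B y p)
       (pi1 B y, pi1_one B y) (boundary E x p y)
       (pi0 (fibre E p y), eta (fibre E p y) x) (pi0_map E (\<lambda>t. t))
       (pi0 E, eta E x)"
proof -
  let ?F = "fibre E p y"
  have p: "continuous_map E B p" using cov by (simp add: covering_map_def)
  have y: "y \<in> topspace B" using cov x by (auto simp: covering_map_def)
  have lhp: "local_homeomorphism E B p" by (rule covering_map_local_homeomorphism[OF cov])
  have E: "locally_path_connected_space E"
    by (rule local_homeomorphism_locally_path_connected[OF lhp B(2)])
  have tF: "topspace ?F = {t \<in> topspace E. p t = y}" by (auto simp: fibre_def)
  have xF: "x \<in> topspace ?F" using x by (simp add: tF)
  have F: "?F = discrete_topology (topspace ?F)" by (rule fibre_discrete[OF lhp])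
  have etaF: "eta ?F t = {t}" if "t \<in> topspace ?F" for t
    using connected_component_of_discrete_topology[of "topspace ?F" t] that unfolding F[symmetric] by simp
  have pi0F: "pi0 ?F = (\<lambda>t. {t}) ` topspace ?F"
    using connected_components_of_discrete_topology[of "topspace ?F"] unfolding F[symmetric] .
  have bd: "boundary E x p y c = {lift_end E x p c}" "lift_end E x p c \<in> topspace ?F" if "c \<in> pi1 B y" for c
    using lift_end_in_fibre[OF cov x that] etaF by (simp_all add: boundary_def tF)
  have map1: "pi1_map B y p c \<in> pi1 B y" if c: "c \<in> pi1 E x" for c
  proof -
    obtain \<sigma> where \<sigma>: "\<sigma> \<in> loops E x" "c = loop_class E x \<sigma>" by (rule pi1E[OF c])
    show ?thesis
      unfolding \<sigma>(2) pi1_map_loop_class[OF \<sigma>(1) p x(2)] pi1_def using loops_compose[OF \<sigma>(1) p x(2)] by blast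
  qed
  have one: "pi1_map B y p (pi1_one E x) = pi1_one B y"
    unfolding pi1_one_def using pi1_map_loop_class[of "\<lambda>_. x" E x, OF _ p x(2)] x by (simp add: loops_def comp_def)
  have oneE: "pi1_one E x \<in> pi1 E x" using pi1_one_in[OF x(1)] .
  have bd1: "boundary E x p y (pi1_one B y) = {x}"
    using bd(1)[OF pi1_one_in[OF y]] lift_end_pi1_one[OF cov x y] by simp
  have comp: "pi0_map E (\<lambda>t. t) {t} = eta E t" for t by (simp add: pi0_map_def)
  have pi0E: "eta E t \<in> pi0 E" if "t \<in> topspace E" for t using that by (simp add: connected_components_of_def)
  have eta_eq: "eta E t = eta E x \<longleftrightarrow> (\<exists>\<gamma>. pathin E \<gamma> \<and> \<gamma> 0 = x \<and> \<gamma> 1 = t)" if "t \<in> topspace E" for t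
    using mem_eta_iff[OF x(1), of t] eta_iff_path[OF E, of t x] that by metis
  have "exact_at ({()}, ()) (\<lambda>_. snd (pi1 E x, pi1_one E x)) (pi1 E x, pi1_one E x) (pi1_map B y p)
      (pi1 B y, pi1_one B y)"
    unfolding exact_at_def pointed_fun_def fst_conv snd_conv
  proof (intro conjI)
    have "{c \<in> pi1 E x. pi1_map B y p c = pi1_one B y} = {pi1_one E x}"
      using oneE one pi1_map_covering_kernel[OF cov x] by blast
    then show "(\<lambda>_. pi1_one E x) ` {()} = {c \<in> pi1 E x. pi1_map B y p c = pi1_one B y}" by simp
  qed (use map1 one oneE in auto)
  moreover have "exact_at (pi1 E x, pi1_one E x) (pi1_map B y p) (pi1 B y, pi1_one B y)
      (boundary E x p y) (pi0 ?F, eta ?F x)"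
    unfolding exact_at_def pointed_fun_def fst_conv snd_conv
  proof (intro conjI)
    show "pi1_map B y p ` pi1 E x = {b \<in> pi1 B y. boundary E x p y b = eta ?F x}"
      using lift_end_kernel[OF cov x] bd(1) etaF[OF xF] by auto
    show "boundary E x p y \<in> pi1 B y \<rightarrow> pi0 ?F"
      using bd pi0F by auto
  qed (use map1 one bd1 etaF[OF xF] in auto)
  moreover have "exact_at (pi1 B y, pi1_one B y) (boundary E x p y) (pi0 ?F, eta ?F x)
      (pi0_map E (\<lambda>t. t)) (pi0 E, eta E x)"
    unfolding exact_at_def pointed_fun_def fst_conv snd_conv
  proof (intro conjI)
    have "boundary E x p y ` pi1 B y = (\<lambda>t. {t}) ` (lift_end E x p ` pi1 B y)"
      unfolding image_image by (rule image_cong[OF refl bd(1)])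
    also have "\<dots> = (\<lambda>t. {t}) ` {t \<in> topspace ?F. eta E t = eta E x}"
      unfolding lift_end_image[OF cov x] tF using eta_eq by (intro arg_cong[of _ _ "image _"]) auto
    also have "\<dots> = {b \<in> pi0 ?F. pi0_map E (\<lambda>t. t) b = eta E x}"
      unfolding pi0F using comp by auto
    finally show "boundary E x p y ` pi1 B y = {b \<in> pi0 ?F. pi0_map E (\<lambda>t. t) b = eta E x}" .
    show "pi0_map E (\<lambda>t. t) \<in> pi0 ?F \<rightarrow> pi0 E"
      using pi0F comp pi0E tF by auto
    show "boundary E x p y \<in> pi1 B y \<rightarrow> pi0 ?F"
      using bd pi0F by auto
  qed (use bd1 etaF[OF xF] comp in auto)
  moreover have "exact_at (pi0 ?F, eta ?F x) (pi0_map E (\<lambda>t. t)) (pi0 E, eta E x) (\<lambda>_. ()) ({()}, ())"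
    unfolding exact_at_def pointed_fun_def fst_conv snd_conv
  proof (intro conjI)
    have "C \<in> pi0_map E (\<lambda>t. t) ` pi0 ?F" if C: "C \<in> pi0 E" for C
    proof -
      obtain e where e: "e \<in> topspace E" "C = eta E e" using C by (auto simp: connected_components_of_def)
      obtain \<sigma> where \<sigma>: "pathin E \<sigma>" "\<sigma> 0 = e" "p (\<sigma> 1) = y"
        by (rule covering_path_to_fibre[OF cov B(1) y e(1)])
      have t: "\<sigma> 1 \<in> topspace E" using path_finish_in_topspace[OF \<sigma>(1)] .
      have "\<sigma> 1 \<in> eta E e" using eta_iff_path[OF E] \<sigma> by blast
      then have "eta E (\<sigma> 1) = eta E e" using mem_eta_iff[OF e(1)] by blast
      then have "C = pi0_map E (\<lambda>t. t) {\<sigma> 1}" using comp e(2) by simp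
      then show ?thesis using pi0F tF t \<sigma>(3) by auto
    qed
    then show "pi0_map E (\<lambda>t. t) ` pi0 ?F = {b \<in> pi0 E. () = ()}"
      using pi0F comp pi0E tF by auto
    show "pi0_map E (\<lambda>t. t) \<in> pi0 ?F \<rightarrow> pi0 E"
      using pi0F comp pi0E tF by auto
  qed (use etaF[OF xF] comp in auto)
  ultimately show ?thesis unfolding exact_sequence_0ABCD0_def by blast
qed

section \<open>The universal covering and the connecting map\<close>

lemma galois_pi1_eq:
  assumes "universal_covering U w B y u"
  shows "galois_pi1 U w u y = {z \<in> topspace U. u z = y}"
proof -
  have U: "connected_space U" "w \<in> topspace U" using assms by (auto simp: universal_covering_def)
  have "eta U z = eta U w" if "z \<in> topspace U" for z
    using connected_space_imp_connected_component_of[OF U that] mem_eta_iff[OF U(2), of z] by blast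
  then show ?thesis unfolding galois_pi1_def by blast
qed

text \<open>Lifts of two loops to \<open>U\<close> with the same endpoint are homotopic because \<open>U\<close> is simply connected,
  and the homotopy projects to \<open>B\<close>; this gives injectivity.  Each point over \<open>y\<close> is joined to \<open>w\<close> by a
  path, which lies over a loop; this gives surjectivity.\<close>

lemma bij_betw_lift_end:
  assumes uc: "universal_covering U w B y u"
  shows "bij_betw (lift_end U w u) (pi1 B y) (galois_pi1 U w u y)"
proof -
  have cov: "covering_map U B u" and w: "w \<in> topspace U" "u w = y" and sc: "simply_connected_space U"
    using uc by (auto simp: universal_covering_def)
  have u: "continuous_map U B u" using cov by (simp add: covering_map_def)
  have "inj_on (lift_end U w u) (pi1 B y)"
  proof (rule inj_onI)
    fix c c' assume c: "c \<in> pi1 B y" "c' \<in> pi1 B y" "lift_end U w u c = lift_end U w u c'"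
    obtain \<omega> where \<omega>: "\<omega> \<in> loops B y" "c = loop_class B y \<omega>" by (rule pi1E[OF c(1)])
    obtain \<omega>' where \<omega>': "\<omega>' \<in> loops B y" "c' = loop_class B y \<omega>'" by (rule pi1E[OF c(2)])
    obtain \<sigma> where \<sigma>: "path_lift U w u \<omega> \<sigma>" "lift_end U w u (loop_class B y \<omega>) = \<sigma> 1"
      by (rule loop_path_lift[OF cov w \<omega>(1)])
    obtain \<sigma>' where \<sigma>': "path_lift U w u \<omega>' \<sigma>'" "lift_end U w u (loop_class B y \<omega>') = \<sigma>' 1"
      by (rule loop_path_lift[OF cov w \<omega>'(1)])
    have "path_homotopic U w (\<sigma> 1) \<sigma> \<sigma>'"
      using simply_connected_path_homotopic[OF sc, of \<sigma> \<sigma>'] \<sigma> \<sigma>' c(3) \<omega>(2) \<omega>'(2) by (auto simp: path_lift_iff)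
    then have "path_homotopic B (u w) (u (\<sigma> 1)) (u \<circ> \<sigma>) (u \<circ> \<sigma>')" by (rule path_homotopic_compose[OF _ u])
    moreover have "u w = y" "u (\<sigma> 1) = y" using w \<sigma>(1) \<omega>(1) by (auto simp: path_lift_iff loops_def)
    ultimately have h: "path_homotopic B y y (u \<circ> \<sigma>) (u \<circ> \<sigma>')" by simp
    have "path_homotopic B y y \<omega> (u \<circ> \<sigma>)" "path_homotopic B y y \<omega>' (u \<circ> \<sigma>')"
      using \<omega>(1) \<omega>'(1) \<sigma>(1) \<sigma>'(1)
      by (auto intro!: path_homotopic_equal simp: loops_def path_lift_iff)
    then have "path_homotopic B y y \<omega> \<omega>'"
      using h path_homotopic_sym path_homotopic_trans by metis
    then show "c = c'" using loop_class_eq_iff[OF \<omega>(1)] \<omega>(2) \<omega>'(2) by simp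
  qed
  moreover have "lift_end U w u ` pi1 B y = galois_pi1 U w u y"
  proof -
    have "\<exists>\<gamma>. pathin U \<gamma> \<and> \<gamma> 0 = w \<and> \<gamma> 1 = z" if "z \<in> topspace U" for z
      using sc w(1) that by (auto simp: simply_connected_space_def path_connected_space_def)
    then show ?thesis unfolding lift_end_image[OF cov w] galois_pi1_eq[OF uc] by blast
  qed
  ultimately show ?thesis by (simp add: bij_betw_def)
qed

lemma universal_covering_lift:
  assumes uc: "universal_covering U w B y u" and lpc: "locally_path_connected_space B"
    and cov: "covering_map E A p" and x: "x \<in> topspace E" "p x = g y" and g: "continuous_map B A g"
  shows "has_unique_lift E x p U w (g \<circ> u)"
proof -
  have u: "covering_map U B u" "w \<in> topspace U" "u w = y" "connected_space U" "simply_connected_space U"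
    using uc by (auto simp: universal_covering_def)
  have "locally_path_connected_space U"
    using local_homeomorphism_locally_path_connected[OF covering_map_local_homeomorphism[OF u(1)] lpc] .
  moreover have "continuous_map U A (g \<circ> u)"
    using u(1) by (intro continuous_map_compose[OF _ g]) (simp add: covering_map_def)
  ultimately show ?thesis
    using covering_map_has_unique_lift[OF cov u(5,4) _ u(2)] x u(3) by simp
qed

lemma delta_is_lift:
  assumes uc: "universal_covering U w B y u" and lpc: "locally_path_connected_space B"
    and cov: "covering_map E B p" and x: "x \<in> topspace E" "p x = y"
  shows "has_unique_lift E x p U w u" "is_lift E x p U w u (delta U w u E x p)"
proof -
  show l: "has_unique_lift E x p U w u"
    using universal_covering_lift[OF uc lpc cov x(1), of id] x(2) by simp
  show "is_lift E x p U w u (delta U w u E x p)" unfolding delta_def by (rule the_lift[OF l])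
qed

text \<open>The map \<open>U \<rightarrow> E\<close> over \<open>B\<close> carries the lift of a loop to \<open>U\<close> to its lift to \<open>E\<close>.\<close>

lemma lift_end_delta:
  assumes uc: "universal_covering U w B y u" and lpc: "locally_path_connected_space B"
    and cov: "covering_map E B p" and x: "x \<in> topspace E" "p x = y" and c: "c \<in> pi1 B y"
  shows "lift_end E x p c = delta U w u E x p (lift_end U w u c)"
proof -
  let ?d = "delta U w u E x p"
  have d: "continuous_map U E ?d" "?d w = x" "\<And>t. t \<in> topspace U \<Longrightarrow> p (?d t) = u t"
    using delta_is_lift(2)[OF uc lpc cov x] by (auto simp: is_lift_def)
  have u: "covering_map U B u" "w \<in> topspace U" "u w = y" using uc by (auto simp: universal_covering_def)
  obtain \<omega> where \<omega>: "\<omega> \<in> loops B y" "c = loop_class B y \<omega>" by (rule pi1E[OF c])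
  obtain \<sigma> where \<sigma>: "path_lift U w u \<omega> \<sigma>" "lift_end U w u (loop_class B y \<omega>) = \<sigma> 1"
    by (rule loop_path_lift[OF u \<omega>(1)])
  have "path_lift E x p \<omega> (?d \<circ> \<sigma>)"
    using \<sigma>(1) d pathin_compose[OF _ d(1), of \<sigma>] path_image_subset_topspace[of U \<sigma>]
    by (auto simp: path_lift_iff Pi_iff)
  from lift_end_eq[OF cov \<omega>(1) this] show ?thesis using \<sigma>(2) \<omega>(2) by simp
qed

text \<open>Both sides, as functions of \<open>z\<close>, lift \<open>g \<circ> u\<close> to \<open>E'\<close> and agree at the base-point.\<close>

lemma delta_natural:
  assumes uc: "universal_covering U w B y u" and lpc: "locally_path_connected_space B"
    and cov: "covering_map E B p" and x: "x \<in> topspace E" "p x = y"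
    and uc': "universal_covering U' w' B' y' u'" and lpc': "locally_path_connected_space B'"
    and cov': "covering_map E' B' p'" and x': "x' \<in> topspace E'" "p' x' = y'"
    and f: "continuous_map E E' f" "f x = x'" and g: "continuous_map B B' g" "g y = y'"
    and fg: "\<And>e. e \<in> topspace E \<Longrightarrow> p' (f e) = g (p e)" and z: "z \<in> topspace U"
  shows "delta U' w' u' E' x' p' (galois_pi1_map U w u U' w' u' g z) = f (delta U w u E x p z)"
proof -
  let ?d = "delta U w u E x p" and ?d' = "delta U' w' u' E' x' p'"
    and ?m = "galois_pi1_map U w u U' w' u' g"
  have u: "w \<in> topspace U" "connected_space U" using uc by (auto simp: universal_covering_def)
  have u': "covering_map U' B' u'" "w' \<in> topspace U'" "u' w' = y'"
    using uc' by (auto simp: universal_covering_def)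
  have d: "continuous_map U E ?d" "?d w = x" "\<And>t. t \<in> topspace U \<Longrightarrow> p (?d t) = u t"
    using delta_is_lift(2)[OF uc lpc cov x] by (auto simp: is_lift_def)
  have d': "continuous_map U' E' ?d'" "?d' w' = x'" "\<And>t. t \<in> topspace U' \<Longrightarrow> p' (?d' t) = u' t"
    using delta_is_lift(2)[OF uc' lpc' cov' x'] by (auto simp: is_lift_def)
  have "has_unique_lift U' w' u' U w (g \<circ> u)"
    using universal_covering_lift[OF uc lpc u'(1,2) _ g(1)] u'(3) g(2) by simp
  then have m: "continuous_map U U' ?m" "?m w = w'" "\<And>t. t \<in> topspace U \<Longrightarrow> u' (?m t) = g (u t)"
    using the_lift unfolding galois_pi1_map_def is_lift_def by fastforce+
  have mU: "?m t \<in> topspace U'" "?d t \<in> topspace E" if "t \<in> topspace U" for t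
    using m(1) d(1) that by (auto simp: continuous_map_def)
  have "(?d' \<circ> ?m) z = (f \<circ> ?d) z"
  proof (rule covering_map_unique_lift[OF cov' u(2) _ _ _ u(1) _ z])
    show "continuous_map U E' (?d' \<circ> ?m)" "continuous_map U E' (f \<circ> ?d)"
      using continuous_map_compose m(1) d'(1) d(1) f(1) by blast+
    show "p' ((?d' \<circ> ?m) t) = p' ((f \<circ> ?d) t)" if "t \<in> topspace U" for t
      using that d(3) d'(3) m(3) mU fg by simp
    show "(?d' \<circ> ?m) w = (f \<circ> ?d) w" using d(2) d'(2) m(2) f(2) by simp
  qed
  then show ?thesis by simp
qed

lemma normal_extension_points:
  assumes "normal_extension E x B y p"
  shows "x \<in> topspace E" "p x = y"
  using assms monadic_extension_sum_iff[of E x B y p]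
  by (auto simp: normal_extension_def etale_map_def loco_map_def pointed_loco_def)

section \<open>The exact sequence of a normal extension\<close>

theorem mainTheorem4:
  fixes B :: "'b topology" and y :: 'b and E :: "'e topology" and x :: 'e and p :: "'e \<Rightarrow> 'b"
  assumes base: "connected_space B" "locally_path_connected_space B"
      "semilocally_simply_connected_space B" "y \<in> topspace B"
    and normal: "normal_extension E x B y p"
  shows
    \<comment> \<open>the fibre \<open>F\<close> is discrete, and the unit identifies \<open>(F, x)\<close> with \<open>\<pi>\<^sub>0(F, x)\<close>\<close>
    "fibre E p y = discrete_topology (topspace (fibre E p y)) \<and>
     bij_betw (eta (fibre E p y)) (topspace (fibre E p y)) (pi0 (fibre E p y)) \<and>
     \<comment> \<open>the exact sequence\<close>
     exact_sequence_0ABCD0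
       (pi1 E x, pi1_one E x) (pi1_map B y p)
       (pi1 B y, pi1_one B y) (boundary E x p y)
       (pi0 (fibre E p y), eta (fibre E p y) x) (pi0_map E (\<lambda>t. t))
       (pi0 E, eta E x) \<and>
     \<comment> \<open>it is the low-dimensional part of the usual homotopy sequence: the boundary is well defined,
         components are path components, and the two outer terms of the usual sequence are trivial\<close>
     (\<forall>c \<in> pi1 B y. \<exists>!t. is_lift_end E x p c t) \<and>
     path_components_of (fibre E p y) = pi0 (fibre E p y) \<and>
     path_components_of E = pi0 E \<and>
     pi1 (fibre E p y) x = {pi1_one (fibre E p y) x} \<and>
     path_components_of B = {eta B y} \<and>
     \<comment> \<open>a universal covering exists, and for every universal covering the boundary is \<open>\<delta>\<^sub>p\<close>\<close>
     (\<exists>(U :: (real \<Rightarrow> 'b) set topology) w u. universal_covering U w B y u) \<and>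
     (\<forall>(U :: 'u topology) w u. universal_covering U w B y u \<longrightarrow>
        (\<forall>c \<in> pi1 B y. \<exists>!z. is_lift_end U w u c z) \<and>
        bij_betw (lift_end U w u) (pi1 B y) (galois_pi1 U w u y) \<and>
        lift_end U w u (pi1_one B y) = w \<and>
        has_unique_lift E x p U w u \<and>
        pointed_fun (galois_pi1 U w u y, w) (topspace (fibre E p y), x) (delta U w u E x p) \<and>
        (\<forall>c \<in> pi1 B y.
           boundary E x p y c = eta (fibre E p y) (delta U w u E x p (lift_end U w u c))) \<and>
        \<comment> \<open>naturality of \<open>\<delta>\<close> with respect to morphisms \<open>(f, g)\<close> from \<open>p\<close> to a normal extension \<open>p'\<close>\<close>
        (\<forall>(B' :: 'c topology) y' (E' :: 'd topology) x' p' (U' :: 'v topology) w' u' f g.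
           admissible_base B' y' \<and> normal_extension E' x' B' y' p' \<and>
           universal_covering U' w' B' y' u' \<and>
           loco_map E x E' x' f \<and> loco_map B y B' y' g \<and>
           (\<forall>e \<in> topspace E. p' (f e) = g (p e)) \<longrightarrow>
             has_unique_lift U' w' u' U w (g \<circ> u) \<and>
             (\<forall>z \<in> galois_pi1 U w u y.
                delta U' w' u' E' x' p' (galois_pi1_map U w u U' w' u' g z) =
                f (delta U w u E x p z))))"
proof -
  let ?F = "fibre E p y"
  have cov: "covering_map E B p" by (rule normal_extension_covering_map[OF normal])
  have x: "x \<in> topspace E" "p x = y" using normal_extension_points[OF normal] by auto
  have pc: "path_connected_space B"
    using base(1) path_connected_eq_connected_space[OF base(2)] by simp
  have lhp: "local_homeomorphism E B p" by (rule covering_map_local_homeomorphism[OF cov])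
  have E: "locally_path_connected_space E"
    by (rule local_homeomorphism_locally_path_connected[OF lhp base(2)])
  have tF: "topspace ?F = {t \<in> topspace E. p t = y}" by (auto simp: fibre_def)
  have F: "?F = discrete_topology (topspace ?F)" by (rule fibre_discrete[OF lhp])
  have etaF: "eta ?F t = {t}" if "t \<in> topspace ?F" for t
    using connected_component_of_discrete_topology[of "topspace ?F" t] that unfolding F[symmetric] by simp
  have pi0F: "pi0 ?F = (\<lambda>t. {t}) ` topspace ?F"
    using connected_components_of_discrete_topology[of "topspace ?F"] unfolding F[symmetric] .
  have bij: "bij_betw (eta ?F) (topspace ?F) (pi0 ?F)"
    unfolding bij_betw_def
  proof
    show "inj_on (eta ?F) (topspace ?F)" by (rule inj_onI) (simp only: etaF singleton_inject)
    show "eta ?F ` topspace ?F = pi0 ?F" unfolding connected_components_of_def ..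
  qed
  have pi1F: "pi1 ?F x = {pi1_one ?F x}"
    using pi1_discrete[of x "topspace ?F"] x tF unfolding F[symmetric] by simp
  have pcF: "path_components_of ?F = pi0 ?F"
    using path_components_of_discrete_topology[of "topspace ?F"] pi0F unfolding F[symmetric] by simp
  have pcE: "path_components_of E = pi0 E" by (rule path_components_eq_connected_components_of[OF E])
  have pcB: "path_components_of B = {eta B y}"
  proof -
    have "eta B y = topspace B"
      using connected_space_imp_connected_component_of[OF base(1,4)] connected_component_of_subset_topspace[of B y]
      by blast
    then show ?thesis using path_components_of_path_connected_space[OF pc] base(4) by auto
  qed
  have U: "\<exists>(U :: (real \<Rightarrow> 'b) set topology) w u. universal_covering U w B y u"
    using universal_covering_ucover[OF pc base(2-4)] by blast
  note exact = covering_exact_sequence[OF cov x pc base(2)]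
  have d: "continuous_map U E (delta U w u E x p)" "delta U w u E x p w = x"
      "\<And>t. t \<in> topspace U \<Longrightarrow> p (delta U w u E x p t) = u t"
    if "universal_covering U w B y u" for U :: "'u topology" and w u
    using delta_is_lift(2)[OF that base(2) cov x] by (auto simp: is_lift_def)
  have pf: "pointed_fun (galois_pi1 U w u y, w) (topspace ?F, x) (delta U w u E x p)"
    if "universal_covering U w B y u" for U :: "'u topology" and w u
    using d[OF that] by (auto simp: pointed_fun_def galois_pi1_eq[OF that] tF continuous_map_def Pi_iff)
  have bd: "boundary E x p y c = eta ?F (delta U w u E x p (lift_end U w u c))"
    if "universal_covering U w B y u" "c \<in> pi1 B y" for U :: "'u topology" and w u c
    unfolding boundary_def lift_end_delta[OF that(1) base(2) cov x that(2)] ..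
  have uc: "covering_map U B u" "w \<in> topspace U" "u w = y"
    if "universal_covering U w B y u" for U :: "'u topology" and w u
    using that by (auto simp: universal_covering_def)
  have nat: "has_unique_lift U' w' u' U w (g \<circ> u)"
      "\<And>z. z \<in> galois_pi1 U w u y \<Longrightarrow>
         delta U' w' u' E' x' p' (galois_pi1_map U w u U' w' u' g z) = f (delta U w u E x p z)"
    if uc: "universal_covering U w B y u"
      and h: "admissible_base B' y' \<and> normal_extension E' x' B' y' p' \<and>
           universal_covering U' w' B' y' u' \<and>
           loco_map E x E' x' f \<and> loco_map B y B' y' g \<and>
           (\<forall>e \<in> topspace E. p' (f e) = g (p e))"
    for U :: "'u topology" and w u and B' :: "'c topology" and y' and E' :: "'d topology" and x' p'
      and U' :: "'v topology" and w' u' f g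
  proof -
    have N': "normal_extension E' x' B' y' p'" and uc': "universal_covering U' w' B' y' u'"
      and lpc': "locally_path_connected_space B'"
      and f: "continuous_map E E' f" "f x = x'" and g: "continuous_map B B' g" "g y = y'"
      and fg: "\<And>e. e \<in> topspace E \<Longrightarrow> p' (f e) = g (p e)"
      using h by (auto simp: admissible_base_def loco_map_def)
    have u': "covering_map U' B' u'" "w' \<in> topspace U'" "u' w' = g y"
      using uc' g(2) by (auto simp: universal_covering_def)
    show "has_unique_lift U' w' u' U w (g \<circ> u)" by (rule universal_covering_lift[OF uc base(2) u' g(1)])
    show "delta U' w' u' E' x' p' (galois_pi1_map U w u U' w' u' g z) = f (delta U w u E x p z)"
      if "z \<in> galois_pi1 U w u y" for z
    proof (rule delta_natural[OF uc base(2) cov x uc' lpc' normal_extension_covering_map[OF N']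
            normal_extension_points[OF N'] f g fg])
      show "z \<in> topspace U" using that by (simp add: galois_pi1_def)
    qed
  qed
  show ?thesis
    by (intro conjI allI impI ballI;
        (fact F bij exact pcF pcE pi1F pcB U | rule ex1_is_lift_end[OF cov x], assumption
         | rule ex1_is_lift_end[OF uc], assumption+ | rule bij_betw_lift_end, assumption
         | rule lift_end_pi1_one[OF uc base(4)], assumption+
         | rule delta_is_lift(1)[OF _ base(2) cov x], assumption
         | rule pf, assumption | rule bd, assumption+ | rule nat, assumption+))
qed

end
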